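(* Let $K$ be an algebraically closed field of characteristic different from $2$, $g\ge 1$ an integer, $\alpha_1,\dots,\alpha_{2g+1}$ distinct elements of $K$, $f(x)=\prod_{i=1}^{2g+1}(x-\alpha_i)$, $\mathcal{C}$ the smooth projective model of $y^2=f(x)$, and $J$ its jacobian, with $\mathcal{C}$ embedded in $J$ so that $\infty\mapsto 0$. Let $P=(a,b)\in\mathcal{C}(K)$, i.e. $a,b\in K$ and $b^2=f(a)$. Then the $2^{2g}$-element set $$M_{1/2,P}:=\{\mathfrak{a}\in J(K)\mid 2\mathfrak{a}=P\in\mathcal{C}(K)\subset J(K)\}$$ can be described as follows. Let $\mathfrak{R}_{1/2,P}$ be the set of all $(2g+1)$-tuples $\mathfrak{r}=(\mathfrak{r}_1,\dots,\mathfrak{r}_{2g+1})$ of elements of $K$ such that $$\mathfrak{r}_i^2=a-\alpha_i\ \text{ for all } i=1,\dots,2g+1;\qquad \prod_{i=1}^{2g+1}\mathfrak{r}_i=-b.$$ Let $\mathbf{s}_i(\mathfrak{r})$ be the $i$th elementary symmetric function in $\mathfrak{r}_1,\dots,\mathfrak{r}_{2g+1}$, and put $$U_{\mathfrak{r}}(x)=(-1)^g\left[(a-x)^g+\sum_{j=1}^g\mathbf{s}_{2j}(\mathfrak{r})(a-x)^{g-j}\right],$$ $$V_{\mathfrak{r}}(x)=\sum_{j=1}^g\left(\mathbf{s}_{2j+1}(\mathfrak{r})-\mathbf{s}_1(\mathfrak{r})\mathbf{s}_{2j}(\mathfrak{r})\right)(a-x)^{g-j}.$$ Then there is a natural bijection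 between $\mathfrak{R}_{1/2,P}$ and $M_{1/2,P}$ such that $\mathfrak{r}\in\mathfrak{R}_{1/2,P}$ corresponds to the $\mathfrak{a}_{\mathfrak{r}}\in M_{1/2,P}$ with Mumford representation $(U_{\mathfrak{r}},V_{\mathfrak{r}})$. More explicitly, if $\{c_1,\dots,c_g\}$ is the list of all $g$ roots (with multiplicities) of $U_{\mathfrak{r}}(x)$, then $\mathfrak{r}$ corresponds to $$\mathfrak{a}_{\mathfrak{r}}=\mathrm{cl}(D-g(\infty))\in J(K),\qquad 2\mathfrak{a}_{\mathfrak{r}}=P,$$ where $$D=D(\mathfrak{a}_{\mathfrak{r}})=\sum_{j=1}^g(Q_j),\qquad Q_j=(c_j,V_{\mathfrak{r}}(c_j))\in\mathcal{C}(K)\ \text{ for all } j=1,\dots,g.$$ In addition, none of the $\alpha_i$ is a root of $U_{\mathfrak{r}}(x)$ (i.e., the polynomials $U_{\mathfrak{r}}(x)$ and $f(x)$ are relatively prime), and $$\mathfrak{r}_i=\mathbf{s}_1(\mathfrak{r})+(-1)^g\frac{V_{\mathfrak{r}}(\alpha_i)}{U_{\mathfrak{r}}(\alpha_i)}\ \text{ for all } i=1,\dots,2g+1.$$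
   Context: The curve $\mathcal{C}$ is a genus $g$ hyperelliptic curve with exactly one point at infinity, denoted $\infty$; its other $K$-points are the pairs $(a,b)\in K^2$ with $b^2=f(a)$. Put $\mathfrak{W}_i=(\alpha_i,0)\in\mathcal{C}(K)$, and let $\iota:\mathcal{C}\to\mathcal{C}$ be the hyperelliptic involution $(x,y)\mapsto(x,-y)$, $\infty\mapsto\infty$. For a degree zero divisor $D$ on $\mathcal{C}$, $\mathrm{cl}(D)\in J(K)$ denotes its linear equivalence class. A point $P\in\mathcal{C}(K)$ is identified with $\mathrm{cl}((P)-(\infty))\in J(K)$. Reduced divisors: if $D$ is an effective divisor of degree $m\le g$ with $\infty\notin\mathrm{supp}(D)$, then $D-m(\infty)$ is called reduced if each $\mathfrak{W}_i$ lying in $\mathrm{supp}(D)$ has multiplicity $1$ in $D$, and whenever $Q\in\mathrm{supp}(D)$ is not one of the $\mathfrak{W}_i$, then $\iota(Q)\notin\mathrm{supp}(D)$. Every $\mathfrak{a}\in J(K)$ equals $\mathrm{cl}(D-m(\infty))$ for exactly one such $m$ and $D$ with $D-m(\infty)$ reduced. Mumford representation: if $\mathfrak{a}=\mathrm{cl}(D-m(\infty))$ with $D-m(\infty)$ reduced and $D=\sum_{j=1}^m(Q_j)$, $Q_j=(a_j,b_j)$ (not necessarily distinct), the Mumford representation of $\mathfrak{a}$ is the unique pair $(U(x),V(x))$ of polynomials in $K[x]$ such that $U(x)=\prod_{j=1}^m(x-a_j)$, $\deg V<m=\deg U$, $U(x)$ divides $V(x)^2-f(x)$, and $b_j=V(a_j)$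 for all $j$. Conversely, any pair $(U,V)$ with $U$ monic of degree $m\le g$, $\deg V<\deg U$ and $U\mid V^2-f$ is the Mumford representation of exactly one $\mathfrak{a}\in J(K)$. *)

theory Defs
  imports
    "HOL-Algebra.Coset"
    "HOL-Algebra.Algebraic_Closure_Type"
    "HOL-Computational_Algebra.Computational_Algebra"
    "HOL-Library.FuncSet"
    "HOL-Library.Poly_Mapping"
begin

section \<open>The curve y^2 = f(x), its function field and its local rings\<close>

text \<open>
  Throughout, \<open>f\<close> is meant to be squarefree and monic of odd degree \<open>2 * genus f + 1\<close>.
  The smooth projective model is covered by the two affine charts \<open>y\<^sup>2 = f(x)\<close> and
  \<open>v\<^sup>2 = u\<^bsup>2 * genus f + 2\<^esup> f(1/u)\<close>, where \<open>u = 1/x\<close> and \<open>v = y/x\<^bsup>genus f + 1\<^esup>\<close>;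
  the second chart adds the single point \<open>(u, v) = (0, 0)\<close>.
\<close>

datatype 'a point = Infinity | Affine 'a 'a

definition genus :: "'a::field poly \<Rightarrow> nat" where
  "genus f = (degree f - 1) div 2"

definition curve :: "'a::field poly \<Rightarrow> 'a point set" where
  "curve f = insert Infinity {Affine a b | a b. b ^ 2 = poly f a}"

definition weierstrass :: "'a::field poly \<Rightarrow> 'a point set" where
  "weierstrass f = {Affine a 0 | a. poly f a = 0}"

fun invol :: "'a::field point \<Rightarrow> 'a point" where
  "invol Infinity = Infinity"
| "invol (Affine a b) = Affine a (- b)"

text \<open>
  The function field is realised as the subfield \<open>K(x)(y)\<close> of an algebraic closure of \<open>K(x)\<close>,
  where \<open>y\<close> is a fixed square root of \<open>f(x)\<close>.
\<close>

type_synonym 'a kx_closure = "'a poly fract alg_closure"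

definition kconst :: "'a::field \<Rightarrow> 'a kx_closure" where
  "kconst c = to_ac (to_fract [:c:])"

definition xfun :: "'a::field kx_closure" where
  "xfun = to_ac (to_fract [:0, 1:])"

definition yfun :: "'a::field poly \<Rightarrow> 'a kx_closure" where
  "yfun f = (SOME y. y ^ 2 = to_ac (to_fract f))"

definition function_field :: "'a::field poly \<Rightarrow> 'a kx_closure set" where
  "function_field f = {to_ac A + to_ac B * yfun f | A B. True}"

text \<open>
  On each of the two charts the square of the second coordinate is a polynomial in the first one,
  so the regular functions on the chart are the expressions \<open>A(s) + B(s) t\<close>, where
  \<open>s, t\<close> are the coordinates.
\<close>

definition reg_fun :: "'a::field kx_closure \<Rightarrow> 'a kx_closure \<Rightarrow> 'a poly \<Rightarrow> 'a poly \<Rightarrow> 'a kx_closure" where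
  "reg_fun s t A B = poly (map_poly kconst A) s + poly (map_poly kconst B) s * t"

text \<open>
  The local ring of the chart with coordinate functions \<open>s, t\<close> at its point \<open>(p, q)\<close>: quotients
  of regular functions whose denominator does not vanish at \<open>(p, q)\<close>.
\<close>

definition chart_local_ring ::
    "'a::field kx_closure \<Rightarrow> 'a kx_closure \<Rightarrow> 'a \<Rightarrow> 'a \<Rightarrow> 'a kx_closure set" where
  "chart_local_ring s t p q =
     {reg_fun s t A B / reg_fun s t C D | A B C D. poly C p + poly D p * q \<noteq> 0}"

fun local_ring :: "'a::field poly \<Rightarrow> 'a point \<Rightarrow> 'a kx_closure set" where
  "local_ring f (Affine a b) = chart_local_ring xfun (yfun f) a b"
| "local_ring f Infinity = chart_local_ring (1 / xfun) (yfun f / xfun ^ (genus f + 1)) 0 0"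

definition local_units :: "'a::field set \<Rightarrow> 'a set" where
  "local_units R = {u \<in> R. u \<noteq> 0 \<and> inverse u \<in> R}"

text \<open>A generator of the maximal ideal, i.e. of the set of non-units, of a local ring.\<close>

definition uniformizer :: "'a::field set \<Rightarrow> 'a \<Rightarrow> bool" where
  "uniformizer R t \<longleftrightarrow> t \<noteq> 0 \<and> R - local_units R = {t * h | h. h \<in> R}"

text \<open>Order of vanishing at a point of the curve (meaningful for nonzero rational functions).\<close>

definition ord_at :: "'a::field poly \<Rightarrow> 'a point \<Rightarrow> 'a kx_closure \<Rightarrow> int" where
  "ord_at f P h =
     (THE n. \<exists>t u. uniformizer (local_ring f P) t \<and> u \<in> local_units (local_ring f P) \<and>
                   h = t powi n * u)"


section \<open>Divisors and the group of points of the jacobian\<close>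

type_synonym 'a divisor = "'a point \<Rightarrow>\<^sub>0 int"

abbreviation pt_div :: "'a point \<Rightarrow> 'a divisor" where
  "pt_div P \<equiv> Poly_Mapping.single P 1"

definition div_degree :: "'a divisor \<Rightarrow> int" where
  "div_degree D = (\<Sum>P\<in>Poly_Mapping.keys D. Poly_Mapping.lookup D P)"

definition principal_divisors :: "'a::field poly \<Rightarrow> 'a divisor set" where
  "principal_divisors f =
     {D. Poly_Mapping.keys D \<subseteq> curve f \<and>
         (\<exists>h\<in>function_field f. h \<noteq> 0 \<and> (\<forall>P\<in>curve f. Poly_Mapping.lookup D P = ord_at f P h))}"

definition Div0 :: "'a::field poly \<Rightarrow> 'a divisor monoid" where
  "Div0 f = \<lparr>carrier = {D. Poly_Mapping.keys D \<subseteq> curve f \<and> div_degree D = 0}, monoid.mult = (+), one = 0\<rparr>"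

text \<open>
  For algebraically closed \<open>K\<close>, \<open>J(K)\<close> is the group of classes of degree zero divisors
  modulo linear equivalence.
\<close>

definition jacobian :: "'a::field poly \<Rightarrow> 'a divisor set monoid" where
  "jacobian f = Div0 f Mod principal_divisors f"

definition cl :: "'a::field poly \<Rightarrow> 'a divisor \<Rightarrow> 'a divisor set" where
  "cl f D = principal_divisors f #>\<^bsub>Div0 f\<^esub> D"

definition embed :: "'a::field poly \<Rightarrow> 'a point \<Rightarrow> 'a divisor set" where
  "embed f P = cl f (pt_div P - pt_div Infinity)"

text \<open>\<open>reduced f m D\<close> says that \<open>D - m(\<infinity>)\<close> is a reduced divisor.\<close>

definition reduced :: "'a::field poly \<Rightarrow> nat \<Rightarrow> 'a divisor \<Rightarrow> bool" where
  "reduced f m D \<longleftrightarrow>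
     Poly_Mapping.keys D \<subseteq> curve f - {Infinity} \<and> (\<forall>P. Poly_Mapping.lookup D P \<ge> 0) \<and>
     div_degree D = int m \<and> m \<le> genus f \<and>
     (\<forall>W\<in>weierstrass f \<inter> Poly_Mapping.keys D. Poly_Mapping.lookup D W = 1) \<and>
     (\<forall>Q\<in>Poly_Mapping.keys D - weierstrass f. invol Q \<notin> Poly_Mapping.keys D)"

text \<open>
  The list \<open>qs\<close> contains the coordinates of the points \<open>Q\<^sub>j = (a\<^sub>j, b\<^sub>j)\<close>, with repetitions.
  The zero polynomial has degree 0 in HOL, so \<open>deg V < m\<close> needs the extra case \<open>V = 0\<close>.
\<close>

definition mumford_rep :: "'a::field poly \<Rightarrow> 'a divisor set \<Rightarrow> 'a poly \<Rightarrow> 'a poly \<Rightarrow> bool" where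
  "mumford_rep f \<aa> U V \<longleftrightarrow>
     (\<exists>m D qs. reduced f m D \<and>
        \<aa> = cl f (D - Poly_Mapping.single Infinity (int m)) \<and>
        length qs = m \<and> D = (\<Sum>(a, b)\<leftarrow>qs. pt_div (Affine a b)) \<and>
        U = (\<Prod>(a, b)\<leftarrow>qs. [:- a, 1:]) \<and>
        (V = 0 \<or> degree V < m) \<and> U dvd V ^ 2 - f \<and>
        (\<forall>(a, b)\<in>set qs. b = poly V a))"

definition halves :: "'a::field poly \<Rightarrow> 'a point \<Rightarrow> 'a divisor set set" where
  "halves f P = {\<aa> \<in> carrier (jacobian f). \<aa> \<otimes>\<^bsub>jacobian f\<^esub> \<aa> = embed f P}"


section \<open>Tuples of square roots and the associated polynomials\<close>

definition root_tuples :: "nat \<Rightarrow> (nat \<Rightarrow> 'a::field) \<Rightarrow> 'a \<Rightarrow> 'a \<Rightarrow> (nat \<Rightarrow> 'a) set" where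
  "root_tuples g \<alpha> a b =
     {r \<in> {1..2*g+1} \<rightarrow>\<^sub>E UNIV.
        (\<forall>i\<in>{1..2*g+1}. (r i) ^ 2 = a - \<alpha> i) \<and> (\<Prod>i=1..2*g+1. r i) = - b}"

definition elem_sym :: "nat \<Rightarrow> (nat \<Rightarrow> 'a::comm_ring_1) \<Rightarrow> nat \<Rightarrow> 'a" where
  "elem_sym n r k = (\<Sum>S | S \<subseteq> {1..n} \<and> card S = k. \<Prod>i\<in>S. r i)"

text \<open>The polynomial \<open>[:a, -1:]\<close> is \<open>a - x\<close>.\<close>

definition U_poly :: "nat \<Rightarrow> 'a::field \<Rightarrow> (nat \<Rightarrow> 'a) \<Rightarrow> 'a poly" where
  "U_poly g a r =
     (-1) ^ g * ([:a, -1:] ^ g +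
       (\<Sum>j=1..g. smult (elem_sym (2*g+1) r (2*j)) ([:a, -1:] ^ (g - j))))"

definition V_poly :: "nat \<Rightarrow> 'a::field \<Rightarrow> (nat \<Rightarrow> 'a) \<Rightarrow> 'a poly" where
  "V_poly g a r =
     (\<Sum>j=1..g. smult (elem_sym (2*g+1) r (2*j+1)
                        - elem_sym (2*g+1) r 1 * elem_sym (2*g+1) r (2*j))
                 ([:a, -1:] ^ (g - j)))"

text \<open>
  The divisor \<open>\<Sum>\<^sub>j (c\<^sub>j, V(c\<^sub>j))\<close>, where \<open>c\<^sub>j\<close> runs through the roots of \<open>U\<close> with multiplicities.
\<close>

definition root_divisor :: "'a::field poly \<Rightarrow> 'a poly \<Rightarrow> 'a divisor" where
  "root_divisor U V = (\<Sum>c\<in>#proots U. pt_div (Affine c (poly V c)))"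

end

(*
  Put t = a - x and write the product of all (w + r_i), where w^2 = t, as w A(t) + B(t). Multiplying
  with the same expression for - w gives f = B^2 + (x - a) A^2, B(alpha_i) = r_i A(alpha_i) and
  B(a) = - b, while U = (-1)^g A and V = B - s_1 A. The first identity is the norm of y - B, hence
  div(y - B) = 2 D + (a, - b) - (2g + 1) infinity for D = D(a_r); subtracting div(x - a) shows
  that the class of D - g infinity is a half of P.

  Conversely, a half of P is the class of some E - m infinity, with E effective, affine
  and of degree m <= g. Then 2 E + (a, - b) - (2m + 1) infinity is the divisor of a function h
  without affine poles, so h is a polynomial in x and y. Its pole order is odd and at most 2g + 1,
  which forces m = g and h = y - v up to a constant. By the parity of its orders the norm of y - v
  has the form v^2 - f = - (x - a) A^2, and r_i = v(alpha_i) / A(alpha_i) is the required tuple,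
  because (A, v) is determined by these 2g + 1 ratios.

  Orders are computed from norms: the orders of A + B y at the points above x = c add up to the
  multiplicity of c as a root of A^2 - f B^2.
*)
theory Submission
  imports Defs
begin

section \<open>Orders in a discrete valuation ring inside a field\<close>

text \<open>That a half of P has a representative E - m infinity with m <= g rests on Riemann's
  inequality for multiples of infinity, obtained here by counting pole orders. As x and y have poles
  of order 2 and 2g + 1 at infinity, polynomials in x and y realise every pole order except the g
  gaps 1, 3, ..., 2g - 1, and each prescribed zero costs at most one pole order. So a set of n >= g
  points, with multiplicity, lies on the zeros of a function of pole order at most n + g, which
  leaves at most g further zeros.

  That distinct tuples give distinct classes has a similar reason. If D and D' are equivalent, then
  D + iota D' is cut out by a function of pole order 2g < 2g + 1, hence by a polynomial in x. Its
  symmetry recovers D, because D never contains two conjugate points. This determines A, and B up to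
  a sign, which is read off at a root of A.

  As \<open>ord_at\<close> is a definite description, orders are computed with the relation
  \<open>has_ord\<close>; the affine chart and the chart at infinity are instances of one
  locale.\<close>

definition has_ord :: "'l::field set \<Rightarrow> 'l \<Rightarrow> int \<Rightarrow> bool" where
  "has_ord R h n \<longleftrightarrow> (\<exists>t u. uniformizer R t \<and> u \<in> local_units R \<and> h = t powi n * u)"

text \<open>Only closure is required here; that \<open>R\<close> is a discrete valuation ring enters
  lemma by lemma through a uniformizer, usually the one contained in a \<open>has_ord\<close>
  hypothesis.\<close>

locale field_subring =
  fixes R :: "'l::field set"
  assumes one_closed: "1 \<in> R"
    and diff_closed: "x \<in> R \<Longrightarrow> y \<in> R \<Longrightarrow> x - y \<in> R"
    and mult_closed: "x \<in> R \<Longrightarrow> y \<in> R \<Longrightarrow> x * y \<in> R"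
begin

lemma zero_closed: "0 \<in> R"
  using diff_closed[OF one_closed one_closed] by simp

lemma add_closed: "x \<in> R \<Longrightarrow> y \<in> R \<Longrightarrow> x + y \<in> R"
  using diff_closed[of x "0 - y"] diff_closed[of 0 y] zero_closed by simp

lemma power_closed: "x \<in> R \<Longrightarrow> x ^ (n::nat) \<in> R"
  by (induction n) (auto intro: one_closed mult_closed)

lemma units_one: "1 \<in> local_units R"
  by (auto simp: local_units_def one_closed)

lemma units_mult: "u \<in> local_units R \<Longrightarrow> v \<in> local_units R \<Longrightarrow> u * v \<in> local_units R"
  by (auto simp: local_units_def intro: mult_closed)

lemma units_inverse: "u \<in> local_units R \<Longrightarrow> inverse u \<in> local_units R"
  by (auto simp: local_units_def)

lemma units_power: "u \<in> local_units R \<Longrightarrow> u ^ (n::nat) \<in> local_units R"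
  by (induction n) (auto intro: units_one units_mult)

lemma units_powi: "u \<in> local_units R \<Longrightarrow> u powi n \<in> local_units R"
  by (auto simp: power_int_def intro: units_power units_inverse)

lemma uniformizer_nonzero: "uniformizer R t \<Longrightarrow> t \<noteq> 0"
  by (simp add: uniformizer_def)

lemma uniformizer_multiple_nonunit:
  assumes "uniformizer R t" "h \<in> R"
  shows "t * h \<in> R" "t * h \<notin> local_units R"
  using assms unfolding uniformizer_def by blast+

lemma uniformizer_closed: "uniformizer R t \<Longrightarrow> t \<in> R"
  using uniformizer_multiple_nonunit(1)[of t 1] one_closed by simp

text \<open>Each of the two is a non-unit and thus a multiple of the other. Orders therefore do not
  depend on the uniformizer.\<close>

lemma uniformizers_associated:
  assumes "uniformizer R t" "uniformizer R t'"
  shows "\<exists>u\<in>local_units R. t' = t * u"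
proof -
  have "t' \<in> R - local_units R" "t \<in> R - local_units R"
    using uniformizer_multiple_nonunit[OF assms(1) one_closed]
      uniformizer_multiple_nonunit[OF assms(2) one_closed] by auto
  then obtain u u' where u: "u \<in> R" "t' = t * u" and u': "u' \<in> R" "t = t' * u'"
    using assms unfolding uniformizer_def by blast
  have "t = t * (u * u')" using u(2) u'(2) by (metis mult.assoc)
  then have "u * u' = 1" using uniformizer_nonzero[OF assms(1)] by (metis mult_cancel_left1)
  then have "u \<noteq> 0" "inverse u = u'" by (auto intro: inverse_unique)
  then show ?thesis using u u' by (auto simp: local_units_def)
qed

lemma has_ord_fixed_uniformizer:
  assumes "uniformizer R t" "has_ord R h n"
  obtains u where "u \<in> local_units R" "h = t powi n * u"
proof -
  from assms(2) obtain t' v where v: "uniformizer R t'" "v \<in> local_units R" "h = t' powi n * v"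
    unfolding has_ord_def by blast
  obtain w where w: "w \<in> local_units R" "t' = t * w"
    using uniformizers_associated[OF assms(1) v(1)] by blast
  have "h = t powi n * (w powi n * v)"
    using v w by (simp add: power_int_mult_distrib)
  moreover have "w powi n * v \<in> local_units R" using v w by (intro units_mult units_powi)
  ultimately show ?thesis using that by blast
qed

lemma has_ordI: "uniformizer R t \<Longrightarrow> u \<in> local_units R \<Longrightarrow> h = t powi n * u \<Longrightarrow> has_ord R h n"
  unfolding has_ord_def by blast

lemma has_ord_uniformizer_ex: "has_ord R h n \<Longrightarrow> \<exists>t. uniformizer R t"
  unfolding has_ord_def by blast

lemma has_ord_unit: "uniformizer R t \<Longrightarrow> u \<in> local_units R \<Longrightarrow> has_ord R u 0"
  by (rule has_ordI) auto

lemma has_ord_uniformizer: "uniformizer R t \<Longrightarrow> has_ord R t 1"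
  by (rule has_ordI[of t 1]) (auto intro: units_one)

lemma has_ord_nonzero: "has_ord R h n \<Longrightarrow> h \<noteq> 0"
  unfolding has_ord_def uniformizer_def local_units_def by auto

lemma has_ord_mult:
  assumes "has_ord R h n" "has_ord R h' m"
  shows "has_ord R (h * h') (n + m)"
proof -
  obtain t where t: "uniformizer R t" using assms(1) has_ord_uniformizer_ex by blast
  obtain u where u: "u \<in> local_units R" "h = t powi n * u"
    using has_ord_fixed_uniformizer[OF t assms(1)] .
  obtain v where v: "v \<in> local_units R" "h' = t powi m * v"
    using has_ord_fixed_uniformizer[OF t assms(2)] .
  show ?thesis
    using has_ordI[OF t units_mult[OF u(1) v(1)], of "h * h'" "n + m"] u v uniformizer_nonzero[OF t]
    by (simp add: power_int_add)
qed

lemma has_ord_inverse: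
  assumes "has_ord R h n"
  shows "has_ord R (inverse h) (- n)"
proof -
  obtain t u where u: "uniformizer R t" "u \<in> local_units R" "h = t powi n * u"
    using assms unfolding has_ord_def by blast
  then show ?thesis
    using has_ordI[OF u(1) units_inverse[OF u(2)], of "inverse h" "- n"]
    by (simp add: power_int_minus)
qed

text \<open>A negative order would make \<open>t\<close> invertible inside \<open>R\<close>,
  although all its multiples are non-units. Later comparisons of orders are reduced to this
  criterion.\<close>

lemma has_ord_closed_iff:
  assumes "has_ord R h n"
  shows "h \<in> R \<longleftrightarrow> n \<ge> 0"
proof
  obtain t u where u: "uniformizer R t" "u \<in> local_units R" "h = t powi n * u"
    using assms unfolding has_ord_def by blast
  have uR: "u \<in> R" "inverse u \<in> R" "u \<noteq> 0" using u(2) by (auto simp: local_units_def)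
  {
    assume "n \<ge> 0"
    then have "h = t ^ nat n * u" using u(3) by (simp add: power_int_def)
    then show "h \<in> R" using uR uniformizer_closed[OF u(1)] by (auto intro: mult_closed power_closed)
  }
  {
    assume h: "h \<in> R"
    show "n \<ge> 0"
    proof (rule ccontr)
      assume "\<not> n \<ge> 0"
      then obtain k where k: "n = - int (Suc k)"
        by (metis int_cases of_nat_0_le_iff)
      have "h * inverse u = inverse (t ^ Suc k)"
        using u(3) k uR by (simp add: power_int_minus del: of_nat_Suc power_Suc)
      then have "t * (t ^ k * (h * inverse u)) = 1"
        using uniformizer_nonzero[OF u(1)] by (simp add: field_simps)
      moreover have "t ^ k * (h * inverse u) \<in> R"
        using uniformizer_closed[OF u(1)] h uR by (intro mult_closed power_closed)
      ultimately show False
        using uniformizer_multiple_nonunit(2)[OF u(1)] units_one by metis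
    qed
  }
qed

lemma has_ord_unique:
  assumes "has_ord R h n" "has_ord R h m"
  shows "n = m"
proof -
  have *: "n \<ge> m" if "has_ord R h n" "has_ord R h m" for n m
  proof -
    \<comment> \<open>Thus 1 has order \<open>n - m\<close>, and since 1 lies in \<open>R\<close>
      this is nonnegative.\<close>
    have "has_ord R (h * inverse h) (n + - m)"
      using that by (intro has_ord_mult has_ord_inverse)
    moreover have "h * inverse h = 1" using has_ord_nonzero[OF that(1)] by simp
    ultimately show ?thesis using has_ord_closed_iff[of 1 "n - m"] one_closed by simp
  qed
  show ?thesis using *[of n m] *[of m n] assms by simp
qed

text \<open>Both summands lie in \<open>R\<close> after division by \<open>t\<close> to the smaller
  order. The order of the sum is a hypothesis because the sum may vanish and then has none.\<close>

lemma has_ord_add: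
  assumes "has_ord R h n" "has_ord R h' m" "has_ord R (h + h') k"
  shows "k \<ge> min n m"
proof -
  obtain t where t: "uniformizer R t" using assms(1) has_ord_uniformizer_ex by blast
  define l where "l = min n m"
  have tl: "has_ord R (t powi (- l)) (- l)"
    by (rule has_ordI[OF t units_one]) simp
  have "h * t powi (- l) \<in> R"
    using has_ord_mult[OF assms(1) tl] has_ord_closed_iff l_def by fastforce
  moreover have "h' * t powi (- l) \<in> R"
    using has_ord_mult[OF assms(2) tl] has_ord_closed_iff l_def by fastforce
  ultimately have "(h + h') * t powi (- l) \<in> R"
    by (simp add: distrib_right add_closed)
  then show ?thesis
    using has_ord_mult[OF assms(3) tl] has_ord_closed_iff l_def by fastforce
qed

text \<open>Here \<open>h + h'\<close> is \<open>h\<close> times \<open>1 + t * w\<close>, which is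
  a unit because otherwise \<open>t\<close> would divide 1 in \<open>R\<close>. In contrast to
  \<open>has_ord_add\<close>, the existence of the order of the sum is part of the
  conclusion.\<close>

lemma has_ord_add_less:
  assumes "has_ord R h n" "has_ord R h' m" "n < m"
  shows "has_ord R (h + h') n"
proof -
  obtain t where t: "uniformizer R t" using assms(1) has_ord_uniformizer_ex by blast
  have h0: "h \<noteq> 0" using has_ord_nonzero assms(1) by blast
  have "has_ord R (h' * inverse h * inverse t) (m + - n + - 1)"
    by (intro has_ord_mult has_ord_inverse assms has_ord_uniformizer t)
  then have "h' * inverse h * inverse t \<in> R"
    using has_ord_closed_iff[of "h' * inverse h * inverse t" "m + - n + - 1"] assms(3) by simp
  moreover define w where "w = h' * inverse h * inverse t"
  ultimately have w: "w \<in> R" "h' * inverse h = t * w"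
    using uniformizer_nonzero[OF t] by simp_all
  have "1 + t * w \<in> local_units R"
  proof (rule ccontr)
    assume "1 + t * w \<notin> local_units R"
    moreover have "1 + t * w \<in> R"
      using w one_closed uniformizer_closed[OF t] by (intro add_closed mult_closed)
    ultimately obtain w' where "w' \<in> R" "1 + t * w = t * w'"
      using t unfolding uniformizer_def by blast
    then have "1 = t * (w' - w)" "w' - w \<in> R" using w diff_closed by (auto simp: algebra_simps)
    then show False using uniformizer_multiple_nonunit(2)[OF t] units_one by metis
  qed
  then have "has_ord R (h * (1 + t * w)) (n + 0)"
    by (intro has_ord_mult assms has_ord_unit[OF t])
  moreover have "h * (1 + t * w) = h + h'"
    unfolding w(2)[symmetric] using h0 by (simp add: field_simps)
  ultimately show ?thesis by simp
qed

text \<open>\<open>C\<close> stands for the field of constants. The quotient of \<open>h\<close> and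
  \<open>h'\<close> has order 0, and subtracting its residue cancels the leading term. The
  conclusion is conditional since the difference may be zero.\<close>

lemma has_ord_cancel_leading:
  assumes residue: "\<And>u. u \<in> R \<Longrightarrow> \<exists>c\<in>C. u - c \<in> R - local_units R"
    and "has_ord R h n" "has_ord R h' n"
  shows "\<exists>c\<in>C. \<forall>m. has_ord R (h - c * h') m \<longrightarrow> m > n"
proof -
  obtain t where t: "uniformizer R t" using assms(2) has_ord_uniformizer_ex by blast
  have "has_ord R (h * inverse h') 0"
    using has_ord_mult[OF assms(2) has_ord_inverse[OF assms(3)]] by simp
  then have "h * inverse h' \<in> R" using has_ord_closed_iff by blast
  then obtain c where c: "c \<in> C" "h * inverse h' - c \<in> R - local_units R"
    using residue by blast
  then obtain w where w: "w \<in> R" "h * inverse h' - c = t * w"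
    using t unfolding uniformizer_def by blast
  have "h - c * h' = t * w * h'"
    unfolding w(2)[symmetric] using has_ord_nonzero[OF assms(3)] by (simp add: field_simps)
  have "m > n" if m: "has_ord R (h - c * h') m" for m
  proof -
    have "has_ord R ((h - c * h') * (inverse h' * inverse t)) (m + (- n + - 1))"
      by (intro has_ord_mult has_ord_inverse m assms has_ord_uniformizer t)
    moreover have "(h - c * h') * (inverse h' * inverse t) = w"
      using \<open>h - c * h' = t * w * h'\<close> has_ord_nonzero[OF assms(3)] uniformizer_nonzero[OF t]
      by (simp add: field_simps)
    ultimately show ?thesis using has_ord_closed_iff[of w] w(1) by fastforce
  qed
  then show ?thesis using c by blast
qed

end

lemma ord_at_eqI:
  assumes "field_subring (local_ring f P)" "has_ord (local_ring f P) h n"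
  shows "ord_at f P h = n"
proof -
  have "ord_at f P h = (THE n. has_ord (local_ring f P) h n)"
    by (simp add: ord_at_def has_ord_def)
  also have "\<dots> = n"
    using assms field_subring.has_ord_unique by (intro the_equality) blast+
  finally show ?thesis .
qed

section \<open>Local rings of the chart \<open>t\<^sup>2 = F(s)\<close>\<close>

lemma kconst_0 [simp]: "kconst 0 = 0"
  by (simp add: kconst_def)

lemma kconst_1 [simp]: "kconst 1 = 1"
  by (simp add: kconst_def flip: one_pCons)

lemma kconst_add [simp]: "kconst (x + y) = kconst x + kconst y"
  by (simp add: kconst_def flip: to_ac_add to_fract_add)

lemma kconst_mult [simp]: "kconst (x * y) = kconst x * kconst y"
  by (simp add: kconst_def flip: to_ac_mult to_fract_mult)

lemma kconst_uminus: "kconst (- x) = - kconst x"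
  using kconst_add[of x "- x"] by (simp add: eq_neg_iff_add_eq_0 add.commute del: kconst_add)

lemma kconst_eq_0_iff [simp]: "kconst x = 0 \<longleftrightarrow> x = 0"
  by (simp add: kconst_def)

definition kpoly :: "'a::field kx_closure \<Rightarrow> 'a poly \<Rightarrow> 'a kx_closure" where
  "kpoly s A = poly (map_poly kconst A) s"

lemma map_poly_kconst_simps:
  "map_poly kconst (A + B) = map_poly kconst A + map_poly kconst B"
  "map_poly kconst (A * B) = map_poly kconst A * map_poly kconst B"
  "map_poly kconst (pCons c A) = pCons (kconst c) (map_poly kconst A)"
proof -
  show add: "map_poly kconst (A + B) = map_poly kconst A + map_poly kconst B" for A B :: "'a poly"
    by (intro poly_eqI) (simp add: coeff_map_poly)
  show pc: "map_poly kconst (pCons c A) = pCons (kconst c) (map_poly kconst A)" for c and A :: "'a poly"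
    by (intro poly_eqI) (simp add: coeff_map_poly coeff_pCons split: nat.splits)
  have sm: "map_poly kconst (smult c B) = smult (kconst c) (map_poly kconst B)" for c and B :: "'a poly"
    by (intro poly_eqI) (simp add: coeff_map_poly)
  show "map_poly kconst (A * B) = map_poly kconst A * map_poly kconst B"
    by (induction A) (simp_all add: add pc sm)
qed

lemma kpoly_0 [simp]: "kpoly s 0 = 0"
  by (simp add: kpoly_def)

lemma kpoly_pCons: "kpoly s (pCons c A) = kconst c + s * kpoly s A"
  by (simp add: kpoly_def map_poly_kconst_simps)

lemma kpoly_1 [simp]: "kpoly s 1 = 1"
  by (simp add: one_pCons kpoly_pCons)

lemma kpoly_add: "kpoly s (A + B) = kpoly s A + kpoly s B"
  by (simp add: kpoly_def map_poly_kconst_simps)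

lemma kpoly_mult: "kpoly s (A * B) = kpoly s A * kpoly s B"
  by (simp add: kpoly_def map_poly_kconst_simps)

lemma kpoly_uminus: "kpoly s (- A) = - kpoly s A"
  using kpoly_add[of s A "- A"] by (simp add: eq_neg_iff_add_eq_0 add.commute)

lemma kpoly_diff: "kpoly s (A - B) = kpoly s A - kpoly s B"
  using kpoly_add[of s A "- B"] by (simp add: kpoly_uminus)

lemma kpoly_smult: "kpoly s (smult c A) = kconst c * kpoly s A"
  using kpoly_mult[of s "[:c:]" A] by (simp add: kpoly_pCons)

lemma kpoly_power: "kpoly s (A ^ n) = kpoly s A ^ n"
  by (induction n) (simp_all add: kpoly_mult)

lemma reg_fun_eq: "reg_fun s t A B = kpoly s A + kpoly s B * t"
  by (simp add: reg_fun_def kpoly_def)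

text \<open>Keeps products with the linear factors \<open>[:- p, 1:]\<close> unexpanded.\<close>

declare mult_pCons_left [simp del] mult_pCons_right [simp del]

text \<open>One theory for both charts of the curve. The simple root \<open>c0\<close> ensures that
  \<open>F\<close> is not a square; smoothness at the point under consideration is stated separately
  in \<open>point\<close>.\<close>

locale chart =
  fixes s t :: "'a::alg_closed_field kx_closure" and F :: "'a poly" and c0 :: 'a
  assumes transcendental: "kpoly s A = 0 \<Longrightarrow> A = 0"
    and curve_eq: "t ^ 2 = kpoly s F"
    and F_nonzero: "F \<noteq> 0"
    and simple_root: "order c0 F = 1"
    and two: "(2::'a) \<noteq> 0"
begin

abbreviation "reg \<equiv> reg_fun s t"

definition norm_poly :: "'a poly \<Rightarrow> 'a poly \<Rightarrow> 'a poly" where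
  "norm_poly A B = A ^ 2 - F * B ^ 2"

lemma norm_poly_mult: "norm_poly (C * A) (C * B) = C ^ 2 * norm_poly A B"
  by (simp add: norm_poly_def algebra_simps power2_eq_square)

text \<open>At \<open>c0\<close> the order of \<open>A ^ 2\<close> is even and that of
  \<open>F * B ^ 2\<close> is odd.\<close>

lemma norm_poly_nonzero:
  assumes "A \<noteq> 0 \<or> B \<noteq> 0"
  shows "norm_poly A B \<noteq> 0"
proof
  assume "norm_poly A B = 0"
  then have eq: "A ^ 2 = F * B ^ 2" by (simp add: norm_poly_def)
  then have nz: "A \<noteq> 0" "B \<noteq> 0" using assms F_nonzero by auto
  have "order c0 (A ^ 2) = 2 * order c0 A"
    using nz by (simp add: power2_eq_square order_mult)
  moreover have "order c0 (F * B ^ 2) = 1 + 2 * order c0 B"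
    using nz F_nonzero simple_root by (simp add: power2_eq_square order_mult)
  ultimately show False unfolding eq by presburger
qed

lemma reg_mult: "reg A B * reg C D = reg (A * C + F * B * D) (A * D + B * C)"
  using curve_eq by (simp add: reg_fun_eq kpoly_mult kpoly_add power2_eq_square algebra_simps)

lemma reg_conj_mult: "reg A B * reg A (- B) = kpoly s (norm_poly A B)"
  unfolding reg_mult by (simp add: reg_fun_eq norm_poly_def power2_eq_square mult.commute mult.left_commute)

lemma reg_diff: "reg A B - reg C D = reg (A - C) (B - D)"
  by (simp add: reg_fun_eq kpoly_diff algebra_simps)

lemma reg_const_mult: "kconst c * reg A B = reg (smult c A) (smult c B)"
  by (simp add: reg_fun_eq kpoly_smult algebra_simps)

lemma reg_poly [simp]: "reg A 0 = kpoly s A"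
  by (simp add: reg_fun_eq)

lemma reg_eq_0_iff [simp]: "reg A B = 0 \<longleftrightarrow> A = 0 \<and> B = 0"
proof
  assume "reg A B = 0"
  then have "kpoly s (norm_poly A B) = 0" by (simp flip: reg_conj_mult)
  then show "A = 0 \<and> B = 0" using transcendental norm_poly_nonzero by blast
qed (simp add: reg_fun_eq)

lemma reg_eq_iff: "reg A B = reg C D \<longleftrightarrow> A = C \<and> B = D"
  using reg_eq_0_iff[of "A - C" "B - D"] reg_diff[of A B C D] by auto

abbreviation "R p q \<equiv> chart_local_ring s t p q"

text \<open>A smooth point of the chart: where \<open>t\<close> vanishes, \<open>F\<close> must have
  a simple zero.\<close>

definition point :: "'a \<Rightarrow> 'a \<Rightarrow> bool" where
  "point p q \<longleftrightarrow> q ^ 2 = poly F p \<and> (q \<noteq> 0 \<or> order p F = 1)"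

definition val :: "'a \<Rightarrow> 'a \<Rightarrow> 'a poly \<Rightarrow> 'a poly \<Rightarrow> 'a" where
  "val p q A B = poly A p + poly B p * q"

lemma R_iff: "x \<in> R p q \<longleftrightarrow> (\<exists>A B C D. val p q C D \<noteq> 0 \<and> x = reg A B / reg C D)"
  unfolding chart_local_ring_def val_def by blast

lemma val_nonzero: "val p q A B \<noteq> 0 \<Longrightarrow> reg A B \<noteq> 0"
  by (auto simp: val_def)

lemma val_conj: "val p q A (- B) = val p (- q) A B"
  by (simp add: val_def)

lemma val_mult:
  "point p q \<Longrightarrow> val p q (A * C + F * B * D) (A * D + B * C) = val p q A B * val p q C D"
  by (simp add: val_def point_def power2_eq_square algebra_simps)

lemma val_norm_poly: "point p q \<Longrightarrow> val p q A B * val p q A (- B) = poly (norm_poly A B) p"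
  by (simp add: val_def point_def norm_poly_def power2_eq_square algebra_simps)

lemma val_eq_0_both:
  assumes "q \<noteq> 0" "val p q A B = 0" "val p (- q) A B = 0"
  shows "poly A p = 0" "poly B p = 0"
proof -
  have "2 * poly A p = val p q A B + val p (- q) A B"
    by (simp add: val_def)
  then show "poly A p = 0" using assms two by simp
  then show "poly B p = 0" using assms by (simp add: val_def)
qed

text \<open>Where \<open>q = 0\<close> the function \<open>s - p\<close> has a double zero and
  \<open>t\<close> a simple one; elsewhere \<open>s - p\<close> is a local parameter.\<close>

definition unif :: "'a \<Rightarrow> 'a \<Rightarrow> 'a kx_closure" where
  "unif p q = (if q = 0 then t else kpoly s [:- p, 1:])"

text \<open>The ramification index of \<open>s\<close>, that is, the order of \<open>s - p\<close>
  at \<open>(p, q)\<close>.\<close>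

definition ram :: "'a \<Rightarrow> int" where
  "ram q = (if q = 0 then 2 else 1)"

context
  fixes p q :: 'a
  assumes pt: "point p q"
begin

lemma R_subring: "field_subring (R p q)"
proof
  show "1 \<in> R p q"
    unfolding R_iff by (rule exI[of _ 1], rule exI[of _ 0], rule exI[of _ 1], rule exI[of _ 0])
      (simp add: val_def)
next
  fix x y assume "x \<in> R p q" "y \<in> R p q"
  then obtain A B C D A' B' C' D'
    where x: "val p q C D \<noteq> 0" "x = reg A B / reg C D"
      and y: "val p q C' D' \<noteq> 0" "y = reg A' B' / reg C' D'"
    unfolding R_iff by blast
  have nz: "reg C D \<noteq> 0" "reg C' D' \<noteq> 0" using x y val_nonzero by blast+
  have d: "val p q (C * C' + F * D * D') (C * D' + D * C') \<noteq> 0"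
    using x y val_mult[OF pt] by simp
  have "x - y = (reg A B * reg C' D' - reg C D * reg A' B') / (reg C D * reg C' D')"
    unfolding x(2) y(2) using nz by (simp add: diff_frac_eq mult.commute)
  then show "x - y \<in> R p q" unfolding R_iff reg_mult reg_diff using d by blast
  have "x * y = (reg A B * reg A' B') / (reg C D * reg C' D')"
    using x y by simp
  then show "x * y \<in> R p q" unfolding R_iff reg_mult using d by blast
qed

interpretation field_subring "R p q" by (rule R_subring)

lemma quotient_unit:
  assumes "val p q A B \<noteq> 0" "val p q C D \<noteq> 0"
  shows "reg A B / reg C D \<in> local_units (R p q)"
proof -
  have "reg A B / reg C D \<in> R p q" "reg C D / reg A B \<in> R p q"
    unfolding R_iff using assms by blast+
  then show ?thesis
    using val_nonzero[OF assms(1)] val_nonzero[OF assms(2)] by (simp add: local_units_def)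
qed

text \<open>Regular functions determine their coefficients (\<open>reg_eq_iff\<close>), so an
  equation between cross products can be evaluated at the point; an inverse in \<open>R p q\<close>
  would equate zero with a nonzero value.\<close>

lemma quotient_nonunit:
  assumes "val p q A B = 0" "val p q C D \<noteq> 0"
  shows "reg A B / reg C D \<in> R p q - local_units (R p q)"
proof -
  have "reg A B / reg C D \<in> R p q" unfolding R_iff using assms by blast
  moreover have "reg A B / reg C D \<notin> local_units (R p q)"
  proof
    assume u: "reg A B / reg C D \<in> local_units (R p q)"
    then have "inverse (reg A B / reg C D) \<in> R p q" by (simp add: local_units_def)
    then obtain A' B' C' D'
      where i: "val p q C' D' \<noteq> 0" "inverse (reg A B / reg C D) = reg A' B' / reg C' D'"
      unfolding R_iff by blast
    have "reg A B \<noteq> 0" using u by (auto simp: local_units_def simp del: reg_eq_0_iff)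
    then have "reg C D * reg C' D' = reg A B * reg A' B'"
      using i val_nonzero[OF i(1)] val_nonzero[OF assms(2)] by (simp add: field_simps del: reg_eq_0_iff)
    then have "val p q C D * val p q C' D' = val p q A B * val p q A' B'"
      unfolding reg_mult reg_eq_iff val_mult[OF pt, symmetric] by simp
    then show False using assms i by simp
  qed
  ultimately show ?thesis by blast
qed

lemma nonunit_quotient:
  assumes "x \<in> R p q - local_units (R p q)"
  obtains A B C D where "val p q C D \<noteq> 0" "val p q A B = 0" "x = reg A B / reg C D"
proof -
  obtain A B C D where x: "val p q C D \<noteq> 0" "x = reg A B / reg C D"
    using DiffD1[OF assms] unfolding R_iff by blast
  then have "val p q A B = 0" using assms quotient_unit by blast
  then show ?thesis using that x by blast
qed

text \<open>The residue field is the base field: the constant is the value of the quotient at the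
  point.\<close>

lemma residue:
  assumes "u \<in> R p q"
  shows "\<exists>c\<in>range kconst. u - c \<in> R p q - local_units (R p q)"
proof -
  obtain A B C D where u: "val p q C D \<noteq> 0" "u = reg A B / reg C D"
    using assms unfolding R_iff by blast
  define c where "c = val p q A B / val p q C D"
  have "u - kconst c = (reg A B - kconst c * reg C D) / reg C D"
    using u val_nonzero[OF u(1)] by (simp add: field_simps)
  also have "\<dots> = reg (A - smult c C) (B - smult c D) / reg C D"
    by (simp add: reg_const_mult reg_diff)
  also have "\<dots> \<in> R p q - local_units (R p q)"
    using u(1) by (intro quotient_nonunit) (simp_all add: val_def c_def field_simps)
  finally show ?thesis by blast
qed

lemma F_split: "q = 0 \<Longrightarrow> \<exists>F1. F = [:- p, 1:] * F1 \<and> poly F1 p \<noteq> 0"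
  using pt order_decomp[OF F_nonzero, of p] by (fastforce simp: point_def poly_eq_0_iff_dvd)

lemma root_split: "poly A p = 0 \<Longrightarrow> \<exists>A'. A = [:- p, 1:] * A'"
  by (auto simp: poly_eq_0_iff_dvd dvd_def)

lemma unif_factor:
  assumes "val p q A B = 0"
  shows "\<exists>A' B' C D. val p q C D \<noteq> 0 \<and> reg A B * reg C D = unif p q * reg A' B'"
proof (cases "q = 0")
  case True
  obtain F1 where F1: "F = [:- p, 1:] * F1" "poly F1 p \<noteq> 0" using F_split True by blast
  have "poly A p = 0" using assms True by (simp add: val_def)
  then obtain A1 where A1: "A = [:- p, 1:] * A1" using root_split by blast
  \<comment> \<open>Multiplying by the unit \<open>F1\<close> completes \<open>[:- p, 1:]\<close> to
    \<open>F\<close>, which becomes \<open>t ^ 2\<close>, so that one \<open>t\<close> can be taken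
    out.\<close>
  have "reg A B * reg F1 0 = kpoly s A1 * kpoly s F + kpoly s (B * F1) * t"
    unfolding F1(1) A1 by (simp add: reg_fun_eq kpoly_mult algebra_simps)
  also have "\<dots> = t * reg (B * F1) A1"
    by (simp add: reg_fun_eq curve_eq[symmetric] power2_eq_square algebra_simps)
  finally show ?thesis
    using F1(2) True by (intro exI[of _ "B * F1"] exI[of _ A1] exI[of _ F1] exI[of _ 0])
      (simp add: val_def unif_def)
next
  case False
  show ?thesis
  \<comment> \<open>If the conjugate vanishes too, both coefficients are divisible by
    \<open>[:- p, 1:]\<close>. Otherwise the conjugate can be used as denominator and the norm
    supplies the factor.\<close>
  proof (cases "val p q A (- B) = 0")
    case True
    then have "poly A p = 0" "poly B p = 0"
      using val_eq_0_both[OF False assms] by (simp_all only: val_conj)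
    then obtain A1 B1 where "A = [:- p, 1:] * A1" "B = [:- p, 1:] * B1" using root_split by blast
    then have "reg A B * reg 1 0 = unif p q * reg A1 B1"
      using False by (simp add: reg_fun_eq unif_def kpoly_mult algebra_simps)
    then show ?thesis
      by (intro exI[of _ A1] exI[of _ B1] exI[of _ 1] exI[of _ 0]) (simp add: val_def)
  next
    case nz: False
    have "poly (norm_poly A B) p = 0" using val_norm_poly[OF pt, of A B] assms by simp
    then obtain N where "norm_poly A B = [:- p, 1:] * N" using root_split by blast
    then have "reg A B * reg A (- B) = unif p q * reg N 0"
      unfolding reg_conj_mult using False
      by (simp add: unif_def kpoly_mult)
    then show ?thesis using nz by blast
  qed
qed

lemma unif_eq_reg: "\<exists>A B. unif p q = reg A B \<and> val p q A B = 0"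
proof (cases "q = 0")
  case True
  then have "unif p q = reg 0 1 \<and> val p q 0 1 = 0" by (simp add: unif_def reg_fun_eq val_def)
  then show ?thesis by blast
next
  case False
  then have "unif p q = reg [:- p, 1:] 0 \<and> val p q [:- p, 1:] 0 = 0" by (simp add: unif_def val_def)
  then show ?thesis by blast
qed

lemma unif_nonzero: "unif p q \<noteq> 0"
  by (auto simp: unif_def dest: transcendental) (use curve_eq F_nonzero transcendental in force)

lemma uniformizer_unif: "uniformizer (R p q) (unif p q)"
  unfolding uniformizer_def
proof (intro conjI unif_nonzero equalityI subsetI)
  fix x assume "x \<in> R p q - local_units (R p q)"
  then obtain A B C D where x: "val p q C D \<noteq> 0" "val p q A B = 0" "x = reg A B / reg C D"
    by (rule nonunit_quotient)
  obtain A' B' C' D' where f: "val p q C' D' \<noteq> 0" "reg A B * reg C' D' = unif p q * reg A' B'"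
    using unif_factor[OF x(2)] by blast
  have "x = unif p q * (reg A' B' / (reg C D * reg C' D'))"
    unfolding x(3) times_divide_eq_right f(2)[symmetric]
    using val_nonzero[OF x(1)] val_nonzero[OF f(1)] by (simp del: reg_eq_0_iff)
  moreover have "reg A' B' / (reg C D * reg C' D') \<in> R p q"
    using x(1) f(1) val_mult[OF pt] unfolding R_iff reg_mult by (metis mult_eq_0_iff)
  ultimately show "x \<in> {unif p q * h | h. h \<in> R p q}" by blast
next
  fix x assume "x \<in> {unif p q * h | h. h \<in> R p q}"
  then obtain A B C D where x: "val p q C D \<noteq> 0" "x = unif p q * (reg A B / reg C D)"
    unfolding R_iff by blast
  obtain A' B' where u: "unif p q = reg A' B'" "val p q A' B' = 0" using unif_eq_reg by blast
  have "x = reg (A' * A + F * B' * B) (A' * B + B' * A) / reg C D"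
    using x u by (simp flip: reg_mult)
  then show "x \<in> R p q - local_units (R p q)"
    using quotient_nonunit x(1) u(2) val_mult[OF pt] by simp
qed

lemma reg_unit: "val p q A B \<noteq> 0 \<Longrightarrow> reg A B \<in> local_units (R p q)"
  using quotient_unit[of A B 1 0] by (simp add: val_def)

lemma has_ord_reg_0: "val p q A B \<noteq> 0 \<Longrightarrow> has_ord (R p q) (reg A B) 0"
  using has_ord_unit[OF uniformizer_unif reg_unit] .

lemma has_ord_power: "has_ord (R p q) h n \<Longrightarrow> has_ord (R p q) (h ^ k) (int k * n)"
proof (induction k)
  case 0
  show ?case using has_ord_unit[OF uniformizer_unif units_one] by simp
next
  case (Suc k)
  then show ?case using has_ord_mult[of h n "h ^ k" "int k * n"] by (simp add: algebra_simps)
qed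

lemma has_ord_linear: "has_ord (R p q) (kpoly s [:- p, 1:]) (ram q)"
proof (cases "q = 0")
  case True
  obtain F1 where F1: "F = [:- p, 1:] * F1" "poly F1 p \<noteq> 0" using F_split True by blast
  have "has_ord (R p q) (t * t) (1 + 1)"
    using uniformizer_unif True by (intro has_ord_mult has_ord_uniformizer) (simp_all add: unif_def)
  moreover have "has_ord (R p q) (inverse (reg F1 0)) (- 0)"
    by (intro has_ord_inverse has_ord_reg_0) (simp add: val_def F1)
  ultimately have "has_ord (R p q) (t * t * inverse (reg F1 0)) (1 + 1 + - 0)"
    by (rule has_ord_mult)
  moreover have "t * t * inverse (reg F1 0) = kpoly s [:- p, 1:]"
    using curve_eq F1 val_nonzero[of p q F1 0]
    by (simp add: power2_eq_square kpoly_mult val_def)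
  ultimately show ?thesis using True by (simp add: ram_def)
next
  case False
  then show ?thesis using has_ord_uniformizer[OF uniformizer_unif] by (simp add: unif_def ram_def)
qed

lemma has_ord_kpoly:
  assumes "A \<noteq> 0"
  shows "has_ord (R p q) (kpoly s A) (ram q * order p A)"
proof -
  obtain A1 where A1: "A = [:- p, 1:] ^ order p A * A1" "\<not> [:- p, 1:] dvd A1"
    using order_decomp[OF assms] by blast
  have "has_ord (R p q) (kpoly s [:- p, 1:] ^ order p A * reg A1 0) (int (order p A) * ram q + 0)"
    using A1(2) by (intro has_ord_mult has_ord_power has_ord_linear has_ord_reg_0)
      (simp add: val_def poly_eq_0_iff_dvd)
  moreover have "kpoly s [:- p, 1:] ^ order p A * reg A1 0 = kpoly s A"
    by (subst (2) A1(1)) (simp add: kpoly_mult kpoly_power)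
  ultimately show ?thesis by (simp add: mult.commute)
qed

text \<open>If the function does not vanish at the conjugate point, its conjugate is a unit here, so
  the norm accounts for the whole order.\<close>

lemma has_ord_reg_opposite:
  assumes "val p (- q) A B \<noteq> 0"
  shows "has_ord (R p q) (reg A B) (ram q * order p (norm_poly A B))"
proof -
  have v: "val p q A (- B) \<noteq> 0" using assms by (simp add: val_conj)
  have "A \<noteq> 0 \<or> B \<noteq> 0" using assms by (auto simp: val_def)
  then have "has_ord (R p q) (kpoly s (norm_poly A B) * inverse (reg A (- B)))
      (ram q * order p (norm_poly A B) + - 0)"
    by (intro has_ord_mult has_ord_kpoly has_ord_inverse has_ord_reg_0 norm_poly_nonzero v)
  moreover have "kpoly s (norm_poly A B) * inverse (reg A (- B)) = reg A B"
    using val_nonzero[OF v] by (simp flip: reg_conj_mult del: reg_eq_0_iff)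
  ultimately show ?thesis by simp
qed

end

text \<open>After this splitting \<open>A1 + B1 t\<close> cannot vanish at both points above
  \<open>p\<close> if they are distinct (\<open>val_eq_0_both\<close>), and at a point with
  \<open>q = 0\<close> its order is at most 1.\<close>

lemma common_factor_split:
  assumes "A \<noteq> 0 \<or> B \<noteq> (0 :: 'a poly)"
  obtains n A1 B1 where "A = [:- p, 1:] ^ n * A1" "B = [:- p, 1:] ^ n * B1"
    "poly A1 p \<noteq> 0 \<or> poly B1 p \<noteq> 0"
proof (cases "B \<noteq> 0 \<and> (A = 0 \<or> order p B \<le> order p A)")
  case True
  then obtain B1 where "B = [:- p, 1:] ^ order p B * B1" "\<not> [:- p, 1:] dvd B1"
    using order_decomp by blast
  moreover have "[:- p, 1:] ^ order p B dvd A" using True by (auto simp: order_divides)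
  ultimately show ?thesis using that unfolding dvd_def poly_eq_0_iff_dvd by metis
next
  case False
  then have "A \<noteq> 0" using assms by blast
  then obtain A1 where "A = [:- p, 1:] ^ order p A * A1" "\<not> [:- p, 1:] dvd A1"
    using order_decomp by blast
  moreover have "[:- p, 1:] ^ order p A dvd B" using False by (auto simp: order_divides)
  ultimately show ?thesis using that unfolding dvd_def poly_eq_0_iff_dvd by metis
qed

lemma order_norm_split:
  assumes "A1 \<noteq> 0 \<or> B1 \<noteq> 0"
  shows "order p (norm_poly ([:- p, 1:] ^ n * A1) ([:- p, 1:] ^ n * B1))
    = 2 * n + order p (norm_poly A1 B1)"
proof -
  have "norm_poly ([:- p, 1:] ^ n * A1) ([:- p, 1:] ^ n * B1)
      = [:- p, 1:] ^ (2 * n) * norm_poly A1 B1"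
    unfolding norm_poly_mult by (simp only: power_mult[symmetric] mult.commute[of n 2])
  then show ?thesis
    using norm_poly_nonzero[OF assms] by (simp add: order_mult order_power_n_n)
qed

text \<open>Conjugation fixes this point, so a function and its conjugate have equal order, while
  the norm has twice its polynomial order because \<open>s\<close> is ramified. The proof checks
  this after removing common factors, when the order is 0 or 1.\<close>

lemma has_ord_reg_weierstrass:
  assumes pt: "point p 0" and nz: "A \<noteq> 0 \<or> B \<noteq> 0"
  shows "has_ord (R p 0) (reg A B) (order p (norm_poly A B))"
proof -
  interpret field_subring "R p 0" by (rule R_subring[OF pt])
  obtain n A1 B1 where s: "A = [:- p, 1:] ^ n * A1" "B = [:- p, 1:] ^ n * B1"
    "poly A1 p \<noteq> 0 \<or> poly B1 p \<noteq> 0"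
    using common_factor_split[OF nz] by metis
  have nz1: "A1 \<noteq> 0 \<or> B1 \<noteq> 0" using s(3) by auto
  have *: "has_ord (R p 0) (reg A1 B1) (order p (norm_poly A1 B1))"
  proof (cases "poly A1 p = 0")
    case False
    then have "poly (norm_poly A1 B1) p \<noteq> 0"
      using pt by (simp add: norm_poly_def point_def)
    then have "order p (norm_poly A1 B1) = 0" by (rule order_0I)
    then show ?thesis using has_ord_reg_0[OF pt] False by (simp add: val_def)
  next
    case True
    obtain F1 where F1: "F = [:- p, 1:] * F1" "poly F1 p \<noteq> 0" using F_split[OF pt] by blast
    obtain A2 where A2: "A1 = [:- p, 1:] * A2" using root_split[OF pt True] by blast
    have "has_ord (R p 0) (t * reg (B1 * F1) A2 * inverse (reg F1 0)) (1 + 0 + - 0)"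
      using uniformizer_unif[OF pt] F1(2) s(3) True
      by (intro has_ord_mult has_ord_inverse has_ord_uniformizer has_ord_reg_0[OF pt])
        (simp_all add: val_def unif_def)
    moreover have "t * reg (B1 * F1) A2 * inverse (reg F1 0) = reg A1 B1"
    proof -
      have "reg A1 B1 * reg F1 0 = kpoly s A2 * kpoly s F + kpoly s (B1 * F1) * t"
        unfolding F1(1) A2 by (simp add: reg_fun_eq kpoly_mult algebra_simps)
      also have "\<dots> = t * reg (B1 * F1) A2"
        by (simp add: reg_fun_eq curve_eq[symmetric] power2_eq_square algebra_simps)
      finally have "t * reg (B1 * F1) A2 = reg A1 B1 * reg F1 0" by simp
      then show ?thesis using F1(2) val_nonzero[of p 0 F1 0]
        by (simp add: val_def del: reg_poly reg_eq_0_iff)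
    qed
    moreover have "order p (norm_poly A1 B1) = 1"
    proof -
      have e: "norm_poly A1 B1 = [:- p, 1:] ^ 1 * ([:- p, 1:] * A2 ^ 2 - F1 * B1 ^ 2)"
        unfolding norm_poly_def unfolding F1(1) A2 by (simp add: power2_eq_square algebra_simps)
      have v: "poly ([:- p, 1:] * A2 ^ 2 - F1 * B1 ^ 2) p \<noteq> 0"
        using F1(2) s(3) True by simp
      then have "[:- p, 1:] * A2 ^ 2 - F1 * B1 ^ 2 \<noteq> 0" by (metis poly_0)
      then show ?thesis
        unfolding e using order_0I[OF v] order_power_n_n[of p 1]
        by (subst order_mult) auto
    qed
    ultimately show ?thesis by simp
  qed
  have "has_ord (R p 0) (kpoly s [:- p, 1:] ^ n * reg A1 B1) (int n * 2 + order p (norm_poly A1 B1))"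
    using has_ord_linear[OF pt] by (intro has_ord_mult has_ord_power * pt) (simp add: ram_def)
  moreover have "kpoly s [:- p, 1:] ^ n * reg A1 B1 = reg A B"
    unfolding s by (simp add: reg_fun_eq kpoly_mult kpoly_power distrib_left mult.assoc)
  ultimately show ?thesis unfolding s(1,2) order_norm_split[OF nz1] by (simp add: mult.commute)
qed

lemma has_ord_reg_fiber:
  assumes pt: "point p q" and q: "q \<noteq> 0" and nz: "A \<noteq> 0 \<or> B \<noteq> 0"
  shows "\<exists>(m::nat) (m'::nat). has_ord (R p q) (reg A B) (int m) \<and> has_ord (R p (- q)) (reg A B) (int m') \<and>
    int m + int m' = int (order p (norm_poly A B))"
proof -
  have pt': "point p (- q)" using pt by (simp add: point_def)
  have ram: "ram q = 1" "ram (- q) = 1" using q by (simp_all add: ram_def)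
  interpret P: field_subring "R p q" by (rule R_subring[OF pt])
  interpret P': field_subring "R p (- q)" by (rule R_subring[OF pt'])
  obtain n A1 B1 where s: "A = [:- p, 1:] ^ n * A1" "B = [:- p, 1:] ^ n * B1"
    "poly A1 p \<noteq> 0 \<or> poly B1 p \<noteq> 0"
    using common_factor_split[OF nz] by metis
  have nz1: "A1 \<noteq> 0 \<or> B1 \<noteq> 0" using s(3) by auto
  have "\<exists>(m::nat) (m'::nat). has_ord (R p q) (reg A1 B1) (int m) \<and> has_ord (R p (- q)) (reg A1 B1) (int m') \<and>
      int m + int m' = int (order p (norm_poly A1 B1))"
  \<comment> \<open>At most one of the two points is a zero, and it carries the whole order of the
    norm.\<close>
  proof (cases "val p q A1 B1 = 0")
    case True
    then have v: "val p (- q) A1 B1 \<noteq> 0" using val_eq_0_both[OF q] s(3) by blast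
    let ?k = "order p (norm_poly A1 B1)"
    have "has_ord (R p q) (reg A1 B1) (int ?k) \<and> has_ord (R p (- q)) (reg A1 B1) (int 0) \<and> int ?k + int 0 = int ?k"
      using has_ord_reg_opposite[OF pt v] has_ord_reg_0[OF pt' v] ram by simp
    then show ?thesis by blast
  next
    case False
    then have v: "val p (- (- q)) A1 B1 \<noteq> 0" by simp
    let ?k = "order p (norm_poly A1 B1)"
    have "has_ord (R p q) (reg A1 B1) (int 0) \<and> has_ord (R p (- q)) (reg A1 B1) (int ?k) \<and> int 0 + int ?k = int ?k"
      using has_ord_reg_opposite[OF pt' v] has_ord_reg_0[OF pt False] ram by simp
    then show ?thesis by blast
  qed
  then obtain m m' :: nat where m: "has_ord (R p q) (reg A1 B1) (int m)" "has_ord (R p (- q)) (reg A1 B1) (int m')"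
    "int m + int m' = int (order p (norm_poly A1 B1))" by blast
  have e: "kpoly s [:- p, 1:] ^ n * reg A1 B1 = reg A B"
    unfolding s by (simp add: reg_fun_eq kpoly_mult kpoly_power distrib_left mult.assoc)
  have "has_ord (R p q) (kpoly s [:- p, 1:] ^ n * reg A1 B1) (int n * 1 + m)"
    using has_ord_linear[OF pt] ram by (intro P.has_ord_mult has_ord_power m pt) simp
  moreover have "has_ord (R p (- q)) (kpoly s [:- p, 1:] ^ n * reg A1 B1) (int n * 1 + m')"
    using has_ord_linear[OF pt'] ram by (intro P'.has_ord_mult has_ord_power m pt') simp
  moreover have "int (n + m) + int (n + m') = int (order p (norm_poly A B))"
    unfolding s(1,2) order_norm_split[OF nz1] using m(3) by simp
  ultimately have "has_ord (R p q) (reg A B) (int (n + m)) \<and> has_ord (R p (- q)) (reg A B) (int (n + m')) \<and>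
      int (n + m) + int (n + m') = int (order p (norm_poly A B))"
    unfolding e by simp
  then show ?thesis by blast
qed

end

section \<open>Orders of functions on the hyperelliptic curve\<close>

lemma map_poly_kconst_reflect: "map_poly kconst (reflect_poly A) = reflect_poly (map_poly kconst A)"
proof -
  have "degree (map_poly kconst A) = degree A" by (rule degree_map_poly) simp
  then show ?thesis by (intro poly_eqI) (simp add: coeff_reflect_poly coeff_map_poly)
qed

lemma kpoly_reflect: "s \<noteq> 0 \<Longrightarrow> kpoly s (reflect_poly A) = s ^ degree A * kpoly (inverse s) A"
proof -
  assume "s \<noteq> 0"
  moreover have "degree (map_poly kconst A) = degree A" by (rule degree_map_poly) simp
  ultimately show ?thesis
    by (simp add: kpoly_def map_poly_kconst_reflect poly_reflect_poly_nz)
qed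

lemma kpoly_linear: "kpoly s [:c, 1:] = kconst c + s"
  by (simp add: kpoly_pCons)

lemma kpoly_xfun: "kpoly xfun A = to_ac (to_fract A)"
proof (induction A)
  case (pCons c A)
  have "kpoly xfun (pCons c A)
      = to_ac (to_fract [:c:]) + to_ac (to_fract [:0, 1:]) * to_ac (to_fract A)"
    by (simp add: kpoly_pCons pCons.IH) (simp add: kconst_def xfun_def)
  also have "\<dots> = to_ac (to_fract ([:c:] + [:0, 1:] * A))" by simp
  also have "[:c:] + [:0, 1:] * A = pCons c A" by (simp add: mult_pCons_left)
  finally show ?case .
qed simp

lemma kpoly_xfun_eq_0_iff [simp]: "kpoly xfun A = 0 \<longleftrightarrow> A = 0"
  by (simp add: kpoly_xfun)

lemma xfun_nonzero: "xfun \<noteq> 0"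
  by (simp add: xfun_def)

lemma yfun_square: "yfun f ^ 2 = kpoly xfun f"
  unfolding yfun_def kpoly_xfun by (rule someI_ex) (simp add: nth_root_exists)

locale hyperelliptic =
  fixes f :: "'a::alg_closed_field poly" and g :: nat
  assumes two: "(2::'a) \<noteq> 0"
    and degree_f: "degree f = 2 * g + 1"
    and monic_f: "lead_coeff f = 1"
    and order_f: "poly f c = 0 \<Longrightarrow> order c f = 1"
begin

lemma genus_f: "genus f = g"
  by (simp add: genus_def degree_f)

lemma f_nonzero: "f \<noteq> 0"
  using degree_f by auto

definition root_f :: 'a where
  "root_f = (SOME c. poly f c = 0)"

lemma poly_root_f: "poly f root_f = 0"
  unfolding root_f_def by (rule someI_ex) (simp add: alg_closed_imp_poly_has_root degree_f)

sublocale X: chart xfun "yfun f" f root_f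
  by unfold_locales (simp_all add: yfun_square f_nonzero order_f poly_root_f two)

abbreviation "reg \<equiv> reg_fun xfun (yfun f)"

definition uinf :: "'a kx_closure" where "uinf = 1 / xfun"

lemma uinf_nonzero: "uinf \<noteq> 0"
  by (simp add: uinf_def xfun_nonzero)

lemma inverse_uinf: "inverse uinf = xfun"
  by (simp add: uinf_def)

definition vinf :: "'a kx_closure" where "vinf = yfun f / xfun ^ (g + 1)"
text \<open>The polynomial \<open>u ^ (2 * g + 2) * f (1 / u)\<close> of the chart at infinity.
  Reflecting \<open>f\<close>, of degree \<open>2 * g + 1\<close>, misses one factor
  \<open>u\<close>; this factor gives the simple root at 0.\<close>

definition finf :: "'a poly" where "finf = [:0, 1:] * reflect_poly f"

lemma order_finf: "order 0 finf = 1"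
proof -
  have "order 0 (reflect_poly f) = 0" by (rule order_0I) (simp add: monic_f)
  then show ?thesis
    unfolding finf_def using f_nonzero order_power_n_n[of "0 :: 'a" 1] by (subst order_mult) auto
qed

sublocale I: chart uinf vinf finf 0
proof
  \<comment> \<open>Transcendence of \<open>1 / x\<close>: the reflected polynomial would annihilate
    \<open>x\<close>.\<close>
  fix A assume "kpoly uinf A = 0"
  then have "kpoly xfun (reflect_poly A) = 0"
    by (simp only: kpoly_reflect[OF xfun_nonzero]) (simp add: uinf_def divide_inverse)
  then show "A = 0" by simp
next
  have "kpoly uinf finf = uinf * (uinf ^ (2 * g + 1) * kpoly xfun f)"
    using kpoly_reflect[OF uinf_nonzero, of f]
    by (simp add: finf_def kpoly_mult kpoly_linear degree_f inverse_uinf)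
  also have "\<dots> = vinf ^ 2"
  proof -
    have "(g + 1) * 2 = Suc (2 * g + 1)" by simp
    then show ?thesis
      unfolding vinf_def uinf_def power_divide yfun_square power_mult[symmetric]
      by (simp only: power_Suc power_one times_divide_times_eq times_divide_eq_left mult_1_left
          times_divide_eq_right divide_divide_eq_left mult.commute)
  qed
  finally show "vinf ^ 2 = kpoly uinf finf" by simp
qed (use order_finf two f_nonzero in \<open>auto simp: finf_def\<close>)

lemma I_point: "I.point 0 0"
  unfolding I.point_def using order_finf by (simp add: finf_def)

lemma local_ring_Infinity: "local_ring f Infinity = I.R 0 0"
  by (simp add: genus_f uinf_def vinf_def)

lemma Affine_in_curve [simp]: "Affine c d \<in> curve f \<longleftrightarrow> d ^ 2 = poly f c"
  by (auto simp: curve_def)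

lemma Infinity_in_curve [simp]: "Infinity \<in> curve f"
  by (auto simp: curve_def)

lemma X_point: "Affine c d \<in> curve f \<Longrightarrow> X.point c d"
  using order_f by (auto simp: X.point_def)

lemma local_ring_subring: "P \<in> curve f \<Longrightarrow> field_subring (local_ring f P)"
  using X.R_subring X_point I.R_subring[OF I_point] local_ring_Infinity
  by (cases P) simp_all

lemma ord_eqI: "P \<in> curve f \<Longrightarrow> has_ord (local_ring f P) h n \<Longrightarrow> ord_at f P h = n"
  using ord_at_eqI local_ring_subring by blast

text \<open>The pole order of \<open>reg A B\<close> at infinity, by
  \<open>has_ord_Infinity_reg\<close>.\<close>

definition degree_norm :: "'a poly \<Rightarrow> 'a poly \<Rightarrow> nat" where
  "degree_norm A B = degree (X.norm_poly A B)"

text \<open>\<open>A ^ 2\<close> has even and \<open>f * B ^ 2\<close> odd degree, so the leading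
  terms cannot cancel.\<close>

lemma degree_norm_eq:
  "degree_norm A B = (if B = 0 then 2 * degree A else max (2 * degree A) (2 * g + 1 + 2 * degree B))"
proof (cases "B = 0")
  case True
  then show ?thesis by (cases "A = 0") (simp_all add: degree_norm_def X.norm_poly_def degree_power_eq)
next
  case False
  have d: "degree (f * B ^ 2) = 2 * g + 1 + 2 * degree B"
    using False f_nonzero by (simp add: degree_mult_eq degree_power_eq degree_f)
  have d': "degree (A ^ 2) = 2 * degree A" by (cases "A = 0") (simp_all add: degree_power_eq)
  have "degree (A ^ 2 - f * B ^ 2) = max (2 * degree A) (2 * g + 1 + 2 * degree B)"
  proof (cases "2 * degree A < 2 * g + 1 + 2 * degree B")
    case True
    then show ?thesis using d d' degree_add_eq_right[of "A ^ 2" "- (f * B ^ 2)"] by simp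
  next
    case False
    then have "2 * g + 1 + 2 * degree B < 2 * degree A" by presburger
    then show ?thesis using d d' degree_add_eq_left[of "- (f * B ^ 2)" "A ^ 2"] by simp
  qed
  then show ?thesis using False by (simp add: degree_norm_def X.norm_poly_def)
qed

text \<open>Written in \<open>uinf\<close>, which has order 2, the function is the reflected
  polynomial, a unit at infinity, divided by \<open>uinf ^ degree A\<close>.\<close>

lemma has_ord_Infinity_kpoly:
  assumes "A \<noteq> 0"
  shows "has_ord (local_ring f Infinity) (kpoly xfun A) (- int (2 * degree A))"
proof -
  interpret field_subring "I.R 0 0" by (rule I.R_subring[OF I_point])
  have u: "has_ord (I.R 0 0) uinf 2"
    using I.has_ord_linear[OF I_point] by (simp add: kpoly_linear I.ram_def)
  have "has_ord (I.R 0 0) (I.reg (reflect_poly A) 0) 0"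
    using assms by (intro I.has_ord_reg_0[OF I_point]) (simp add: I.val_def)
  then have "has_ord (I.R 0 0) (I.reg (reflect_poly A) 0 * inverse (uinf ^ degree A))
      (0 + - (int (degree A) * 2))"
    by (intro has_ord_mult has_ord_inverse I.has_ord_power[OF I_point] u)
  moreover have "I.reg (reflect_poly A) 0 * inverse (uinf ^ degree A) = kpoly xfun A"
    using kpoly_reflect[OF uinf_nonzero, of A] uinf_nonzero by (simp add: inverse_uinf)
  ultimately show ?thesis unfolding local_ring_Infinity by (simp add: mult.commute)
qed

lemma has_ord_Infinity_yfun:
  "has_ord (local_ring f Infinity) (yfun f) (- int (2 * g + 1))"
proof -
  interpret field_subring "I.R 0 0" by (rule I.R_subring[OF I_point])
  have u: "has_ord (I.R 0 0) uinf 2"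
    using I.has_ord_linear[OF I_point] by (simp add: kpoly_linear I.ram_def)
  have "has_ord (I.R 0 0) vinf 1"
    using has_ord_uniformizer[OF I.uniformizer_unif[OF I_point]] by (simp add: I.unif_def)
  then have "has_ord (I.R 0 0) (vinf * inverse (uinf ^ (g + 1))) (1 + - (int (g + 1) * 2))"
    by (intro has_ord_mult has_ord_inverse I.has_ord_power[OF I_point] u)
  moreover have "vinf * inverse (uinf ^ (g + 1)) = yfun f"
    by (simp add: uinf_def vinf_def power_one_over xfun_nonzero)
  ultimately show ?thesis unfolding local_ring_Infinity by (simp add: algebra_simps)
qed

lemma has_ord_Infinity_reg:
  assumes "A \<noteq> 0 \<or> B \<noteq> 0"
  shows "has_ord (local_ring f Infinity) (reg A B) (- int (degree_norm A B))"
proof -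
  interpret field_subring "local_ring f Infinity" by (rule local_ring_subring) simp
  have By: "has_ord (local_ring f Infinity) (kpoly xfun B * yfun f)
      (- int (2 * degree B) + - int (2 * g + 1))" if "B \<noteq> 0"
    by (intro has_ord_mult has_ord_Infinity_kpoly has_ord_Infinity_yfun that)
  consider "B = 0" | "A = 0" "B \<noteq> 0" | "A \<noteq> 0" "B \<noteq> 0" "2 * degree A < 2 * g + 1 + 2 * degree B"
    | "A \<noteq> 0" "B \<noteq> 0" "2 * g + 1 + 2 * degree B < 2 * degree A"
    by (metis linorder_neqE_nat even_add even_mult_iff even_numeral odd_one)
  then show ?thesis
  proof cases
    case 1
    then show ?thesis using assms has_ord_Infinity_kpoly by (simp add: degree_norm_eq reg_fun_eq)
  next
    case 2
    then show ?thesis using By by (simp add: degree_norm_eq reg_fun_eq algebra_simps)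
  next
    case 3
    then show ?thesis
      using has_ord_add_less[OF By has_ord_Infinity_kpoly[of A]]
      by (simp add: degree_norm_eq reg_fun_eq algebra_simps)
  next
    case 4
    then show ?thesis
      using has_ord_add_less[OF has_ord_Infinity_kpoly[of A] By]
      by (simp add: degree_norm_eq reg_fun_eq)
  qed
qed

lemma has_ord_reg_ex:
  assumes "P \<in> curve f" "A \<noteq> 0 \<or> B \<noteq> 0"
  shows "\<exists>n. has_ord (local_ring f P) (reg A B) n"
proof (cases P)
  case Infinity
  then show ?thesis using has_ord_Infinity_reg[OF assms(2)] by blast
next
  case (Affine c d)
  have pt: "X.point c d" using assms(1) Affine X_point by blast
  show ?thesis
    using X.has_ord_reg_weierstrass[of c A B] X.has_ord_reg_fiber[OF pt _ assms(2)] pt assms(2) Affine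
    by (cases "d = 0") auto
qed

section \<open>The function field and the orders of its elements\<close>

lemma function_field_iff:
  "h \<in> function_field f \<longleftrightarrow> (\<exists>A B C. C \<noteq> 0 \<and> h = reg A B / kpoly xfun C)"
proof
  assume "h \<in> function_field f"
  then obtain A B where h: "h = to_ac A + to_ac B * yfun f"
    unfolding function_field_def by blast
  obtain a b where A: "A = Fract a b" "b \<noteq> 0" by (cases A rule: Fract_cases) auto
  obtain c d where B: "B = Fract c d" "d \<noteq> 0" by (cases B rule: Fract_cases) auto
  have "h = reg (a * d) (c * b) / kpoly xfun (b * d)"
    using h A B by (simp add: reg_fun_eq kpoly_mult kpoly_xfun Fract_conv_to_fract field_simps)
  moreover have "b * d \<noteq> 0" using A B by simp
  ultimately show "\<exists>A B C. C \<noteq> 0 \<and> h = reg A B / kpoly xfun C" by blast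
next
  assume "\<exists>A B C. C \<noteq> 0 \<and> h = reg A B / kpoly xfun C"
  then obtain A B C where "C \<noteq> 0" "h = reg A B / kpoly xfun C" by blast
  then have "h = to_ac (to_fract A / to_fract C) + to_ac (to_fract B / to_fract C) * yfun f"
    by (simp add: reg_fun_eq kpoly_xfun add_divide_distrib)
  then show "h \<in> function_field f" unfolding function_field_def by blast
qed

lemma function_field_reg: "reg A B \<in> function_field f"
  unfolding function_field_iff by (intro exI[of _ A] exI[of _ B] exI[of _ 1]) simp

lemma function_field_kpoly: "kpoly xfun A \<in> function_field f"
  using function_field_reg[of A 0] by simp

lemma function_field_1: "1 \<in> function_field f"
  using function_field_kpoly[of 1] by simp

lemma function_field_mult:
  assumes "h \<in> function_field f" "h' \<in> function_field f"
  shows "h * h' \<in> function_field f"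
proof -
  obtain A B C A' B' C' where "C \<noteq> 0" "h = reg A B / kpoly xfun C" "C' \<noteq> 0" "h' = reg A' B' / kpoly xfun C'"
    using assms unfolding function_field_iff by blast
  then have "h * h' = reg (A * A' + f * B * B') (A * B' + B * A') / kpoly xfun (C * C')" "C * C' \<noteq> 0"
    by (simp_all add: X.reg_mult[symmetric] kpoly_mult)
  then show ?thesis unfolding function_field_iff by blast
qed

lemma function_field_inverse:
  assumes "h \<in> function_field f"
  shows "inverse h \<in> function_field f"
proof (cases "h = 0")
  case False
  obtain A B C where h: "C \<noteq> 0" "h = reg A B / kpoly xfun C"
    using assms unfolding function_field_iff by blast
  then have nz: "A \<noteq> 0 \<or> B \<noteq> 0" using False by (auto simp: reg_fun_eq)
  have "reg A (- B) \<noteq> 0" using nz by auto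
  then have "inverse h = kpoly xfun C * reg A (- B) / (reg A B * reg A (- B))"
    using h by (simp del: X.reg_eq_0_iff)
  then have "inverse h = kpoly xfun C * reg A (- B) / kpoly xfun (X.norm_poly A B)"
    by (simp only: X.reg_conj_mult)
  also have "kpoly xfun C * reg A (- B) = reg (C * A) (C * - B)"
    by (simp add: reg_fun_eq kpoly_mult kpoly_uminus algebra_simps)
  finally show ?thesis unfolding function_field_iff using X.norm_poly_nonzero[OF nz] by blast
qed (use function_field_kpoly[of 0] in simp)

lemma has_ord_ord_at:
  assumes "P \<in> curve f" "h \<in> function_field f" "h \<noteq> 0"
  shows "has_ord (local_ring f P) h (ord_at f P h)"
proof -
  interpret field_subring "local_ring f P" by (rule local_ring_subring[OF assms(1)])
  obtain A B C where h: "C \<noteq> 0" "h = reg A B / kpoly xfun C"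
    using assms unfolding function_field_iff by blast
  then have nz: "A \<noteq> 0 \<or> B \<noteq> 0" using assms(3) by (auto simp: reg_fun_eq)
  obtain n where n: "has_ord (local_ring f P) (reg A B) n" using has_ord_reg_ex assms(1) nz by blast
  obtain m where m: "has_ord (local_ring f P) (reg C 0) m" using has_ord_reg_ex[of P C 0] assms(1) h by blast
  have "has_ord (local_ring f P) h (n + - m)"
    unfolding h(2) divide_inverse using n has_ord_inverse[OF m] by (intro has_ord_mult) simp_all
  then show ?thesis using ord_eqI[OF assms(1)] by metis
qed

lemma ord_mult:
  assumes "P \<in> curve f" "h \<in> function_field f" "h \<noteq> 0" "h' \<in> function_field f" "h' \<noteq> 0"
  shows "ord_at f P (h * h') = ord_at f P h + ord_at f P h'"
  using assms by (intro ord_eqI field_subring.has_ord_mult local_ring_subring has_ord_ord_at)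

lemma ord_inverse:
  assumes "P \<in> curve f" "h \<in> function_field f" "h \<noteq> 0"
  shows "ord_at f P (inverse h) = - ord_at f P h"
  using assms by (intro ord_eqI field_subring.has_ord_inverse local_ring_subring has_ord_ord_at)

lemma ord_Infinity_reg:
  assumes "A \<noteq> 0 \<or> B \<noteq> 0"
  shows "ord_at f Infinity (reg A B) = - int (degree_norm A B)"
  using assms by (intro ord_eqI has_ord_Infinity_reg) simp_all

lemma ord_Infinity_kpoly:
  assumes "A \<noteq> 0"
  shows "ord_at f Infinity (kpoly xfun A) = - int (2 * degree A)"
  using assms by (intro ord_eqI has_ord_Infinity_kpoly) simp_all

lemma ord_Affine_kpoly:
  assumes "Affine c d \<in> curve f" "A \<noteq> 0"
  shows "ord_at f (Affine c d) (kpoly xfun A) = X.ram d * int (order c A)"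
  using assms X.has_ord_kpoly[OF X_point] by (intro ord_eqI) simp_all

lemma ord_Affine_reg_nonneg:
  assumes "Affine c d \<in> curve f" "A \<noteq> 0 \<or> B \<noteq> 0"
  shows "ord_at f (Affine c d) (reg A B) \<ge> 0"
    and "ord_at f (Affine c d) (reg A B) > 0 \<longleftrightarrow> poly A c + poly B c * d = 0"
proof -
  have pt: "X.point c d" using X_point assms(1) .
  interpret field_subring "local_ring f (Affine c d)" by (rule local_ring_subring[OF assms(1)])
  have o: "has_ord (local_ring f (Affine c d)) (reg A B) (ord_at f (Affine c d) (reg A B))"
    using assms by (intro has_ord_ord_at function_field_reg) simp_all
  have "reg A B \<in> local_ring f (Affine c d)"
    unfolding local_ring.simps X.R_iff
    by (rule exI[of _ A], rule exI[of _ B], rule exI[of _ 1], rule exI[of _ 0]) (simp add: X.val_def)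
  then show ge: "ord_at f (Affine c d) (reg A B) \<ge> 0" using has_ord_closed_iff[OF o] by blast
  show "ord_at f (Affine c d) (reg A B) > 0 \<longleftrightarrow> poly A c + poly B c * d = 0"
  proof (cases "poly A c + poly B c * d = 0")
    case False
    then have "ord_at f (Affine c d) (reg A B) = 0"
      using X.has_ord_reg_0[OF pt] assms(1) by (intro ord_eqI) (simp_all add: X.val_def)
    then show ?thesis using False by simp
  next
    case True
    have "reg A B / reg 1 0 \<in> X.R c d - local_units (X.R c d)"
      using True by (intro X.quotient_nonunit[OF pt]) (simp_all add: X.val_def)
    then have nu: "reg A B \<notin> local_units (local_ring f (Affine c d))" by simp
    have "ord_at f (Affine c d) (reg A B) \<noteq> 0"
    proof
      assume "ord_at f (Affine c d) (reg A B) = 0"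
      then obtain t u where "u \<in> local_units (local_ring f (Affine c d))" "reg A B = t powi 0 * u"
        using o unfolding has_ord_def by metis
      then show False using nu by simp
    qed
    then show ?thesis using ge True by simp
  qed
qed

lemma finite_square_roots: "finite {d :: 'a. d ^ 2 = e}"
proof -
  obtain d where d: "d ^ 2 = e" using nth_root_exists[of 2 e] by auto
  have "{d :: 'a. d ^ 2 = e} \<subseteq> {d, - d}" unfolding d[symmetric] by (auto simp: power2_eq_iff)
  then show ?thesis by (rule finite_subset) simp
qed

lemma square_roots_eq: "{z :: 'a. z ^ 2 = d ^ 2} = {d, - d}"
  by (auto simp: power2_eq_iff)

lemma neq_uminus: "d \<noteq> 0 \<Longrightarrow> - d \<noteq> (d :: 'a)"
  using two by (metis eq_neg_iff_add_eq_0 mult_2 mult_eq_0_iff)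

text \<open>The sum runs over the set of square roots, so a ramified fibre contributes a single
  term, without a factor 2.\<close>

lemma fiber_sum:
  assumes "A \<noteq> 0 \<or> B \<noteq> 0"
  shows "(\<Sum>d | d ^ 2 = poly f c. ord_at f (Affine c d) (reg A B)) = int (order c (X.norm_poly A B))"
proof -
  obtain d where d: "poly f c = d ^ 2" using nth_root_exists[of 2 "poly f c"] by (metis zero_less_numeral)
  then have pt: "X.point c d" and cd: "Affine c d \<in> curve f" "Affine c (- d) \<in> curve f"
    using X_point by simp_all
  show ?thesis
  proof (cases "d = 0")
    case True
    then have "ord_at f (Affine c d) (reg A B) = int (order c (X.norm_poly A B))"
      using pt assms cd X.has_ord_reg_weierstrass[of c A B] by (intro ord_eqI) simp_all
    then show ?thesis unfolding d square_roots_eq using True by simp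
  next
    case False
    obtain m m' :: nat where m: "has_ord (X.R c d) (reg A B) (int m)"
      "has_ord (X.R c (- d)) (reg A B) (int m')" "int m + int m' = int (order c (X.norm_poly A B))"
      using X.has_ord_reg_fiber[OF pt False assms] by blast
    have "ord_at f (Affine c d) (reg A B) = int m" using m cd by (intro ord_eqI) simp_all
    moreover have "ord_at f (Affine c (- d)) (reg A B) = int m'" using m cd by (intro ord_eqI) simp_all
    ultimately show ?thesis unfolding d square_roots_eq using neq_uminus[OF False] m(3) by simp
  qed
qed

end

section \<open>Principal divisors and the class group\<close>

lemma proots_alg_closed:
  fixes p :: "'a::alg_closed_field poly"
  assumes "p \<noteq> 0"
  shows "size (proots p) = degree p" "p = smult (lead_coeff p) (\<Prod>x\<in>#proots p. [:- x, 1:])"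
proof -
  obtain A where A: "size A = degree p" "p = smult (lead_coeff p) (\<Prod>x\<in>#A. [:- x, 1:])"
    using alg_closed_imp_factorization[OF assms] by blast
  have "proots p = proots (\<Prod>x\<in>#A. [:- x, 1:])"
    using assms by (subst A(2)) (simp add: proots_smult)
  also have "\<dots> = A"
  proof (induction A)
    case (add x A)
    have "(\<Prod>x\<in>#A. [:- x, 1:]) \<noteq> 0" by auto
    then show ?case using add proots_mult[of "[:- x, 1:]" "\<Prod>x\<in>#A. [:- x, 1:]"] by simp
  qed simp
  finally show "size (proots p) = degree p" "p = smult (lead_coeff p) (\<Prod>x\<in>#proots p. [:- x, 1:])"
    using A by simp_all
qed

lemma sum_order_roots:
  fixes p :: "'a::alg_closed_field poly"
  assumes "p \<noteq> 0"
  shows "(\<Sum>c | poly p c = 0. order c p) = degree p"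
  using proots_alg_closed(1)[OF assms] assms by (simp add: size_multiset_overloaded_eq)

lemma keys_subset_iff: "Poly_Mapping.keys D \<subseteq> S \<longleftrightarrow> (\<forall>P. P \<notin> S \<longrightarrow> Poly_Mapping.lookup D P = 0)"
  by (auto simp: in_keys_iff)

lemma div_degree_superset:
  assumes "finite S" "Poly_Mapping.keys D \<subseteq> S"
  shows "div_degree D = (\<Sum>P\<in>S. Poly_Mapping.lookup D P)"
  unfolding div_degree_def using assms
  by (intro sum.mono_neutral_left) (auto simp: in_keys_iff)

lemma div_degree_add: "div_degree (D + E) = div_degree D + div_degree E"
proof -
  let ?S = "Poly_Mapping.keys D \<union> Poly_Mapping.keys E"
  have "Poly_Mapping.keys (D + E) \<subseteq> ?S" by (rule Poly_Mapping.keys_add)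
  then show ?thesis
    using div_degree_superset[of ?S D] div_degree_superset[of ?S E] div_degree_superset[of ?S "D + E"]
    by (simp add: lookup_add sum.distrib)
qed

lemma div_degree_single [simp]: "div_degree (Poly_Mapping.single P n) = n"
  using div_degree_superset[of "{P}" "Poly_Mapping.single P n"] by simp

lemma div_degree_0 [simp]: "div_degree 0 = 0"
  by (simp add: div_degree_def)

lemma div_degree_uminus: "div_degree (- D) = - div_degree D"
  using div_degree_add[of D "- D"] by simp

lemma div_degree_diff: "div_degree (D - E) = div_degree D - div_degree E"
  using div_degree_add[of D "- E"] by (simp add: div_degree_uminus)

lemma effective_divisor_multiset:
  fixes D :: "'a divisor"
  assumes "\<And>P. Poly_Mapping.lookup D P \<ge> 0"
  obtains M where "\<And>P. Poly_Mapping.lookup D P = int (count M P)" "int (size M) = div_degree D"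
proof
  define M where "M = Abs_multiset (\<lambda>P. nat (Poly_Mapping.lookup D P))"
  have "finite {P. 0 < nat (Poly_Mapping.lookup D P)}"
    by (rule finite_subset[of _ "Poly_Mapping.keys D"]) (auto simp: in_keys_iff)
  then have c: "count M P = nat (Poly_Mapping.lookup D P)" for P
    unfolding M_def by (subst count_Abs_multiset) simp_all
  then show *: "Poly_Mapping.lookup D P = int (count M P)" for P
    using assms[of P] by simp
  have "P \<in># M \<longleftrightarrow> P \<in> Poly_Mapping.keys D" for P
    using assms[of P] by (auto simp add: in_keys_iff c simp flip: count_greater_zero_iff)
  then have "set_mset M = Poly_Mapping.keys D" by blast
  then show "int (size M) = div_degree D"
    by (simp add: size_multiset_overloaded_eq div_degree_def *)
qed

context hyperelliptic
begin

text \<open>The ring of polynomials in \<open>x\<close> and \<open>y\<close> is integrally closed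
  because \<open>f\<close> is squarefree. By induction on the degree of the denominator: at a root
  \<open>c\<close> of \<open>C\<close> both coefficients of the numerator vanish, and a factor
  \<open>[:- c, 1:]\<close> cancels.\<close>

lemma regular_if_ord_nonneg:
  assumes "h \<in> function_field f" "h \<noteq> 0"
    and nonneg: "\<And>c d. d ^ 2 = poly f c \<Longrightarrow> ord_at f (Affine c d) h \<ge> 0"
  shows "\<exists>A B. h = reg A B"
proof -
  obtain A B C where "C \<noteq> 0" "h = reg A B / kpoly xfun C"
    using assms(1) unfolding function_field_iff by blast
  then show ?thesis
  proof (induction "degree C" arbitrary: A B C)
    case 0
    then obtain c where c: "C = [:c:]" "c \<noteq> 0" by (metis degree_eq_zeroE pCons_0_0)
    have "h = kconst (inverse c) * reg A B"
    proof -
      have "kconst (inverse c) * kconst c = 1" using c by (simp flip: kconst_mult)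
      then have "kconst (inverse c) = inverse (kconst c)" by (metis inverse_unique mult.commute)
      then show ?thesis using 0 c by (simp add: kpoly_pCons divide_inverse)
    qed
    then show ?case unfolding X.reg_const_mult by blast
  next
    case (Suc n)
    obtain c where c: "poly C c = 0"
      using alg_closed_imp_poly_has_root[of C] Suc(2) by auto
    obtain C' where C': "C = [:- c, 1:] * C'" using c by (auto simp: poly_eq_0_iff_dvd dvd_def)
    then have "C' \<noteq> 0" using Suc.prems by auto
    have "degree C' = n" using Suc(2) C' \<open>C' \<noteq> 0\<close> by (simp add: degree_mult_eq)
    have AB: "A \<noteq> 0 \<or> B \<noteq> 0" using Suc.prems assms(2) by (auto simp: reg_fun_eq)
    have oC: "order c C \<ge> 1" using c Suc.prems(1) order_root[of C c] by simp
    have ge: "ord_at f (Affine c d) (reg A B) \<ge> X.ram d" if d: "d ^ 2 = poly f c" for d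
    proof -
      have cd: "Affine c d \<in> curve f" using d by simp
      have "reg A B = h * kpoly xfun C" using Suc.prems by simp
      then have "ord_at f (Affine c d) (reg A B) = ord_at f (Affine c d) h + X.ram d * order c C"
        using ord_mult[OF cd assms(1,2) function_field_kpoly[of C]] ord_Affine_kpoly[OF cd] Suc.prems
        by simp
      moreover have "X.ram d * order c C \<ge> X.ram d" using oC by (simp add: X.ram_def)
      ultimately show ?thesis using nonneg[OF d] by linarith
    qed
    obtain d where d: "poly f c = d ^ 2"
      using nth_root_exists[of 2 "poly f c"] by (metis zero_less_numeral)
    have vanish: "poly A c + poly B c * e = 0" if "e ^ 2 = poly f c" for e
      using ge[OF that] ord_Affine_reg_nonneg(2)[of c e A B] AB that
      by (simp add: X.ram_def split: if_splits)
    have "poly A c = 0 \<and> poly B c = 0"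
    proof (cases "d = 0")
      case False
      have "X.val c d A B = 0" "X.val c (- d) A B = 0"
        using vanish[of d] vanish[of "- d"] d by (simp_all only: X.val_def power2_minus)
      then show ?thesis using X.val_eq_0_both[OF False] by blast
    next
      case True
      then have "poly f c = 0" using d by simp
      have A: "poly A c = 0" using vanish[of 0] d True by simp
      \<comment> \<open>At a Weierstrass point vanishing gives only \<open>poly A c = 0\<close>. The
        order is at least 2, however, and as \<open>f\<close> contributes just one factor
        \<open>[:- c, 1:]\<close> to \<open>f * B ^ 2\<close>, the other must come from
        \<open>B\<close>.\<close>
      have "int (order c (X.norm_poly A B)) \<ge> 2"
        using ge[of 0] d True fiber_sum[OF AB, of c] square_roots_eq[of 0] by (simp add: X.ram_def)
      then have "[:- c, 1:] ^ 2 dvd X.norm_poly A B" by (simp add: order_divides)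
      moreover have "[:- c, 1:] ^ 2 dvd A ^ 2" using A by (simp add: poly_eq_0_iff_dvd dvd_power_same)
      ultimately have "[:- c, 1:] ^ 2 dvd A ^ 2 - X.norm_poly A B" by (rule dvd_diff[rotated])
      then have dv: "[:- c, 1:] ^ 2 dvd f * B ^ 2" by (simp add: X.norm_poly_def)
      have "poly B c = 0"
      proof (rule ccontr)
        assume B: "poly B c \<noteq> 0"
        then have B0: "B \<noteq> 0" by auto
        then have "order c (f * B ^ 2) = order c f + 2 * order c B"
          using f_nonzero by (simp add: order_mult power2_eq_square)
        moreover have "order c B = 0" using B by (rule order_0I)
        moreover have "order c f = 1" using order_f \<open>poly f c = 0\<close> by blast
        moreover have "2 \<le> order c (f * B ^ 2)" using dv B0 f_nonzero by (simp add: order_divides)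
        ultimately show False by simp
      qed
      then show ?thesis using A by blast
    qed
    then obtain A' B' where "A = [:- c, 1:] * A'" "B = [:- c, 1:] * B'"
      by (auto simp: poly_eq_0_iff_dvd dvd_def)
    then have "h = reg A' B' / kpoly xfun C'"
      using Suc.prems C' by (simp add: reg_fun_eq kpoly_mult mult.assoc flip: distrib_left)
    then show ?case using Suc(1)[of C'] \<open>degree C' = n\<close> \<open>C' \<noteq> 0\<close> by blast
  qed
qed

definition affine_fiber :: "'a \<Rightarrow> 'a point set" where
  "affine_fiber c = Affine c ` {d. d ^ 2 = poly f c}"

lemma finite_affine_fiber: "finite (affine_fiber c)"
  unfolding affine_fiber_def using finite_square_roots by blast

lemma sum_affine_fiber: "sum F (affine_fiber c) = (\<Sum>d | d ^ 2 = poly f c. F (Affine c d))"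
  unfolding affine_fiber_def by (subst sum.reindex) (auto simp: inj_on_def)

text \<open>A finite set containing all zeros and poles of \<open>reg A B\<close>, by
  \<open>ord_reg_outside_support\<close>.\<close>

definition norm_support :: "'a poly \<Rightarrow> 'a poly \<Rightarrow> 'a point set" where
  "norm_support A B = insert Infinity (\<Union>c\<in>{c. poly (X.norm_poly A B) c = 0}. affine_fiber c)"

lemma finite_norm_support: "A \<noteq> 0 \<or> B \<noteq> 0 \<Longrightarrow> finite (norm_support A B)"
  unfolding norm_support_def
  using poly_roots_finite[OF X.norm_poly_nonzero] finite_affine_fiber by blast

lemma ord_reg_outside_support:
  assumes "A \<noteq> 0 \<or> B \<noteq> 0" "P \<in> curve f" "P \<notin> norm_support A B"
  shows "ord_at f P (reg A B) = 0"
proof (cases P)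
  case Infinity
  then show ?thesis using assms by (simp add: norm_support_def)
next
  case (Affine c d)
  then have "poly (X.norm_poly A B) c \<noteq> 0"
    using assms by (auto simp: norm_support_def affine_fiber_def)
  then have "poly A c + poly B c * d \<noteq> 0"
    using X.val_norm_poly[OF X_point, of c d A B] assms Affine by (auto simp: X.val_def)
  then show ?thesis using ord_Affine_reg_nonneg[of c d A B] assms Affine by force
qed

lemma finite_support:
  assumes "h \<in> function_field f" "h \<noteq> 0"
  shows "finite {P \<in> curve f. ord_at f P h \<noteq> 0}"
proof -
  obtain A B C where h: "C \<noteq> 0" "h = reg A B / kpoly xfun C"
    using assms unfolding function_field_iff by blast
  then have nz: "A \<noteq> 0 \<or> B \<noteq> 0" using assms(2) by (auto simp: reg_fun_eq)
  have "reg A B = h * reg C 0" using h by simp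
  then have "ord_at f P (reg A B) = ord_at f P h + ord_at f P (reg C 0)" if "P \<in> curve f" for P
    using ord_mult[OF that assms function_field_reg[of C 0]] h by simp
  then have "{P \<in> curve f. ord_at f P h \<noteq> 0} \<subseteq> norm_support A B \<union> norm_support C 0"
    using ord_reg_outside_support[OF nz] ord_reg_outside_support[of C 0] h(1) by fastforce
  then show ?thesis
    using finite_norm_support[OF nz] finite_norm_support[of C 0] h(1) finite_subset by blast
qed

text \<open>\<open>Abs_poly_mapping\<close> is meaningful here only for finite support, hence the
  hypotheses of \<open>lookup_divi\<close>.\<close>

definition divi :: "'a kx_closure \<Rightarrow> 'a divisor" where
  "divi h = Abs_poly_mapping (\<lambda>P. if P \<in> curve f then ord_at f P h else 0)"

lemma lookup_divi:
  assumes "h \<in> function_field f" "h \<noteq> 0"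
  shows "Poly_Mapping.lookup (divi h) P = (if P \<in> curve f then ord_at f P h else 0)"
proof -
  have "finite {P. (if P \<in> curve f then ord_at f P h else 0) \<noteq> 0}"
    using finite_support[OF assms] by (rule rev_finite_subset) (auto split: if_splits)
  then show ?thesis unfolding divi_def by simp
qed

lemma keys_divi:
  assumes "h \<in> function_field f" "h \<noteq> 0"
  shows "Poly_Mapping.keys (divi h) \<subseteq> curve f"
  using lookup_divi[OF assms] by (auto simp: in_keys_iff split: if_splits)

lemma divi_mult:
  assumes "h \<in> function_field f" "h \<noteq> 0" "h' \<in> function_field f" "h' \<noteq> 0"
  shows "divi (h * h') = divi h + divi h'"
  using assms function_field_mult
  by (intro poly_mapping_eqI) (simp add: lookup_divi lookup_add ord_mult)

lemma divi_inverse: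
  assumes "h \<in> function_field f" "h \<noteq> 0"
  shows "divi (inverse h) = - divi h"
  using assms function_field_inverse
  by (intro poly_mapping_eqI) (simp add: lookup_divi ord_inverse)

lemma principal_divisors_iff:
  "D \<in> principal_divisors f \<longleftrightarrow> (\<exists>h\<in>function_field f. h \<noteq> 0 \<and> D = divi h)"
proof
  assume "D \<in> principal_divisors f"
  then obtain h where h: "Poly_Mapping.keys D \<subseteq> curve f" "h \<in> function_field f" "h \<noteq> 0"
    "\<forall>P\<in>curve f. Poly_Mapping.lookup D P = ord_at f P h"
    unfolding principal_divisors_def by blast
  then have "D = divi h"
    by (intro poly_mapping_eqI) (auto simp: lookup_divi in_keys_iff)
  then show "\<exists>h\<in>function_field f. h \<noteq> 0 \<and> D = divi h" using h by blast
next
  assume "\<exists>h\<in>function_field f. h \<noteq> 0 \<and> D = divi h"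
  then show "D \<in> principal_divisors f"
    unfolding principal_divisors_def using keys_divi lookup_divi by fastforce
qed

text \<open>Summed fibre by fibre, the affine orders count the roots of the norm with multiplicity.
  This gives the degree of the norm, which is also the pole order at infinity.\<close>

lemma degree_divi_reg:
  assumes nz: "A \<noteq> 0 \<or> B \<noteq> 0"
  shows "div_degree (divi (reg A B)) = 0"
proof -
  let ?N = "X.norm_poly A B"
  have N: "?N \<noteq> 0" using X.norm_poly_nonzero[OF nz] .
  have r: "reg A B \<in> function_field f" "reg A B \<noteq> 0" using nz function_field_reg by auto
  have sub: "norm_support A B \<subseteq> curve f" by (auto simp: norm_support_def affine_fiber_def)
  have "Poly_Mapping.keys (divi (reg A B)) \<subseteq> norm_support A B"
    using ord_reg_outside_support[OF nz] by (simp add: keys_subset_iff lookup_divi[OF r])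
  then have "div_degree (divi (reg A B)) = (\<Sum>P\<in>norm_support A B. Poly_Mapping.lookup (divi (reg A B)) P)"
    using div_degree_superset finite_norm_support[OF nz] by blast
  also have "\<dots> = (\<Sum>P\<in>norm_support A B. ord_at f P (reg A B))"
    using sub by (intro sum.cong) (auto simp: lookup_divi[OF r])
  also have "\<dots> = ord_at f Infinity (reg A B)
      + (\<Sum>P\<in>(\<Union>c\<in>{c. poly ?N c = 0}. affine_fiber c). ord_at f P (reg A B))"
    unfolding norm_support_def
    using poly_roots_finite[OF N] finite_affine_fiber
    by (subst sum.insert) (auto simp: affine_fiber_def)
  also have "(\<Sum>P\<in>(\<Union>c\<in>{c. poly ?N c = 0}. affine_fiber c). ord_at f P (reg A B))
      = (\<Sum>c | poly ?N c = 0. int (order c ?N))"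
    using poly_roots_finite[OF N] finite_affine_fiber
    by (subst sum.UNION_disjoint)
      (auto simp: affine_fiber_def sum_affine_fiber[unfolded affine_fiber_def] fiber_sum[OF nz])
  also have "\<dots> = int (degree ?N)"
    using sum_order_roots[OF N] by (simp flip: of_nat_sum)
  finally show ?thesis by (simp add: ord_Infinity_reg[OF nz] degree_norm_def)
qed

lemma degree_divi:
  assumes "h \<in> function_field f" "h \<noteq> 0"
  shows "div_degree (divi h) = 0"
proof -
  obtain A B C where h: "C \<noteq> 0" "h = reg A B / kpoly xfun C"
    using assms unfolding function_field_iff by blast
  then have nz: "A \<noteq> 0 \<or> B \<noteq> 0" using assms(2) by (auto simp: reg_fun_eq)
  have "reg A B = h * reg C 0" using h by simp
  then have "divi (reg A B) = divi h + divi (reg C 0)"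
    using divi_mult[OF assms function_field_reg[of C 0]] h by simp
  then show ?thesis
    using degree_divi_reg[OF nz] degree_divi_reg[of C 0] h by (simp add: div_degree_add)
qed

section \<open>The group of divisor classes of degree zero\<close>

lemma carrier_Div0:
  "D \<in> carrier (Div0 f) \<longleftrightarrow> Poly_Mapping.keys D \<subseteq> curve f \<and> div_degree D = 0"
  by (simp add: Div0_def)

lemma Div0_add: "D \<in> carrier (Div0 f) \<Longrightarrow> E \<in> carrier (Div0 f) \<Longrightarrow> D + E \<in> carrier (Div0 f)"
  unfolding carrier_Div0 keys_subset_iff by (simp add: lookup_add div_degree_add)

lemma Div0_uminus: "D \<in> carrier (Div0 f) \<Longrightarrow> - D \<in> carrier (Div0 f)"
  unfolding carrier_Div0 keys_subset_iff by (simp add: div_degree_uminus)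

lemma comm_group_Div0: "comm_group (Div0 f)"
proof (rule comm_groupI)
  fix D assume "D \<in> carrier (Div0 f)"
  then show "\<exists>y\<in>carrier (Div0 f). y \<otimes>\<^bsub>Div0 f\<^esub> D = \<one>\<^bsub>Div0 f\<^esub>"
    using Div0_uminus by (intro bexI[of _ "- D"]) (simp_all add: Div0_def)
qed (use Div0_add carrier_Div0 in \<open>auto simp: Div0_def algebra_simps\<close>)

lemma inv_Div0: "D \<in> carrier (Div0 f) \<Longrightarrow> inv\<^bsub>Div0 f\<^esub> D = - D"
  using comm_group_Div0 Div0_uminus
  by (intro group.inv_equality comm_group.axioms(2)) (auto simp: Div0_def)

lemma divi_in_Div0: "h \<in> function_field f \<Longrightarrow> h \<noteq> 0 \<Longrightarrow> divi h \<in> carrier (Div0 f)"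
  unfolding carrier_Div0 using keys_divi degree_divi by blast

lemma divi_principal: "h \<in> function_field f \<Longrightarrow> h \<noteq> 0 \<Longrightarrow> divi h \<in> principal_divisors f"
  unfolding principal_divisors_iff by blast

lemma principal_add:
  assumes "D \<in> principal_divisors f" "E \<in> principal_divisors f"
  shows "D + E \<in> principal_divisors f"
  using assms unfolding principal_divisors_iff
  by (metis divi_mult function_field_mult mult_eq_0_iff)

lemma principal_uminus: "D \<in> principal_divisors f \<Longrightarrow> - D \<in> principal_divisors f"
  unfolding principal_divisors_iff
  by (metis divi_inverse function_field_inverse inverse_nonzero_iff_nonzero)

lemma principal_diff:
  "D \<in> principal_divisors f \<Longrightarrow> E \<in> principal_divisors f \<Longrightarrow> D - E \<in> principal_divisors f"
  using principal_add[of D "- E"] principal_uminus by simp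

lemma subgroup_principal: "subgroup (principal_divisors f) (Div0 f)"
proof
  show "principal_divisors f \<subseteq> carrier (Div0 f)"
    using divi_in_Div0 by (auto simp: principal_divisors_iff)
  \<comment> \<open>Hence \<open>divi 1\<close> is zero, the neutral element.\<close>
  have "divi 1 = divi 1 + divi 1"
    using divi_mult[of 1 1] function_field_1 by simp
  then show "\<one>\<^bsub>Div0 f\<^esub> \<in> principal_divisors f"
    using divi_principal[OF function_field_1] by (simp add: Div0_def)
  fix D assume D: "D \<in> principal_divisors f"
  show "D \<otimes>\<^bsub>Div0 f\<^esub> E \<in> principal_divisors f" if "E \<in> principal_divisors f" for E
    using principal_add[OF D that] by (simp add: Div0_def)
  have "D \<in> carrier (Div0 f)" using D divi_in_Div0 by (auto simp: principal_divisors_iff)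
  then show "inv\<^bsub>Div0 f\<^esub> D \<in> principal_divisors f"
    using principal_uminus[OF D] by (simp add: inv_Div0)
qed

lemma normal_principal: "principal_divisors f \<lhd> Div0 f"
  using comm_group.normal_iff_subgroup[OF comm_group_Div0] subgroup_principal by blast

lemma carrier_jacobian: "carrier (jacobian f) = cl f ` carrier (Div0 f)"
  by (simp add: jacobian_def carrier_FactGroup cl_def)

lemma cl_mult:
  assumes "D \<in> carrier (Div0 f)" "E \<in> carrier (Div0 f)"
  shows "cl f D \<otimes>\<^bsub>jacobian f\<^esub> cl f E = cl f (D + E)"
  using normal.rcos_sum[OF normal_principal assms] by (simp add: jacobian_def cl_def Div0_def)

lemma cl_eq_iff:
  assumes "D \<in> carrier (Div0 f)" "E \<in> carrier (Div0 f)"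
  shows "cl f D = cl f E \<longleftrightarrow> D - E \<in> principal_divisors f"
proof -
  have G: "group (Div0 f)" using comm_group_Div0 by (simp add: comm_group_def)
  have "D \<in> cl f E \<longleftrightarrow> D - E \<in> principal_divisors f"
    by (auto simp: cl_def r_coset_def Div0_def) (metis diff_add_cancel)
  moreover have "D \<in> cl f E \<longleftrightarrow> cl f D = cl f E"
    unfolding cl_def
    using group.repr_independence[OF G _ assms(2) subgroup_principal]
      group.rcos_self[OF G assms(1) subgroup_principal] by metis
  ultimately show ?thesis by blast
qed

end

section \<open>Representing classes by effective divisors of degree at most the genus\<close>

context hyperelliptic
begin

lemma kconst_eq_kpoly: "kconst c = kpoly xfun [:c:]"
  by (simp add: kpoly_pCons)

lemma function_field_smult: "h \<in> function_field f \<Longrightarrow> kconst c * h \<in> function_field f"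
  using function_field_mult function_field_kpoly[of "[:c:]"] by (simp add: kconst_eq_kpoly)

lemma ord_smult:
  assumes "P \<in> curve f" "h \<in> function_field f" "h \<noteq> 0" "c \<noteq> 0"
  shows "ord_at f P (kconst c * h) = ord_at f P h"
proof -
  have "ord_at f P (kpoly xfun [:c:]) = 0"
  proof (cases P)
    case Infinity
    then show ?thesis using assms ord_Infinity_kpoly[of "[:c:]"] by simp
  next
    case (Affine a b)
    have "order a [:c:] = 0" using assms by (intro order_0I) simp
    then show ?thesis using assms Affine ord_Affine_kpoly[of a b "[:c:]"] by simp
  qed
  then show ?thesis
    using ord_mult[OF assms(1) function_field_kpoly[of "[:c:]"] _ assms(2,3)] assms(4)
    by (simp add: kconst_eq_kpoly)
qed

lemma divi_smult:
  assumes "h \<in> function_field f" "h \<noteq> 0" "c \<noteq> 0"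
  shows "divi (kconst c * h) = divi h"
  using assms function_field_smult by (intro poly_mapping_eqI) (simp add: lookup_divi ord_smult)

section \<open>Pole orders at infinity of functions with prescribed zeros\<close>

definition vanishes :: "'a point multiset \<Rightarrow> 'a poly \<Rightarrow> 'a poly \<Rightarrow> bool" where
  "vanishes M A B \<longleftrightarrow> (A \<noteq> 0 \<or> B \<noteq> 0) \<and>
     (\<forall>P\<in>curve f - {Infinity}. ord_at f P (reg A B) \<ge> int (count M P))"

text \<open>For empty \<open>M\<close> this is the Weierstrass semigroup at infinity. The number of
  elements up to \<open>n\<close> is the dimension of the Riemann-Roch space of \<open>n\<close>
  times infinity minus \<open>M\<close>, so dimension counts become counts of natural
  numbers.\<close>

definition pole_orders :: "'a point multiset \<Rightarrow> nat set" where
  "pole_orders M = {degree_norm A B | A B. vanishes M A B}"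

lemma reg_diff_smult: "reg A B - kconst c * reg A' B' = reg (A - smult c A') (B - smult c B')"
  by (simp add: X.reg_const_mult X.reg_diff)

text \<open>
  If two functions have the same order at \<open>P\<close>, then a suitable combination of them has larger
  order at \<open>P\<close> and inherits the larger pole order at infinity. So only the least pole order
  occurring among the functions of order exactly \<open>count M P\<close> can get lost.
\<close>

lemma pole_orders_add_mset:
  assumes P: "P \<in> curve f - {Infinity}"
  shows "\<exists>p. pole_orders M \<subseteq> insert p (pole_orders (add_mset P M))"
proof -
  define S where "S = {degree_norm A B | A B. vanishes M A B \<and> ord_at f P (reg A B) = int (count M P)}"
  have big: "degree_norm A B \<in> pole_orders (add_mset P M)"
    if "vanishes M A B" "ord_at f P (reg A B) > int (count M P)" for A B
    using that unfolding pole_orders_def vanishes_def by fastforce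
  show ?thesis
  proof (cases "S = {}")
    case True
    have "ord_at f P (reg A B) > int (count M P)" if v: "vanishes M A B" for A B
    proof -
      have "ord_at f P (reg A B) \<ge> int (count M P)" using v P unfolding vanishes_def by blast
      moreover have "ord_at f P (reg A B) \<noteq> int (count M P)" using v True unfolding S_def by blast
      ultimately show ?thesis by simp
    qed
    then show ?thesis using big unfolding pole_orders_def by blast
  next
    case False
    define p where "p = (LEAST n. n \<in> S)"
    have "p \<in> S" unfolding p_def using False by (metis LeastI ex_in_conv)
    then obtain A0 B0 where 0: "p = degree_norm A0 B0" "vanishes M A0 B0"
      "ord_at f P (reg A0 B0) = int (count M P)"
      unfolding S_def by blast
    have "q \<in> pole_orders (add_mset P M)" if q: "q \<in> pole_orders M" "q \<noteq> p" for q
    proof -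
      obtain A B where AB: "q = degree_norm A B" "vanishes M A B"
        using q unfolding pole_orders_def by blast
      show ?thesis
      proof (cases "ord_at f P (reg A B) > int (count M P)")
        case True
        then show ?thesis using big AB by blast
      next
        case False
        moreover have "ord_at f P (reg A B) \<ge> int (count M P)"
          using AB P unfolding vanishes_def by blast
        ultimately have eq: "ord_at f P (reg A B) = int (count M P)" by simp
        then have "q \<in> S" unfolding S_def using AB by blast
        then have "p < q" using q(2) unfolding p_def by (metis Least_le le_neq_implies_less)
        have nz: "A \<noteq> 0 \<or> B \<noteq> 0" "A0 \<noteq> 0 \<or> B0 \<noteq> 0" using AB 0 by (auto simp: vanishes_def)
        then have nz': "reg A B \<noteq> 0" "reg A0 B0 \<noteq> 0" by auto
        interpret L: field_subring "local_ring f P" using P by (intro local_ring_subring) simp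
        obtain a b where ab: "P = Affine a b" "X.point a b"
          using P X_point by (cases P) auto
        have "\<exists>c\<in>range kconst. \<forall>m. has_ord (local_ring f P) (reg A B - c * reg A0 B0) m \<longrightarrow> m > int (count M P)"
        proof (rule L.has_ord_cancel_leading)
          show "has_ord (local_ring f P) (reg A B) (int (count M P))"
            using has_ord_ord_at[of P "reg A B"] P nz' function_field_reg eq by simp
          show "has_ord (local_ring f P) (reg A0 B0) (int (count M P))"
            using has_ord_ord_at[of P "reg A0 B0"] P nz' function_field_reg 0 by simp
        qed (use X.residue[OF ab(2)] ab(1) in simp)
        then obtain c where c: "\<And>m. has_ord (local_ring f P) (reg A B - kconst c * reg A0 B0) m \<Longrightarrow> m > int (count M P)"
          by blast
        define A1 B1 where "A1 = A - smult c A0" and "B1 = B - smult c B0"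
        have h1: "reg A B + kconst (- c) * reg A0 B0 = reg A1 B1"
          unfolding A1_def B1_def reg_diff_smult[symmetric] by (simp add: kconst_uminus)
        \<comment> \<open>Otherwise \<open>reg A B\<close> itself would have order above
          \<open>count M P\<close>.\<close>
        have "c \<noteq> 0"
        proof
          assume "c = 0"
          then show False using c[of "int (count M P)"] has_ord_ord_at[of P "reg A B"] P nz' function_field_reg eq
            by simp
        qed
        have o0: "ord_at f Q (kconst (- c) * reg A0 B0) = ord_at f Q (reg A0 B0)" if "Q \<in> curve f" for Q
          using ord_smult[OF that function_field_reg nz'(2)] \<open>c \<noteq> 0\<close> by simp
        have ff0: "kconst (- c) * reg A0 B0 \<in> function_field f" "kconst (- c) * reg A0 B0 \<noteq> 0"
          using nz'(2) \<open>c \<noteq> 0\<close> function_field_smult[OF function_field_reg] by auto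
        interpret I': field_subring "local_ring f Infinity" by (intro local_ring_subring) simp
        have inf: "has_ord (local_ring f Infinity) (reg A1 B1) (- int q)"
          unfolding h1[symmetric]
        proof (rule I'.has_ord_add_less)
          show "has_ord (local_ring f Infinity) (reg A B) (- int q)"
            using has_ord_Infinity_reg[OF nz(1)] AB by simp
          show "has_ord (local_ring f Infinity) (kconst (- c) * reg A0 B0) (- int p)"
            using has_ord_ord_at[OF Infinity_in_curve ff0] o0[of Infinity] ord_Infinity_reg[OF nz(2)] 0 by simp
        qed (use \<open>p < q\<close> in simp)
        then have "reg A1 B1 \<noteq> 0" using I'.has_ord_nonzero by blast
        then have nz1: "A1 \<noteq> 0 \<or> B1 \<noteq> 0" by auto
        have "degree_norm A1 B1 = q"
          using ord_eqI[OF Infinity_in_curve inf] ord_Infinity_reg[OF nz1] by simp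
        moreover have "vanishes (add_mset P M) A1 B1"
          unfolding vanishes_def
        proof (intro conjI nz1 ballI)
          fix Q assume Q: "Q \<in> curve f - {Infinity}"
          then have o1: "has_ord (local_ring f Q) (reg A1 B1) (ord_at f Q (reg A1 B1))"
            using has_ord_ord_at[of Q "reg A1 B1"] function_field_reg \<open>reg A1 B1 \<noteq> 0\<close> by blast
          show "int (count (add_mset P M) Q) \<le> ord_at f Q (reg A1 B1)"
          proof (cases "Q = P")
            case True
            then show ?thesis
              using c[of "ord_at f Q (reg A1 B1)"] o1 by (simp add: reg_diff_smult A1_def B1_def)
          next
            case False
            interpret Q: field_subring "local_ring f Q" using Q by (intro local_ring_subring) simp
            have "ord_at f Q (reg A1 B1) \<ge> min (ord_at f Q (reg A B)) (ord_at f Q (kconst (- c) * reg A0 B0))"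
            proof (rule Q.has_ord_add)
              show "has_ord (local_ring f Q) (reg A B) (ord_at f Q (reg A B))"
                using has_ord_ord_at Q function_field_reg nz' by blast
              show "has_ord (local_ring f Q) (kconst (- c) * reg A0 B0) (ord_at f Q (kconst (- c) * reg A0 B0))"
                using has_ord_ord_at Q ff0 by blast
            qed (use o1 h1 in simp)
            moreover have "ord_at f Q (reg A B) \<ge> int (count M Q)" "ord_at f Q (reg A0 B0) \<ge> int (count M Q)"
              using AB(2) 0(2) Q unfolding vanishes_def by blast+
            ultimately show ?thesis using o0 Q False by simp
          qed
        qed
        ultimately show ?thesis unfolding pole_orders_def by blast
      qed
    qed
    then show ?thesis by blast
  qed
qed

text \<open>Each point of \<open>M\<close> removes at most one pole order, by
  \<open>pole_orders_add_mset\<close>.\<close>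

lemma pole_orders_codim:
  "set_mset M \<subseteq> curve f - {Infinity} \<Longrightarrow>
    finite (pole_orders {#} - pole_orders M) \<and> card (pole_orders {#} - pole_orders M) \<le> size M"
proof (induction M)
  case (add P M)
  then have IH: "finite (pole_orders {#} - pole_orders M)" "card (pole_orders {#} - pole_orders M) \<le> size M"
    by simp_all
  obtain p where "pole_orders M \<subseteq> insert p (pole_orders (add_mset P M))"
    using pole_orders_add_mset add.prems by (metis insert_subset set_mset_add_mset_insert)
  then have sub: "pole_orders {#} - pole_orders (add_mset P M) \<subseteq> insert p (pole_orders {#} - pole_orders M)"
    by blast
  then have "card (pole_orders {#} - pole_orders (add_mset P M)) \<le> Suc (size M)"
    using card_mono[OF _ sub] IH card_insert_le_m1[of "Suc (size M)" "pole_orders {#} - pole_orders M" p]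
    by (simp add: card_insert_if split: if_splits)
  then show ?case using sub IH finite_subset by auto
qed simp

text \<open>\<open>x ^ k\<close> has pole order \<open>2 * k\<close>, and \<open>x ^ k * y\<close>
  has pole order \<open>2 * g + 1 + 2 * k\<close>.\<close>

lemma pole_orders_empty: "even n \<or> n \<ge> 2 * g + 1 \<Longrightarrow> n \<in> pole_orders {#}"
proof -
  have v: "vanishes {#} A B" if "A \<noteq> 0 \<or> B \<noteq> 0" for A B
    unfolding vanishes_def
  proof (intro conjI that ballI)
    fix P assume "P \<in> curve f - {Infinity}"
    then show "int (count {#} P) \<le> ord_at f P (reg A B)"
      using ord_Affine_reg_nonneg(1)[OF _ that] by (cases P) auto
  qed
  assume n: "even n \<or> n \<ge> 2 * g + 1"
  show ?thesis
  proof (cases "even n")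
    case True
    then obtain k where k: "n = 2 * k" by (elim evenE)
    have "n = degree_norm (monom 1 k) 0" using k by (simp add: degree_norm_eq degree_monom_eq)
    then show ?thesis using v[of "monom 1 k" 0] unfolding pole_orders_def by (force simp: monom_eq_0_iff)
  next
    case False
    then have "even (n - (2 * g + 1))" "n \<ge> 2 * g + 1" using n by simp_all
    then obtain k where k: "n = 2 * g + 1 + 2 * k"
      by (metis evenE le_add_diff_inverse)
    have "n = degree_norm 0 (monom 1 k)"
      using k by (simp add: degree_norm_eq degree_monom_eq monom_eq_0_iff)
    then show ?thesis using v[of 0 "monom 1 k"] unfolding pole_orders_def by (force simp: monom_eq_0_iff)
  qed
qed

text \<open>Among the \<open>size M + g + 1\<close> numbers up to \<open>size M + g\<close> there
  are \<open>g\<close> gaps. The remaining \<open>size M + 1\<close> are pole orders, one more than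
  the points of \<open>M\<close> can remove.\<close>

lemma vanishing_function_exists:
  assumes M: "set_mset M \<subseteq> curve f - {Infinity}" and "size M \<ge> g"
  obtains A B where "vanishes M A B" "degree_norm A B \<le> size M + g"
proof -
  define T where "T = {..size M + g} - (\<lambda>i. 2 * i + 1) ` {..<g}"
  have inj: "inj_on (\<lambda>i::nat. 2 * i + 1) {..<g}" by (auto simp: inj_on_def)
  \<comment> \<open>\<open>size M \<ge> g\<close> ensures that all the gaps, which are at most
    \<open>2 * g - 1\<close>, lie in the range.\<close>
  have "card T = card {..size M + g} - card ((\<lambda>i. 2 * i + 1) ` {..<g})"
    unfolding T_def using assms(2) by (intro card_Diff_subset) auto
  then have cT: "card T = size M + 1" using card_image[OF inj] by simp
  have T: "T \<subseteq> pole_orders {#}"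
  proof
    fix n assume n: "n \<in> T"
    have "n \<ge> 2 * g + 1" if "odd n"
    proof (rule ccontr)
      assume "\<not> n \<ge> 2 * g + 1"
      moreover obtain i where "n = 2 * i + 1" using \<open>odd n\<close> by (elim oddE)
      ultimately show False using n unfolding T_def by auto
    qed
    then show "n \<in> pole_orders {#}" by (intro pole_orders_empty) blast
  qed
  have "T \<inter> pole_orders M \<noteq> {}"
  proof
    assume "T \<inter> pole_orders M = {}"
    then have "T \<subseteq> pole_orders {#} - pole_orders M" using T by blast
    then have "card T \<le> card (pole_orders {#} - pole_orders M)"
      using pole_orders_codim[OF M] card_mono by blast
    then show False using pole_orders_codim[OF M] cT by simp
  qed
  then show ?thesis using that unfolding pole_orders_def T_def by blast
qed

section \<open>Reduction of a class to degree at most the genus\<close>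

definition affine_effective :: "'a divisor \<Rightarrow> bool" where
  "affine_effective E \<longleftrightarrow> Poly_Mapping.keys E \<subseteq> curve f - {Infinity} \<and> (\<forall>P. Poly_Mapping.lookup E P \<ge> 0)"

abbreviation inf_div :: "int \<Rightarrow> 'a divisor" where
  "inf_div n \<equiv> Poly_Mapping.single Infinity n"

lemma inf_div_Div0: "affine_effective E \<Longrightarrow> E - inf_div (div_degree E) \<in> carrier (Div0 f)"
  unfolding affine_effective_def carrier_Div0 keys_subset_iff
  by (auto simp: div_degree_diff lookup_minus lookup_single when_def)

text \<open>A polynomial in \<open>x\<close> that vanishes to high order at the abscissas of the
  affine points of \<open>D\<close> absorbs all negative affine coefficients.\<close>

lemma clear_denominators:
  assumes D: "D \<in> carrier (Div0 f)"
  obtains G E where "G \<noteq> 0" "affine_effective E" "div_degree E \<ge> int g"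
    "D + divi (kpoly xfun G) = E - inf_div (div_degree E)"
proof -
  \<comment> \<open>The extra 0 keeps the product nonconstant when \<open>D\<close> has no affine
    point. Together with the summand \<open>g\<close> in \<open>N\<close> this makes the degree of
    \<open>E\<close> at least \<open>g\<close>.\<close>
  define Xs where "Xs = insert 0 {c. \<exists>d. Affine c d \<in> Poly_Mapping.keys D}"
  define N where "N = g + nat (\<Sum>P\<in>Poly_Mapping.keys D. \<bar>Poly_Mapping.lookup D P\<bar>)"
  define G where "G = (\<Prod>c\<in>Xs. [:- c, 1:]) ^ N"
  have "Xs \<subseteq> insert 0 ((\<lambda>P. case P of Affine c d \<Rightarrow> c | Infinity \<Rightarrow> 0) ` Poly_Mapping.keys D)"
    unfolding Xs_def by force
  then have finX: "finite Xs" by (rule finite_subset) simp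
  have p0: "(\<Prod>c\<in>Xs. [:- c, 1:]) \<noteq> 0" using finX by simp
  then have G0: "G \<noteq> 0" unfolding G_def by simp
  have ND: "\<bar>Poly_Mapping.lookup D P\<bar> \<le> int N - int g" for P
  proof (cases "P \<in> Poly_Mapping.keys D")
    case True
    then have "\<bar>Poly_Mapping.lookup D P\<bar> \<le> (\<Sum>P\<in>Poly_Mapping.keys D. \<bar>Poly_Mapping.lookup D P\<bar>)"
      by (intro member_le_sum) simp_all
    then show ?thesis unfolding N_def by simp
  next
    case False
    then show ?thesis unfolding N_def by (simp add: in_keys_iff)
  qed
  have ordG: "order c G \<ge> N" if "c \<in> Xs" for c
  proof -
    have "[:- c, 1:] dvd (\<Prod>c\<in>Xs. [:- c, 1:])" using that finX by (intro dvd_prodI)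
    then have "[:- c, 1:] ^ N dvd G" unfolding G_def by (rule dvd_power_same)
    then show ?thesis using G0 by (simp add: order_divides)
  qed
  have "degree (\<Prod>c\<in>Xs. [:- c, 1:]) = card Xs" by (subst degree_prod_sum_eq) simp_all
  moreover have "card Xs > 0" using finX by (auto simp: card_gt_0_iff Xs_def)
  ultimately have degG: "degree G \<ge> N" unfolding G_def using p0 by (simp add: degree_power_eq)
  have ff: "kpoly xfun G \<in> function_field f" "kpoly xfun G \<noteq> 0" using G0 function_field_kpoly by auto
  define F where "F = D + divi (kpoly xfun G)"
  define E where "E = F - inf_div (Poly_Mapping.lookup F Infinity)"
  have F0: "F \<in> carrier (Div0 f)" unfolding F_def using D divi_in_Div0[OF ff] by (rule Div0_add)
  have outside: "Poly_Mapping.lookup E P = 0" if "P \<notin> curve f - {Infinity}" for P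
  proof (cases "P = Infinity")
    case True
    then show ?thesis by (simp add: E_def lookup_minus)
  next
    case False
    then have "Poly_Mapping.lookup F P = 0"
      using F0 that unfolding carrier_Div0 keys_subset_iff by blast
    then show ?thesis using False by (simp add: E_def lookup_minus lookup_single)
  qed
  have eff: "affine_effective E"
    unfolding affine_effective_def keys_subset_iff
  proof (intro conjI allI impI outside)
    fix P
    show "0 \<le> Poly_Mapping.lookup E P"
    proof (cases "P \<in> curve f - {Infinity}")
      case True
      then obtain c d where P: "P = Affine c d" "P \<in> curve f" by (cases P) auto
      have e: "Poly_Mapping.lookup E P = Poly_Mapping.lookup D P + X.ram d * int (order c G)"
        using P ord_Affine_kpoly[OF _ G0, of c d]
        by (simp add: E_def F_def lookup_minus lookup_add lookup_divi[OF ff] lookup_single)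
      have r: "X.ram d * int (order c G) \<ge> int (order c G)" by (simp add: X.ram_def)
      show ?thesis
      proof (cases "P \<in> Poly_Mapping.keys D")
        case True
        then have "c \<in> Xs" unfolding Xs_def using P by blast
        then show ?thesis using e r ordG[of c] ND[of P] by linarith
      next
        case False
        then have "Poly_Mapping.lookup D P = 0" by (simp add: in_keys_iff)
        then show ?thesis using e r by linarith
      qed
    next
      case False
      then show ?thesis using outside by simp
    qed
  qed
  have dE: "div_degree E = - Poly_Mapping.lookup F Infinity"
    using F0 unfolding E_def carrier_Div0 by (simp add: div_degree_diff)
  have "Poly_Mapping.lookup F Infinity = Poly_Mapping.lookup D Infinity - 2 * int (degree G)"
    using ord_Infinity_kpoly[OF G0] by (simp add: F_def lookup_add lookup_divi[OF ff])
  then have "div_degree E \<ge> int g" using dE degG ND[of Infinity] by linarith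
  moreover have "F = E - inf_div (div_degree E)"
    unfolding dE by (simp add: E_def single_uminus)
  ultimately show ?thesis using that[OF G0 eff] unfolding F_def by blast
qed

text \<open>A function vanishing on \<open>E0\<close>, with pole order at most
  \<open>div_degree E0 + g\<close>, has at most \<open>g\<close> further zeros, and these form
  \<open>E\<close>. Up to multiples of infinity, \<open>E\<close> is equivalent to
  \<open>- E0\<close>, which is why the denominators are cleared for \<open>- D\<close>.\<close>

theorem small_representative:
  assumes D: "D \<in> carrier (Div0 f)"
  obtains E where "affine_effective E" "div_degree E \<le> int g"
    "cl f D = cl f (E - inf_div (div_degree E))"
proof -
  obtain G E0 where G: "G \<noteq> 0" "affine_effective E0" "div_degree E0 \<ge> int g"
    "- D + divi (kpoly xfun G) = E0 - inf_div (div_degree E0)"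
    using clear_denominators[OF Div0_uminus[OF D]] .
  obtain M where M: "\<And>P. Poly_Mapping.lookup E0 P = int (count M P)" "int (size M) = div_degree E0"
    using effective_divisor_multiset[of E0] G(2) unfolding affine_effective_def by metis
  have "P \<in># M \<Longrightarrow> P \<in> curve f - {Infinity}" for P
    using G(2) M(1)[of P] unfolding affine_effective_def keys_subset_iff
    by (metis count_eq_zero_iff of_nat_eq_0_iff)
  then have "set_mset M \<subseteq> curve f - {Infinity}" by blast
  moreover have "size M \<ge> g" using M(2) G(3) by simp
  ultimately obtain A B where AB: "vanishes M A B" "degree_norm A B \<le> size M + g"
    using vanishing_function_exists by blast
  have nz: "A \<noteq> 0 \<or> B \<noteq> 0" using AB(1) by (simp add: vanishes_def)
  have h: "reg A B \<in> function_field f" "reg A B \<noteq> 0" using nz function_field_reg by auto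
  have k: "kpoly xfun G \<in> function_field f" "kpoly xfun G \<noteq> 0" using G function_field_kpoly by auto
  define E where "E = divi (reg A B) - E0 + inf_div (int (degree_norm A B))"
  have eff: "affine_effective E"
    unfolding affine_effective_def keys_subset_iff
  proof (intro conjI allI impI)
    fix P :: "'a point" assume P: "P \<notin> curve f - {Infinity}"
    have "Poly_Mapping.lookup E0 P = 0"
      using G(2) P unfolding affine_effective_def keys_subset_iff by blast
    then show "Poly_Mapping.lookup E P = 0"
      using P ord_Infinity_reg[OF nz]
      by (cases "P = Infinity") (auto simp: E_def lookup_minus lookup_add lookup_divi[OF h] lookup_single)
  next
    fix P :: "'a point"
    have E0: "P \<notin> curve f - {Infinity} \<Longrightarrow> Poly_Mapping.lookup E0 P = 0"
      using G(2) unfolding affine_effective_def keys_subset_iff by blast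
    show "0 \<le> Poly_Mapping.lookup E P"
    proof (cases "P \<in> curve f - {Infinity}")
      case True
      then have "ord_at f P (reg A B) \<ge> Poly_Mapping.lookup E0 P"
        using AB(1) M(1) unfolding vanishes_def by simp
      then show ?thesis using True
        by (auto simp: E_def lookup_minus lookup_add lookup_divi[OF h] lookup_single)
    next
      case False
      then show ?thesis
        using E0 ord_Infinity_reg[OF nz]
        by (cases "P = Infinity") (auto simp: E_def lookup_minus lookup_add lookup_divi[OF h] lookup_single)
    qed
  qed
  have dE: "div_degree E = int (degree_norm A B) - div_degree E0"
    by (simp add: E_def div_degree_add div_degree_diff degree_divi[OF h])
  have "E - inf_div (div_degree E) = divi (reg A B) - (E0 - inf_div (div_degree E0))"
    unfolding dE single_diff by (simp add: E_def)
  then have "D - (E - inf_div (div_degree E)) = divi (kpoly xfun G) - divi (reg A B)"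
    by (simp flip: G(4))
  then have "D - (E - inf_div (div_degree E)) \<in> principal_divisors f"
    using principal_diff divi_principal h k by metis
  then have "cl f D = cl f (E - inf_div (div_degree E))"
    using cl_eq_iff[OF D inf_div_Div0[OF eff]] by blast
  moreover have "div_degree E \<le> int g" using dE AB(2) M(2) by simp
  ultimately show ?thesis using that eff by blast
qed

end

section \<open>The polynomials attached to a tuple of square roots\<close>

lemma prod_add_elem_sym:
  "(\<Prod>i=1..n. w + r i) = (\<Sum>k\<le>n. elem_sym n r k * w ^ (n - k))"
proof -
  have "(\<Prod>i=1..n. r i + w) = (\<Sum>S\<in>Pow {1..n}. (\<Prod>i\<in>S. r i) * w ^ (n - card S))"
    by (subst prod_add) (auto intro!: sum.cong simp: card_Diff_subset finite_subset[of _ "{1..n}"])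
  also have "\<dots> = (\<Sum>k\<le>n. \<Sum>S | S \<in> Pow {1..n} \<and> card S = k. (\<Prod>i\<in>S. r i) * w ^ (n - card S))"
    by (rule sum.group[symmetric]) (auto dest: card_mono[rotated])
  also have "\<dots> = (\<Sum>k\<le>n. elem_sym n r k * w ^ (n - k))"
    unfolding elem_sym_def by (intro sum.cong refl) (auto simp: sum_distrib_right intro!: sum.cong)
  finally show ?thesis by (simp add: add.commute)
qed

lemma elem_sym_0 [simp]: "elem_sym n r 0 = 1"
proof -
  have "{S. S \<subseteq> {1..n} \<and> card S = 0} = {{}}" by (auto dest: finite_subset)
  then show ?thesis by (simp add: elem_sym_def)
qed

lemma sum_even_odd: "(\<Sum>k\<le>2 * g + 1. c k) = (\<Sum>j\<le>g. c (2 * j)) + (\<Sum>j\<le>g. c (2 * j + 1))"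
  for c :: "nat \<Rightarrow> 'a::comm_monoid_add"
  by (induction g) (simp_all add: numeral_2_eq_2 add.assoc add.left_commute)

text \<open>The polynomial A of the overview; \<open>odd_part\<close> is B. The names refer to the
  indices of the symmetric functions: those of even index go with the odd powers of
  \<open>w\<close>.\<close>

definition even_part :: "nat \<Rightarrow> 'a::field \<Rightarrow> (nat \<Rightarrow> 'a) \<Rightarrow> 'a poly" where
  "even_part g a r = (\<Sum>j\<le>g. smult (elem_sym (2 * g + 1) r (2 * j)) ([:a, -1:] ^ (g - j)))"

definition odd_part :: "nat \<Rightarrow> 'a::field \<Rightarrow> (nat \<Rightarrow> 'a) \<Rightarrow> 'a poly" where
  "odd_part g a r = (\<Sum>j\<le>g. smult (elem_sym (2 * g + 1) r (2 * j + 1)) ([:a, -1:] ^ (g - j)))"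

lemma sum_atMost_shift1: "(\<Sum>j\<le>g. h j) = h 0 + (\<Sum>j=1..g. h j)"
  for h :: "nat \<Rightarrow> 'a::comm_monoid_add"
  by (simp add: sum.atMost_shift sum.atLeast1_atMost_eq lessThan_Suc_atMost)

lemma even_part_eq:
  "even_part g a r = [:a, -1:] ^ g + (\<Sum>j=1..g. smult (elem_sym (2 * g + 1) r (2 * j)) ([:a, -1:] ^ (g - j)))"
  by (simp add: even_part_def sum_atMost_shift1)

lemma U_poly_eq: "U_poly g a r = (-1) ^ g * even_part g a r"
  by (simp add: U_poly_def even_part_eq)

lemma smult_sum_right: "smult c (sum h S) = (\<Sum>i\<in>S. smult c (h i))"
  by (intro poly_eqI) (simp add: coeff_sum sum_distrib_left)

lemma V_poly_eq: "V_poly g a r = odd_part g a r - smult (elem_sym (2 * g + 1) r 1) (even_part g a r)"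
  by (simp add: V_poly_def odd_part_def even_part_def sum_atMost_shift1 smult_diff_left
      sum_subtractf smult_sum_right smult_add_right)

lemma degree_linear_neg_power: "degree ([:a, -1:] ^ n :: 'a::field poly) = n"
  by (subst degree_power_eq) simp_all

lemma lead_coeff_linear_neg_power: "lead_coeff ([:a, -1:] ^ n :: 'a::field poly) = (-1) ^ n"
  by (simp add: lead_coeff_power)

lemma degree_even_part_tail:
  "g \<ge> 1 \<Longrightarrow> degree (\<Sum>j=1..g. smult (c j) ([:a, -1:] ^ (g - j)) :: 'a::field poly) \<le> g - 1"
  by (intro degree_sum_le) (auto intro!: order.trans[OF degree_smult_le] simp: degree_linear_neg_power)

lemma degree_even_part:
  assumes "g \<ge> 1"
  shows "degree (even_part g a r) = g" "lead_coeff (even_part g a r) = (-1) ^ g"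
proof -
  let ?T = "\<Sum>j=1..g. smult (elem_sym (2 * g + 1) r (2 * j)) ([:a, -1:] ^ (g - j))"
  have T: "degree ?T < degree ([:a, -1:] ^ g)"
    using degree_even_part_tail[OF assms, of "\<lambda>j. elem_sym (2 * g + 1) r (2 * j)" a] assms
    by (simp add: degree_linear_neg_power)
  show "degree (even_part g a r) = g"
    unfolding even_part_eq using degree_add_eq_left[OF T] by (simp add: degree_linear_neg_power)
  show "lead_coeff (even_part g a r) = (-1) ^ g"
    unfolding even_part_eq using lead_coeff_add_le[OF T] lead_coeff_linear_neg_power[of a g]
    by (simp add: add.commute)
qed

lemma degree_V_poly: "g \<ge> 1 \<Longrightarrow> degree (V_poly g a r) < g"
  unfolding V_poly_def
  using degree_even_part_tail[of g "\<lambda>j. elem_sym (2 * g + 1) r (2 * j + 1) -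
      elem_sym (2 * g + 1) r 1 * elem_sym (2 * g + 1) r (2 * j)" a] by simp

lemma prod_add_even_odd:
  assumes "w ^ 2 = a - x"
  shows "(\<Prod>i=1..2 * g + 1. w + r i) = w * poly (even_part g a r) x + poly (odd_part g a r) x"
proof -
  have "(\<Prod>i=1..2 * g + 1. w + r i)
      = (\<Sum>j\<le>g. elem_sym (2 * g + 1) r (2 * j) * w ^ (2 * g + 1 - 2 * j))
        + (\<Sum>j\<le>g. elem_sym (2 * g + 1) r (2 * j + 1) * w ^ (2 * g + 1 - (2 * j + 1)))"
    unfolding prod_add_elem_sym by (rule sum_even_odd)
  also have "(\<Sum>j\<le>g. elem_sym (2 * g + 1) r (2 * j) * w ^ (2 * g + 1 - 2 * j))
      = w * poly (even_part g a r) x"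
    unfolding even_part_def poly_sum sum_distrib_left
  proof (rule sum.cong)
    fix j assume "j \<in> {..g}"
    \<comment> \<open>The odd exponent leaves a single factor \<open>w\<close> next to a power of
      \<open>w ^ 2\<close>.\<close>
    then have e: "2 * g + 1 - 2 * j = Suc (2 * (g - j))" by auto
    have "w ^ (2 * (g - j)) = (a - x) ^ (g - j)" unfolding power_mult assms ..
    then show "elem_sym (2 * g + 1) r (2 * j) * w ^ (2 * g + 1 - 2 * j)
        = w * poly (smult (elem_sym (2 * g + 1) r (2 * j)) ([:a, - 1:] ^ (g - j))) x"
      unfolding e by (simp add: mult.commute mult.left_commute)
  qed simp
  also have "(\<Sum>j\<le>g. elem_sym (2 * g + 1) r (2 * j + 1) * w ^ (2 * g + 1 - (2 * j + 1)))
      = poly (odd_part g a r) x"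
    unfolding odd_part_def poly_sum
  proof (rule sum.cong)
    fix j assume "j \<in> {..g}"
    then have e: "2 * g + 1 - (2 * j + 1) = 2 * (g - j)" by auto
    have "w ^ (2 * (g - j)) = (a - x) ^ (g - j)" unfolding power_mult assms ..
    then show "elem_sym (2 * g + 1) r (2 * j + 1) * w ^ (2 * g + 1 - (2 * j + 1))
        = poly (smult (elem_sym (2 * g + 1) r (2 * j + 1)) ([:a, - 1:] ^ (g - j))) x"
      unfolding e by (simp add: mult.commute mult.left_commute)
  qed simp
  finally show ?thesis .
qed

lemma poly_eqI_alg_closed:
  fixes p q :: "'a::alg_closed_field poly"
  assumes "\<And>x. poly p x = poly q x"
  shows "p = q"
proof (rule ccontr)
  assume "p \<noteq> q"
  then have "p - q \<noteq> 0" by simp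
  have "degree (p - q) > 0"
  proof (rule ccontr)
    assume "\<not> degree (p - q) > 0"
    then obtain c where "p - q = [:c:]" by (metis degree_eq_zeroE gr0I)
    then have "c = 0" using assms[of 0] by (metis poly_diff poly_const_conv right_minus_eq)
    then show False using \<open>p - q = [:c:]\<close> \<open>p - q \<noteq> 0\<close> by simp
  qed
  \<comment> \<open>A nonconstant difference takes the value -1 somewhere, although it vanishes
    everywhere.\<close>
  then have "degree (p - q + 1) > 0" by (subst degree_add_eq_left) simp_all
  then obtain x where "poly (p - q + 1) x = 0" using alg_closed_imp_poly_has_root by blast
  then show False using assms[of x] by simp
qed

locale halving =
  fixes f :: "'a::alg_closed_field poly" and g :: nat and \<alpha> :: "nat \<Rightarrow> 'a" and a b :: 'a
  assumes two: "(2::'a) \<noteq> 0" and g_pos: "g \<ge> 1"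
    and inj: "inj_on \<alpha> {1..2 * g + 1}"
    and f_def: "f = (\<Prod>i=1..2 * g + 1. [:- \<alpha> i, 1:])"
    and ab: "b ^ 2 = poly f a"
begin

lemma poly_f: "poly f x = (\<Prod>i=1..2 * g + 1. x - \<alpha> i)"
  unfolding f_def poly_prod by simp

lemma poly_f_eq_0_iff: "poly f x = 0 \<longleftrightarrow> (\<exists>i\<in>{1..2 * g + 1}. x = \<alpha> i)"
  unfolding poly_f by (subst prod_zero_iff) auto

sublocale hyperelliptic f g
proof
  show "(2::'a) \<noteq> 0" by (rule two)
  show "degree f = 2 * g + 1" unfolding f_def by (subst degree_prod_sum_eq) simp_all
  show "lead_coeff f = 1" unfolding f_def lead_coeff_prod by simp
  fix c assume "poly f c = 0"
  then obtain j where j: "j \<in> {1..2 * g + 1}" "c = \<alpha> j" using poly_f_eq_0_iff by blast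
  let ?R = "\<Prod>i\<in>{1..2 * g + 1} - {j}. [:- \<alpha> i, 1:]"
  have f: "f = [:- c, 1:] ^ 1 * ?R"
    unfolding f_def j(2) using j(1) by (subst prod.remove[of _ j]) auto
  have "poly ?R c \<noteq> 0"
    unfolding poly_prod using inj j by (subst prod_zero_iff) (auto simp: inj_on_def)
  moreover from this have "?R \<noteq> 0" by (metis poly_0)
  ultimately show "order c f = 1"
    unfolding f using order_0I[of ?R c] order_power_n_n[of c 1] by (subst order_mult) auto
qed

text \<open>The condition on the product is kept apart, as it turns into the value of
  \<open>odd_part\<close> at \<open>a\<close> (\<open>poly_odd_part_a\<close>).\<close>

definition sqrts :: "(nat \<Rightarrow> 'a) \<Rightarrow> bool" where
  "sqrts r \<longleftrightarrow> (\<forall>i\<in>{1..2 * g + 1}. r i ^ 2 = a - \<alpha> i)"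

text \<open>Write \<open>a - x = w\<^sup>2\<close>; then \<open>f(x)\<close> is the product of all \<open>(w + r\<^sub>i) (- w + r\<^sub>i)\<close>.\<close>

lemma f_decomposition:
  assumes "sqrts r"
  shows "f = odd_part g a r ^ 2 + [:- a, 1:] * even_part g a r ^ 2"
proof (rule poly_eqI_alg_closed)
  fix x
  obtain w where w: "w ^ 2 = a - x" using nth_root_exists[of 2 "a - x"] by auto
  then have w': "(- w) ^ 2 = a - x" by simp
  have "poly f x = (\<Prod>i=1..2 * g + 1. (w + r i) * (- w + r i))"
    unfolding poly_f
  proof (rule prod.cong)
    fix i assume "i \<in> {1..2 * g + 1}"
    then have "r i ^ 2 = a - \<alpha> i" using assms by (simp add: sqrts_def)
    moreover have "(w + r i) * (- w + r i) = r i ^ 2 - w ^ 2" by (simp add: power2_eq_square algebra_simps)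
    ultimately show "x - \<alpha> i = (w + r i) * (- w + r i)" using w by simp
  qed simp
  also have "\<dots> = (w * poly (even_part g a r) x + poly (odd_part g a r) x)
      * (- w * poly (even_part g a r) x + poly (odd_part g a r) x)"
    unfolding prod.distrib prod_add_even_odd[OF w] prod_add_even_odd[OF w'] by simp
  also have "\<dots> = poly (odd_part g a r) x ^ 2 - w ^ 2 * poly (even_part g a r) x ^ 2"
    by (simp add: power2_eq_square algebra_simps)
  also have "\<dots> = poly (odd_part g a r ^ 2 + [:- a, 1:] * even_part g a r ^ 2) x"
    unfolding w by (simp add: algebra_simps)
  finally show "poly f x = poly (odd_part g a r ^ 2 + [:- a, 1:] * even_part g a r ^ 2) x" .
qed

text \<open>At \<open>x = \<alpha> i\<close> one may take \<open>w = - r i\<close>, which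
  annihilates the product of all \<open>w + r j\<close>.\<close>

lemma poly_odd_part_root:
  assumes "sqrts r" "i \<in> {1..2 * g + 1}"
  shows "poly (odd_part g a r) (\<alpha> i) = r i * poly (even_part g a r) (\<alpha> i)"
proof -
  have w: "(- r i) ^ 2 = a - \<alpha> i" using assms by (simp add: sqrts_def)
  have "(\<Prod>j=1..2 * g + 1. - r i + r j) = 0" using assms(2) by (subst prod_zero_iff) force+
  then have "- r i * poly (even_part g a r) (\<alpha> i) + poly (odd_part g a r) (\<alpha> i) = 0"
    by (simp only: prod_add_even_odd[OF w])
  then show ?thesis by (simp add: eq_neg_iff_add_eq_0 add.commute)
qed

text \<open>This is the case \<open>w = 0\<close>.\<close>

lemma poly_odd_part_a: "poly (odd_part g a r) a = (\<Prod>i=1..2 * g + 1. r i)"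
  using prod_add_even_odd[of 0 a a r g] by simp

text \<open>What is used of the two parts when no tuple is known yet. As \<open>A\<close> enters
  only through its square, its sign is fixed by the leading coefficient, chosen to agree with
  \<open>even_part\<close>.\<close>

definition norm_pair :: "'a poly \<Rightarrow> 'a poly \<Rightarrow> bool" where
  "norm_pair A B \<longleftrightarrow> f = B ^ 2 + [:- a, 1:] * A ^ 2 \<and> lead_coeff A = (-1) ^ g"

lemma norm_pair_parts: "sqrts r \<Longrightarrow> norm_pair (even_part g a r) (odd_part g a r)"
  unfolding norm_pair_def using f_decomposition degree_even_part(2)[OF g_pos] by blast

text \<open>A common root of \<open>A\<close> and \<open>f\<close> would also be a root of
  \<open>B\<close>, hence a double root of \<open>f\<close>.\<close>

lemma norm_pair_no_root:
  assumes "norm_pair A B" "poly f c = 0"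
  shows "poly A c \<noteq> 0"
proof
  assume A: "poly A c = 0"
  have "poly f c = poly B c ^ 2 + (c - a) * poly A c ^ 2"
    using assms(1) by (simp add: norm_pair_def)
  then have "poly B c = 0" using A assms(2) by simp
  then have "[:- c, 1:] ^ 2 dvd B ^ 2 + [:- a, 1:] * A ^ 2"
    using A by (intro dvd_add dvd_mult) (simp_all add: poly_eq_0_iff_dvd dvd_power_same)
  then have "2 \<le> order c f"
    using assms(1) f_nonzero by (simp add: norm_pair_def order_divides)
  then show False using order_f[OF assms(2)] by simp
qed

lemma norm_pair_nonzero: "norm_pair A B \<Longrightarrow> A \<noteq> 0"
  by (auto simp: norm_pair_def)

text \<open>The two terms have degrees of different parity, so nothing cancels and neither degree
  exceeds that of \<open>f\<close>.\<close>

lemma norm_pair_degree: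
  assumes "norm_pair A B"
  shows "degree A \<le> g" "degree B \<le> g"
proof -
  have B: "degree (B ^ 2) = 2 * degree B" by (cases "B = 0") (simp_all add: degree_power_eq)
  have A: "degree ([:- a, 1:] * A ^ 2) = 2 * degree A + 1"
    using norm_pair_nonzero[OF assms] by (simp add: degree_mult_eq degree_power_eq)
  have f: "f = B ^ 2 + [:- a, 1:] * A ^ 2" using assms by (simp add: norm_pair_def)
  have "degree f = max (2 * degree B) (2 * degree A + 1)"
  proof (cases "2 * degree B < 2 * degree A + 1")
    case True
    then show ?thesis unfolding f using A B by (subst degree_add_eq_right) simp_all
  next
    case False
    then have "2 * degree A + 1 < 2 * degree B" by presburger
    then show ?thesis unfolding f using A B by (subst degree_add_eq_left) simp_all
  qed
  then show "degree A \<le> g" "degree B \<le> g" using degree_f by simp_all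
qed

lemma lead_coeff_sign_unique:
  fixes A A' :: "'a poly"
  assumes "A ^ 2 = A' ^ 2" "lead_coeff A = (-1) ^ g" "lead_coeff A' = (-1) ^ g"
  shows "A = A'"
proof (rule ccontr)
  assume "A \<noteq> A'"
  then have "A = - A'" using assms(1) by (simp add: power2_eq_iff)
  then have "(-1) ^ g = - ((-1) ^ g :: 'a)" using assms(2,3) by simp
  then show False using neq_uminus[of "(-1) ^ g"] by simp
qed

text \<open>
  \<open>B A' - B' A\<close> has degree at most \<open>2 g\<close> and vanishes at the \<open>2 g + 1\<close> points \<open>\<alpha>\<^sub>i\<close>.
\<close>

lemma norm_pair_unique:
  assumes "norm_pair A B" "norm_pair A' B'"
    and r: "\<And>i. i \<in> {1..2 * g + 1} \<Longrightarrow> poly B (\<alpha> i) = r i * poly A (\<alpha> i)"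
    and r': "\<And>i. i \<in> {1..2 * g + 1} \<Longrightarrow> poly B' (\<alpha> i) = r i * poly A' (\<alpha> i)"
  shows "A = A'" "B = B'"
proof -
  have eq: "B * A' = B' * A"
  proof (rule ccontr)
    assume "B * A' \<noteq> B' * A"
    then have nz: "B * A' - B' * A \<noteq> 0" by simp
    have "\<alpha> ` {1..2 * g + 1} \<subseteq> {x. poly (B * A' - B' * A) x = 0}"
      using r r' by auto
    then have "card (\<alpha> ` {1..2 * g + 1}) \<le> card {x. poly (B * A' - B' * A) x = 0}"
      using poly_roots_finite[OF nz] by (intro card_mono)
    also have "\<dots> \<le> degree (B * A' - B' * A)" using card_poly_roots_bound[OF nz] .
    also have "\<dots> \<le> 2 * g"
      using norm_pair_degree[OF assms(1)] norm_pair_degree[OF assms(2)]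
        degree_mult_le[of B A'] degree_mult_le[of B' A] by (intro degree_diff_le) linarith+
    finally show False using card_image[OF inj] by simp
  qed
  have f: "f = B ^ 2 + [:- a, 1:] * A ^ 2" "f = B' ^ 2 + [:- a, 1:] * A' ^ 2"
    using assms(1,2) unfolding norm_pair_def by blast+
  \<comment> \<open>Multiplied by \<open>A' ^ 2\<close> and \<open>A ^ 2\<close> respectively, the
    two decompositions of \<open>f\<close> acquire the same right-hand side, whence
    \<open>A ^ 2 = A' ^ 2\<close>.\<close>
  have "(B * A') ^ 2 = (B' * A) ^ 2" using eq by simp
  then have "B ^ 2 * A' ^ 2 + [:- a, 1:] * A ^ 2 * A' ^ 2 = B' ^ 2 * A ^ 2 + [:- a, 1:] * A' ^ 2 * A ^ 2"
    by (simp add: power_mult_distrib)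
  moreover have "f * A' ^ 2 = (B ^ 2 + [:- a, 1:] * A ^ 2) * A' ^ 2"
    using arg_cong[OF f(1)] .
  moreover have "f * A ^ 2 = (B' ^ 2 + [:- a, 1:] * A' ^ 2) * A ^ 2"
    using arg_cong[OF f(2)] .
  ultimately have "f * A' ^ 2 = f * A ^ 2" by (simp only: distrib_right)
  then have "A ^ 2 = A' ^ 2" using f_nonzero by simp
  then show "A = A'"
    using lead_coeff_sign_unique assms(1,2) unfolding norm_pair_def by blast
  then show "B = B'" using eq norm_pair_nonzero[OF assms(1)] by simp
qed

end

section \<open>The classes attached to tuples of square roots\<close>

lemma lookup_sum_mset_points:
  "Poly_Mapping.lookup (\<Sum>c\<in>#M. pt_div (Affine c (h c))) (Affine c d)
    = (if d = h c then int (count M c) else 0)"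
  "Poly_Mapping.lookup (\<Sum>c\<in>#M. pt_div (Affine c (h c))) Infinity = 0"
  by (induction M) (auto simp: lookup_add lookup_single when_def)

lemma lookup_root_divisor:
  assumes "U \<noteq> 0"
  shows "Poly_Mapping.lookup (root_divisor U V) (Affine c d) = (if d = poly V c then int (order c U) else 0)"
  unfolding root_divisor_def lookup_sum_mset_points using assms by simp

lemma lookup_root_divisor_Infinity [simp]: "Poly_Mapping.lookup (root_divisor U V) Infinity = 0"
  unfolding root_divisor_def lookup_sum_mset_points by simp

lemma div_degree_root_divisor: "div_degree (root_divisor U V) = int (size (proots U))"
proof -
  have "div_degree (\<Sum>c\<in>#M. pt_div (Affine c (poly V c))) = int (size M)" for M
    by (induction M) (simp_all add: div_degree_add)
  then show ?thesis by (simp add: root_divisor_def)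
qed

lemma monic_square:
  fixes p :: "'a::alg_closed_field poly"
  assumes "lead_coeff p = 1" "\<And>c. even (order c p)"
  obtains w where "p = w ^ 2" "lead_coeff w = 1"
proof
  have p0: "p \<noteq> 0" using assms(1) by auto
  let ?S = "{c. poly p c = 0}"
  define w where "w = (\<Prod>c\<in>?S. [:- c, 1:] ^ (order c p div 2))"
  have "p = (\<Prod>c\<in>#proots p. [:- c, 1:])"
    using proots_alg_closed(2)[OF p0] assms(1) by simp
  also have "\<dots> = (\<Prod>c\<in>?S. [:- c, 1:] ^ order c p)"
    using p0 by (simp add: image_prod_mset_multiplicity)
  also have "\<dots> = w ^ 2"
    unfolding w_def prod_power_distrib
    using assms(2) by (intro prod.cong) (simp_all flip: power_mult)
  finally show "p = w ^ 2" .
  show "lead_coeff w = 1" unfolding w_def lead_coeff_prod by (simp add: lead_coeff_power)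
qed

context halving
begin

section \<open>The divisor of y - B and the doubled class\<close>

lemma order_linear: "order c [:- a, 1:] = (if c = a then 1 else 0)"
  using order_power_n_n[of a 1] by (auto intro: order_0I)

lemma norm_poly_pair:
  assumes "norm_pair A B"
  shows "X.norm_poly (- B) 1 = - ([:- a, 1:] * A ^ 2)"
proof -
  have "X.norm_poly (- B) 1 = - (f - B ^ 2)" by (simp add: X.norm_poly_def)
  also have "f - B ^ 2 = [:- a, 1:] * A ^ 2" using assms by (simp add: norm_pair_def)
  finally show ?thesis .
qed

lemma order_norm_pair:
  assumes "norm_pair A B"
  shows "order c (X.norm_poly (- B) 1) = (if c = a then 1 else 0) + 2 * order c A"
  unfolding norm_poly_pair[OF assms]
  using norm_pair_nonzero[OF assms] by (simp add: order_mult order_linear power2_eq_square)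

lemma norm_pair_root:
  assumes "norm_pair A B" "poly A c = 0"
  shows "poly B c ^ 2 = poly f c" "poly B c \<noteq> 0"
proof -
  have "poly f c = poly B c ^ 2 + (c - a) * poly A c ^ 2"
    using assms(1) by (simp add: norm_pair_def)
  then show "poly B c ^ 2 = poly f c" using assms(2) by simp
  then show "poly B c \<noteq> 0" using norm_pair_no_root[OF assms(1), of c] assms(2) by auto
qed

text \<open>The fibre above \<open>c\<close> carries twice the order of \<open>A\<close>, plus 1 if
  \<open>c = a\<close>. For \<open>d \<noteq> 0\<close> it all sits at the point with
  \<open>d = poly B c\<close>, since \<open>y - B\<close> takes the nonzero value
  \<open>- (2 * d)\<close> at the conjugate of that point. For \<open>d = 0\<close> the fibre is one
  point, and \<open>A\<close> does not vanish there.\<close>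

lemma ord_y_minus:
  assumes np: "norm_pair A B" and Ba: "poly B a = - b" and cd: "d ^ 2 = poly f c"
  shows "ord_at f (Affine c d) (reg (- B) 1)
    = 2 * Poly_Mapping.lookup (root_divisor A B) (Affine c d) + (if c = a \<and> d = - b then 1 else 0)"
proof -
  have A0: "A \<noteq> 0" using norm_pair_nonzero[OF np] .
  have curve: "Affine c d \<in> curve f" "Affine c (- d) \<in> curve f" using cd by simp_all
  have sum: "(\<Sum>d' | d' ^ 2 = d ^ 2. ord_at f (Affine c d') (reg (- B) 1))
      = int ((if c = a then 1 else 0) + 2 * order c A)"
    using fiber_sum[of "- B" 1 c] order_norm_pair[OF np, of c] cd by simp
  show ?thesis
  proof (cases "d = 0")
    case True
    then have "poly A c \<noteq> 0" using norm_pair_no_root[OF np] cd by simp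
    then have oA: "order c A = 0" by (rule order_0I)
    \<comment> \<open>If \<open>c = a\<close>, then \<open>b ^ 2 = d ^ 2 = 0\<close>.\<close>
    have "c = a \<longleftrightarrow> c = a \<and> d = - b" using True cd ab by auto
    then show ?thesis using sum oA True A0 by (auto simp: square_roots_eq lookup_root_divisor)
  next
    case False
    show ?thesis
    proof (cases "poly B c = d")
      case True
      have "poly (- B) c + poly 1 c * (- d) = - (2 * d)" using True by simp
      then have "\<not> ord_at f (Affine c (- d)) (reg (- B) 1) > 0"
        using ord_Affine_reg_nonneg(2)[OF curve(2), of "- B" 1] two False by simp
      then have "ord_at f (Affine c (- d)) (reg (- B) 1) = 0"
        using ord_Affine_reg_nonneg(1)[OF curve(2), of "- B" 1] by simp
      moreover have "c = a \<longleftrightarrow> c = a \<and> d = - b" using True Ba by auto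
      ultimately show ?thesis
        using sum neq_uminus[OF False] True A0 by (simp add: square_roots_eq lookup_root_divisor)
    next
      case neq: False
      then have "\<not> ord_at f (Affine c d) (reg (- B) 1) > 0"
        using ord_Affine_reg_nonneg(2)[OF curve(1), of "- B" 1] by auto
      then have "ord_at f (Affine c d) (reg (- B) 1) = 0"
        using ord_Affine_reg_nonneg(1)[OF curve(1), of "- B" 1] by simp
      moreover have "\<not> (c = a \<and> d = - b)" using neq Ba by auto
      ultimately show ?thesis using neq A0 by (auto simp: lookup_root_divisor)
    qed
  qed
qed

lemma y_minus_nonzero: "reg A 1 \<in> function_field f" "reg A 1 \<noteq> 0"
  using function_field_reg by simp_all

lemma root_divisor_outside:
  assumes "norm_pair A B" "P \<notin> curve f - {Infinity}"
  shows "Poly_Mapping.lookup (root_divisor A B) P = 0"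
proof (cases P)
  case (Affine c d)
  then show ?thesis
    using assms norm_pair_root(1)[OF assms(1), of c] norm_pair_nonzero[OF assms(1)]
    by (auto simp: lookup_root_divisor order_root)
qed simp

lemma size_proots_norm_pair:
  assumes "norm_pair A B" "degree A = g"
  shows "size (proots A) = g"
  using proots_alg_closed(1) norm_pair_nonzero[OF assms(1)] assms(2) by metis

lemma affine_effective_root_divisor: "norm_pair A B \<Longrightarrow> affine_effective (root_divisor A B)"
  unfolding affine_effective_def keys_subset_iff
  using root_divisor_outside norm_pair_nonzero lookup_root_divisor
  by (metis lookup_root_divisor_Infinity of_nat_0_le_iff order_refl point.exhaust)

lemma divi_y_minus:
  assumes np: "norm_pair A B" and Ba: "poly B a = - b"
  shows "divi (reg (- B) 1) = root_divisor A B + root_divisor A B + pt_div (Affine a (- b))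
    - inf_div (2 * int g + 1)"
proof (rule poly_mapping_eqI)
  fix P
  show "Poly_Mapping.lookup (divi (reg (- B) 1)) P = Poly_Mapping.lookup (root_divisor A B +
      root_divisor A B + pt_div (Affine a (- b)) - inf_div (2 * int g + 1)) P"
  proof (cases P)
    case Infinity
    have "degree_norm (- B) 1 = 2 * g + 1"
      using norm_pair_degree(2)[OF np] by (simp add: degree_norm_eq)
    then show ?thesis
      using Infinity ord_Infinity_reg[of "- B" 1]
      by (simp add: lookup_divi[OF y_minus_nonzero] lookup_add lookup_minus lookup_single)
  next
    case (Affine c d)
    show ?thesis
    proof (cases "d ^ 2 = poly f c")
      case True
      then show ?thesis
        using Affine ord_y_minus[OF np Ba True]
        by (auto simp: lookup_divi[OF y_minus_nonzero] lookup_add lookup_minus lookup_single when_def)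
    next
      case False
      then have "\<not> (c = a \<and> d = - b)" using ab by auto
      then show ?thesis
        using False Affine root_divisor_outside[OF np, of P]
        by (auto simp: lookup_divi[OF y_minus_nonzero] lookup_add lookup_minus lookup_single when_def)
    qed
  qed
qed

lemma kpoly_linear_nonzero:
  "kpoly xfun [:- a, 1:] \<in> function_field f" "kpoly xfun [:- a, 1:] \<noteq> 0"
  using function_field_kpoly by simp_all

text \<open>For \<open>b = 0\<close> the two affine points coincide, and their joint coefficient 2
  is the ramification index.\<close>

lemma divi_x_minus:
  "divi (kpoly xfun [:- a, 1:]) = pt_div (Affine a b) + pt_div (Affine a (- b)) - inf_div 2"
proof (rule poly_mapping_eqI)
  fix P
  show "Poly_Mapping.lookup (divi (kpoly xfun [:- a, 1:])) P
    = Poly_Mapping.lookup (pt_div (Affine a b) + pt_div (Affine a (- b)) - inf_div 2) P"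
  proof (cases P)
    case Infinity
    then show ?thesis
      using ord_Infinity_kpoly[of "[:- a, 1:]"]
      by (simp add: lookup_divi[OF kpoly_linear_nonzero] lookup_add lookup_minus lookup_single)
  next
    case (Affine c d)
    show ?thesis
    proof (cases "d ^ 2 = poly f c")
      case True
      have "c = a \<Longrightarrow> d = b \<or> d = - b" using True ab by (metis power2_eq_iff)
      then show ?thesis
        using True Affine ord_Affine_kpoly[of c d "[:- a, 1:]"] neq_uminus[of b]
        by (auto simp: lookup_divi[OF kpoly_linear_nonzero] lookup_add lookup_minus lookup_single
            when_def order_linear X.ram_def)
    next
      case False
      then have "\<not> (c = a \<and> (d = b \<or> d = - b))" using ab by auto
      then show ?thesis
        using False Affine
        by (auto simp: lookup_divi[OF kpoly_linear_nonzero] lookup_add lookup_minus lookup_single when_def)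
    qed
  qed
qed

lemma pt_div_Div0: "pt_div (Affine a b) - pt_div Infinity \<in> carrier (Div0 f)"
  unfolding carrier_Div0 keys_subset_iff using ab
  by (auto simp: div_degree_diff lookup_minus lookup_single when_def)

lemma double_root_divisor:
  assumes np: "norm_pair A B" "degree A = g" and Ba: "poly B a = - b"
  shows "root_divisor A B - inf_div (int g) \<in> carrier (Div0 f)"
    and "cl f (root_divisor A B - inf_div (int g)) \<otimes>\<^bsub>jacobian f\<^esub>
      cl f (root_divisor A B - inf_div (int g)) = embed f (Affine a b)"
proof -
  let ?D = "root_divisor A B - inf_div (int g)"
  show D: "?D \<in> carrier (Div0 f)"
    using inf_div_Div0[OF affine_effective_root_divisor[OF np(1)]]
    by (simp add: div_degree_root_divisor size_proots_norm_pair[OF np])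
  have i: "inf_div (2 * int g + 1) = inf_div (int g) + inf_div (int g) + pt_div Infinity"
    "inf_div 2 = pt_div Infinity + pt_div Infinity"
    by (simp_all flip: single_add)
  have "?D + ?D - (pt_div (Affine a b) - pt_div Infinity)
      = divi (reg (- B) 1) - divi (kpoly xfun [:- a, 1:])"
    unfolding divi_y_minus[OF np(1) Ba] divi_x_minus i by simp
  then have "?D + ?D - (pt_div (Affine a b) - pt_div Infinity) \<in> principal_divisors f"
    using principal_diff divi_principal y_minus_nonzero kpoly_linear_nonzero by metis
  then show "cl f ?D \<otimes>\<^bsub>jacobian f\<^esub> cl f ?D = embed f (Affine a b)"
    using cl_eq_iff[OF Div0_add[OF D D] pt_div_Div0] by (simp add: cl_mult[OF D D] embed_def)
qed

section \<open>Every half comes from a tuple\<close>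

lemma odd_degree_norm:
  assumes "degree_norm A B = 2 * m + 1" "m \<le> g"
  shows "m = g" "degree A \<le> g" "degree B = 0" "B \<noteq> 0"
proof -
  show B: "B \<noteq> 0"
  proof
    assume "B = 0"
    then have "2 * degree A = 2 * m + 1" using assms(1) by (simp add: degree_norm_eq)
    then show False by presburger
  qed
  \<comment> \<open>An odd maximum is attained by the second entry, which is at least
    \<open>2 * g + 1\<close>.\<close>
  then have "max (2 * degree A) (2 * g + 1 + 2 * degree B) = 2 * m + 1"
    using assms(1) by (simp add: degree_norm_eq)
  then show "m = g" "degree A \<le> g" "degree B = 0" using assms(2) by linarith+
qed

text \<open>
  If \<open>div(y - v) = 2E + (a, - b) - (2g + 1)(\<infinity>)\<close>, then every order of the norm of \<open>y - v\<close>
  is even, except for the contribution of \<open>(a, - b)\<close>.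
\<close>

lemma norm_pair_of_half:
  assumes v: "degree v \<le> g"
    and E: "divi (reg (- v) 1) = E + E + pt_div (Affine a (- b)) - inf_div n"
  obtains A where "norm_pair A v"
proof -
  let ?N = "X.norm_poly (- v) 1"
  have nz: "- v \<noteq> 0 \<or> (1 :: 'a poly) \<noteq> 0" by simp
  have ord: "ord_at f (Affine c d) (reg (- v) 1)
      = 2 * Poly_Mapping.lookup E (Affine c d) + (if c = a \<and> d = - b then 1 else 0)"
    if "d ^ 2 = poly f c" for c d
    using arg_cong[OF E, of "\<lambda>D. Poly_Mapping.lookup D (Affine c d)"] that
    by (auto simp: lookup_divi[OF y_minus_nonzero] lookup_add lookup_minus lookup_single when_def)
  have odd: "odd (order c ?N) \<longleftrightarrow> c = a" for c
  proof -
    have "int (order c ?N) = (\<Sum>d | d ^ 2 = poly f c. 2 * Poly_Mapping.lookup E (Affine c d)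
        + (if c = a \<and> d = - b then 1 else 0))"
      unfolding fiber_sum[OF nz, symmetric] by (intro sum.cong) (simp_all add: ord)
    also have "\<dots> = 2 * (\<Sum>d | d ^ 2 = poly f c. Poly_Mapping.lookup E (Affine c d))
        + (\<Sum>d | d ^ 2 = poly f c. if d = - b then (if c = a then 1 else 0) else 0)"
      unfolding sum.distrib sum_distrib_left by (intro arg_cong2[where f = "(+)"] sum.cong) auto
    \<comment> \<open>For \<open>c = a\<close> the value \<open>- b\<close> is among the square
      roots, and it is counted once even if \<open>b = 0\<close>.\<close>
    also have "(\<Sum>d | d ^ 2 = poly f c. if d = - b then (if c = a then 1 else 0) else 0)
        = (if c = a then 1 else 0 :: int)"
      using ab by (subst sum.delta[OF finite_square_roots]) auto
    finally have "int (order c ?N) = 2 * (\<Sum>d | d ^ 2 = poly f c. Poly_Mapping.lookup E (Affine c d))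
        + (if c = a then 1 else 0)" .
    moreover have "odd k \<longleftrightarrow> P" if "int k = 2 * S + (if P then 1 else 0)" for k S P
      using that by (cases P) presburger+
    ultimately show ?thesis by blast
  qed
  have N: "?N = - (f - v ^ 2)" by (simp add: X.norm_poly_def)
  define M where "M = f - v ^ 2"
  have oM: "odd (order c M) \<longleftrightarrow> c = a" for c
    using odd[of c] unfolding N M_def[symmetric] by simp
  \<comment> \<open>\<open>v ^ 2\<close> has degree at most \<open>2 * g\<close>, so
    \<open>f - v ^ 2\<close> keeps the leading coefficient of \<open>f\<close>.\<close>
  have "degree (v ^ 2) < degree f" using v degree_power_le[of v 2] degree_f by simp
  then have "lead_coeff (- (v ^ 2) + f) = lead_coeff f" by (intro lead_coeff_add_le) simp
  then have "lead_coeff M = lead_coeff f" unfolding M_def by simp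
  then have M1: "lead_coeff M = 1" by (simp add: monic_f)
  then have M0: "M \<noteq> 0" by auto
  have "poly M a = 0" using oM[of a] M0 by (metis even_zero order_root)
  then obtain W where W: "M = [:- a, 1:] * W" by (auto simp: poly_eq_0_iff_dvd dvd_def)
  have W0: "W \<noteq> 0" using W M0 by auto
  have W1: "lead_coeff W = 1" using M1 unfolding W lead_coeff_mult by simp
  have "order c M = (if c = a then 1 else 0) + order c W" for c
    unfolding W using W0 by (simp add: order_mult order_linear)
  then have "even (order c W)" for c using oM[of c] by (simp split: if_splits)
  then obtain w where w: "W = w ^ 2" "lead_coeff w = 1" using monic_square[OF W1] by blast
  \<comment> \<open>The sign demanded by \<open>norm_pair\<close>; it disappears on
    squaring.\<close>
  define A where "A = smult ((-1) ^ g) w"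
  have "A ^ 2 = w ^ 2" unfolding A_def by (simp add: smult_power flip: power_mult)
  moreover have "lead_coeff A = (-1) ^ g" unfolding A_def using w(2) by (simp add: lead_coeff_smult)
  moreover have "f = v ^ 2 + [:- a, 1:] * w ^ 2" using W w(1) unfolding M_def by (simp add: algebra_simps)
  ultimately show ?thesis using that unfolding norm_pair_def by metis
qed

lemma root_tuples_iff:
  "r \<in> root_tuples g \<alpha> a b \<longleftrightarrow> r \<in> extensional {1..2 * g + 1} \<and> sqrts r \<and> (\<Prod>i=1..2 * g + 1. r i) = - b"
  by (auto simp: root_tuples_def sqrts_def PiE_def)

lemma root_tuple_facts:
  assumes "r \<in> root_tuples g \<alpha> a b"
  shows "sqrts r" "norm_pair (even_part g a r) (odd_part g a r)" "degree (even_part g a r) = g"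
    "poly (odd_part g a r) a = - b"
  using assms norm_pair_parts degree_even_part(1)[OF g_pos] unfolding root_tuples_iff poly_odd_part_a
  by blast+

lemma norm_pair_root_tuple:
  assumes np: "norm_pair A B" and Ba: "poly B a = - b"
  obtains r where "r \<in> root_tuples g \<alpha> a b" "A = even_part g a r" "B = odd_part g a r"
proof -
  define r where "r = restrict (\<lambda>i. poly B (\<alpha> i) / poly A (\<alpha> i)) {1..2 * g + 1}"
  have nz: "poly A (\<alpha> i) \<noteq> 0" "poly f (\<alpha> i) = 0" if "i \<in> {1..2 * g + 1}" for i
    using norm_pair_no_root[OF np] that poly_f_eq_0_iff by blast+
  have r: "poly B (\<alpha> i) = r i * poly A (\<alpha> i)" if "i \<in> {1..2 * g + 1}" for i
    using nz[OF that] that unfolding r_def by simp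
  have s: "sqrts r"
    unfolding sqrts_def
  proof
    fix i assume i: "i \<in> {1..2 * g + 1}"
    have "poly f (\<alpha> i) = poly B (\<alpha> i) ^ 2 + (\<alpha> i - a) * poly A (\<alpha> i) ^ 2"
      using np by (simp add: norm_pair_def)
    then have "r i ^ 2 * poly A (\<alpha> i) ^ 2 = (a - \<alpha> i) * poly A (\<alpha> i) ^ 2"
      using nz(2)[OF i] r[OF i] by (simp add: power_mult_distrib algebra_simps eq_neg_iff_add_eq_0)
    then show "r i ^ 2 = a - \<alpha> i" using nz(1)[OF i] by simp
  qed
  have eq: "A = even_part g a r" "B = odd_part g a r"
    using norm_pair_unique[OF np norm_pair_parts[OF s] r poly_odd_part_root[OF s]] by blast+
  have "(\<Prod>i=1..2 * g + 1. r i) = - b" using Ba unfolding eq(2) poly_odd_part_a .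
  then have "r \<in> root_tuples g \<alpha> a b" unfolding root_tuples_iff using s by (simp add: r_def)
  then show ?thesis using that eq by blast
qed

lemma half_is_root_class:
  assumes "\<aa> \<in> halves f (Affine a b)"
  shows "\<exists>r\<in>root_tuples g \<alpha> a b. \<aa> = cl f (root_divisor (even_part g a r) (odd_part g a r) - inf_div (int g))"
proof -
  let ?P = "pt_div (Affine a b)" and ?Q = "pt_div (Affine a (- b))"
  obtain D where D: "D \<in> carrier (Div0 f)" "\<aa> = cl f D"
    using assms unfolding halves_def carrier_jacobian by blast
  obtain E where E: "affine_effective E" "div_degree E \<le> int g" "cl f D = cl f (E - inf_div (div_degree E))"
    using small_representative[OF D(1)] .
  have "div_degree E \<ge> 0"
    using E(1) unfolding affine_effective_def div_degree_def by (simp add: sum_nonneg)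
  then obtain m where m: "div_degree E = int m" by (metis nonneg_int_cases)
  let ?E = "E - inf_div (int m)"
  have E0: "?E \<in> carrier (Div0 f)" using inf_div_Div0[OF E(1)] m by simp
  have "cl f ?E \<otimes>\<^bsub>jacobian f\<^esub> cl f ?E = embed f (Affine a b)"
    using assms D(2) E(3) m by (simp add: halves_def)
  then have "?E + ?E - (?P - pt_div Infinity) \<in> principal_divisors f"
    using cl_eq_iff[OF Div0_add[OF E0 E0] pt_div_Div0] by (simp add: cl_mult[OF E0 E0] embed_def)
  then obtain h0 where h0: "h0 \<in> function_field f" "h0 \<noteq> 0" "?E + ?E - (?P - pt_div Infinity) = divi h0"
    unfolding principal_divisors_iff by blast
  \<comment> \<open>The factor \<open>x - a\<close> trades the term \<open>- ?P\<close> for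
    \<open>+ ?Q\<close>, so that no affine pole remains.\<close>
  define h where "h = h0 * kpoly xfun [:- a, 1:]"
  have h: "h \<in> function_field f" "h \<noteq> 0"
    unfolding h_def using h0 kpoly_linear_nonzero function_field_mult by auto
  have i: "inf_div (2 * int m + 1) = inf_div (int m) + inf_div (int m) + pt_div Infinity"
    "inf_div 2 = pt_div Infinity + pt_div Infinity"
    by (simp_all flip: single_add)
  have dh: "divi h = E + E + ?Q - inf_div (2 * int m + 1)"
    unfolding h_def divi_mult[OF h0(1,2) kpoly_linear_nonzero] divi_x_minus h0(3)[symmetric] i by simp
  have E_Infinity: "Poly_Mapping.lookup E Infinity = 0"
    using E(1) unfolding affine_effective_def keys_subset_iff by blast
  have "ord_at f (Affine c d) h \<ge> 0" if "d ^ 2 = poly f c" for c d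
  proof -
    have "Poly_Mapping.lookup E (Affine c d) \<ge> 0" using E(1) by (simp add: affine_effective_def)
    then show ?thesis
      using arg_cong[OF dh, of "\<lambda>D. Poly_Mapping.lookup D (Affine c d)"] that
      by (simp add: lookup_divi[OF h] lookup_add lookup_minus lookup_single when_def split: if_splits)
  qed
  then obtain A0 B0 where AB: "h = reg A0 B0" using regular_if_ord_nonneg[OF h] by blast
  then have nz: "A0 \<noteq> 0 \<or> B0 \<noteq> 0" using h(2) by auto
  have "ord_at f Infinity h = - (2 * int m + 1)"
    using arg_cong[OF dh, of "\<lambda>D. Poly_Mapping.lookup D Infinity"] E_Infinity
    by (simp add: lookup_divi[OF h] lookup_add lookup_minus lookup_single)
  then have "degree_norm A0 B0 = 2 * m + 1" using ord_Infinity_reg[OF nz] AB by simp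
  moreover have "m \<le> g" using m E(2) by simp
  ultimately have deg: "m = g" "degree A0 \<le> g" "degree B0 = 0" "B0 \<noteq> 0"
    using odd_degree_norm by blast+
  obtain e where e: "B0 = [:e:]" "e \<noteq> 0" using deg(3,4) by (metis degree_eq_zeroE pCons_0_0)
  \<comment> \<open>Division by the constant \<open>e\<close> normalises the coefficient of
    \<open>y\<close> to 1.\<close>
  define v where "v = - smult (inverse e) A0"
  have "kconst (inverse e) * h = reg (- v) 1"
    unfolding AB X.reg_const_mult v_def using e by (simp flip: one_pCons)
  then have dv: "divi (reg (- v) 1) = E + E + ?Q - inf_div (2 * int g + 1)"
    using divi_smult[OF h, of "inverse e"] e(2) dh deg(1) by simp
  have "degree v \<le> g" unfolding v_def using deg(2) e(2) by simp
  then obtain A where np: "norm_pair A v" using norm_pair_of_half dv by blast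
  have va: "poly v a = - b"
  proof -
    have aQ: "Affine a (- b) \<in> curve f" using ab by simp
    have "Poly_Mapping.lookup E (Affine a (- b)) \<ge> 0" using E(1) by (simp add: affine_effective_def)
    \<comment> \<open>The effective divisor \<open>E\<close> cannot cancel the term
      \<open>?Q\<close>, so \<open>y - v\<close> vanishes at \<open>(a, - b)\<close>.\<close>
    then have "ord_at f (Affine a (- b)) (reg (- v) 1) > 0"
      using arg_cong[OF dv, of "\<lambda>D. Poly_Mapping.lookup D (Affine a (- b))"] aQ
      by (simp add: lookup_divi[OF y_minus_nonzero] lookup_add lookup_minus lookup_single)
    then have "- poly v a = b"
      using ord_Affine_reg_nonneg(2)[OF aQ, of "- v" 1] by simp
    then show ?thesis by (metis minus_minus)
  qed
  obtain r where r: "r \<in> root_tuples g \<alpha> a b" "A = even_part g a r" "v = odd_part g a r"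
    using norm_pair_root_tuple[OF np va] .
  have EE: "E + E = root_divisor A v + root_divisor A v"
    using dv unfolding divi_y_minus[OF np va] by simp
  \<comment> \<open>Divisors have integer coefficients, so the doubled equation can be
    halved.\<close>
  have "E = root_divisor A v"
  proof (rule poly_mapping_eqI)
    fix P
    show "Poly_Mapping.lookup E P = Poly_Mapping.lookup (root_divisor A v) P"
      using arg_cong[OF EE, of "\<lambda>D. Poly_Mapping.lookup D P"] by (simp add: lookup_add)
  qed
  then show ?thesis using r D(2) E(3) m deg(1) by auto
qed

section \<open>Different tuples give different classes\<close>

lemma ord_kpoly_pair:
  assumes np: "norm_pair A B" and cd: "d ^ 2 = poly f c"
  shows "ord_at f (Affine c d) (kpoly xfun A) =
    Poly_Mapping.lookup (root_divisor A B) (Affine c d) + Poly_Mapping.lookup (root_divisor A B) (Affine c (- d))"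
proof -
  have A0: "A \<noteq> 0" using norm_pair_nonzero[OF np] .
  have o: "ord_at f (Affine c d) (kpoly xfun A) = X.ram d * int (order c A)"
    using ord_Affine_kpoly[of c d A] cd A0 by simp
  show ?thesis
  proof (cases "poly A c = 0")
    case True
    have "poly B c ^ 2 = d ^ 2" "poly B c \<noteq> 0" using norm_pair_root[OF np True] cd by simp_all
    \<comment> \<open>Above a root of \<open>A\<close> the two points are distinct, and exactly one
      of them belongs to the divisor.\<close>
    then have "d \<noteq> 0" "poly B c = d \<or> poly B c = - d" by (auto simp: power2_eq_iff)
    then show ?thesis
      unfolding o lookup_root_divisor[OF A0] using neq_uminus[of d] by (auto simp: X.ram_def)
  next
    case False
    then have "order c A = 0" by (rule order_0I)
    then show ?thesis unfolding o lookup_root_divisor[OF A0] by simp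
  qed
qed

text \<open>
  \<open>D + \<iota>D' - 2g(\<infinity>)\<close> is the divisor of a function whose pole order \<open>2g\<close> is too small for
  \<open>y\<close> to occur. It is thus a polynomial in \<open>x\<close>, and its divisor is invariant under \<open>\<iota>\<close>.
\<close>

lemma class_eq_symmetric:
  assumes np: "norm_pair A B" "degree A = g" and np': "norm_pair A' B'" "degree A' = g"
    and eq: "root_divisor A B - root_divisor A' B' \<in> principal_divisors f"
    and cd: "d ^ 2 = poly f c"
  shows "Poly_Mapping.lookup (root_divisor A B) (Affine c d) + Poly_Mapping.lookup (root_divisor A' B') (Affine c (- d))
    = Poly_Mapping.lookup (root_divisor A B) (Affine c (- d)) + Poly_Mapping.lookup (root_divisor A' B') (Affine c d)"
proof -
  obtain h0 where h0: "h0 \<in> function_field f" "h0 \<noteq> 0" "root_divisor A B - root_divisor A' B' = divi h0"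
    using eq unfolding principal_divisors_iff by blast
  have A0: "A' \<noteq> 0" using norm_pair_nonzero[OF np'(1)] .
  then have k: "kpoly xfun A' \<in> function_field f" "kpoly xfun A' \<noteq> 0" using function_field_kpoly by auto
  \<comment> \<open>The affine divisor of \<open>A'\<close> is the sum of
    \<open>root_divisor A' B'\<close> and its conjugate, so this factor replaces the negative part
    by an effective one.\<close>
  define h where "h = h0 * kpoly xfun A'"
  have h: "h \<in> function_field f" "h \<noteq> 0"
    unfolding h_def using h0 k function_field_mult by auto
  have oh: "ord_at f P h = ord_at f P h0 + ord_at f P (kpoly xfun A')" if "P \<in> curve f" for P
    unfolding h_def using ord_mult[OF that h0(1,2) k] .
  have oh0: "ord_at f P h0 = Poly_Mapping.lookup (root_divisor A B) P - Poly_Mapping.lookup (root_divisor A' B') P"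
    if "P \<in> curve f" for P
    using arg_cong[OF h0(3), of "\<lambda>D. Poly_Mapping.lookup D P"] that
    by (simp add: lookup_divi[OF h0(1,2)] lookup_minus)
  have o: "ord_at f (Affine c d) h =
      Poly_Mapping.lookup (root_divisor A B) (Affine c d) + Poly_Mapping.lookup (root_divisor A' B') (Affine c (- d))"
    if "d ^ 2 = poly f c" for c d
    using oh[of "Affine c d"] oh0[of "Affine c d"] ord_kpoly_pair[OF np'(1) that] that by simp
  have "ord_at f (Affine c d) h \<ge> 0" if "d ^ 2 = poly f c" for c d
    unfolding o[OF that]
    using affine_effective_root_divisor[OF np(1)] affine_effective_root_divisor[OF np'(1)]
    by (simp add: affine_effective_def)
  then obtain A0 B0 where AB: "h = reg A0 B0" using regular_if_ord_nonneg[OF h] by blast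
  then have nz: "A0 \<noteq> 0 \<or> B0 \<noteq> 0" using h(2) by auto
  have "ord_at f Infinity h = - int (2 * g)"
    using oh[of Infinity] oh0[of Infinity] ord_Infinity_kpoly[OF A0] np'(2) by simp
  then have "degree_norm A0 B0 = 2 * g" using ord_Infinity_reg[OF nz] AB by simp
  \<comment> \<open>A nonzero \<open>B0\<close> would give a pole order of at least
    \<open>2 * g + 1\<close>.\<close>
  then have "B0 = 0" by (simp add: degree_norm_eq split: if_splits)
  then have "ord_at f (Affine c d) h = ord_at f (Affine c (- d)) h"
    using nz AB ord_Affine_kpoly[of c d A0] ord_Affine_kpoly[of c "- d" A0] cd by (simp add: X.ram_def)
  then show ?thesis using o[of d c] o[of "- d" c] cd by simp
qed

text \<open>The first divisor contains \<open>(c, poly B c)\<close> and not its conjugate. By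
  \<open>sym\<close> the second divisor contains this point with larger multiplicity than the
  conjugate; as it contains at most one of the two, the multiplicities agree.\<close>

lemma class_eq_order:
  assumes np: "norm_pair A B" and np': "norm_pair A' B'"
    and sym: "\<And>c d. d ^ 2 = poly f c \<Longrightarrow>
      Poly_Mapping.lookup (root_divisor A B) (Affine c d) + Poly_Mapping.lookup (root_divisor A' B') (Affine c (- d))
      = Poly_Mapping.lookup (root_divisor A B) (Affine c (- d)) + Poly_Mapping.lookup (root_divisor A' B') (Affine c d)"
    and root: "poly A c = 0"
  shows "poly B' c = poly B c" "order c A' = order c A"
proof -
  have A0: "A \<noteq> 0" "A' \<noteq> 0" using norm_pair_nonzero np np' by blast+
  define d where "d = poly B c"
  have d: "d ^ 2 = poly f c" "d \<noteq> 0" unfolding d_def using norm_pair_root[OF np root] by simp_all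
  have "order c A > 0" using root A0 by (simp add: order_gt_0_iff)
  have "int (order c A) + (if - d = poly B' c then int (order c A') else 0)
      = (if d = poly B' c then int (order c A') else 0)"
    using sym[OF d(1)] neq_uminus[OF d(2)] unfolding lookup_root_divisor[OF A0(1)] lookup_root_divisor[OF A0(2)]
    by (simp add: d_def)
  then show "poly B' c = poly B c" "order c A' = order c A"
    using \<open>order c A > 0\<close> neq_uminus[OF d(2)] d_def by (auto split: if_splits)
qed

lemma root_class_inj:
  assumes np: "norm_pair A B" "degree A = g" "poly B a = - b"
    and np': "norm_pair A' B'" "degree A' = g" "poly B' a = - b"
    and eq: "cl f (root_divisor A B - inf_div (int g)) = cl f (root_divisor A' B' - inf_div (int g))"
  shows "A = A'" "B = B'"
proof -
  have p: "root_divisor A B - root_divisor A' B' \<in> principal_divisors f"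
    using cl_eq_iff[OF double_root_divisor(1)[OF np] double_root_divisor(1)[OF np']] eq by simp
  note sym = class_eq_symmetric[OF np(1,2) np'(1,2) p]
  have A0: "A \<noteq> 0" "A' \<noteq> 0" using norm_pair_nonzero np np' by blast+
  have "order c A = order c A'" for c
  proof (cases "poly A c = 0 \<or> poly A' c = 0")
    case True
    then show ?thesis
      using class_eq_order(2)[OF np(1) np'(1) sym, of c] class_eq_order(2)[OF np'(1) np(1), of c] sym
      by fastforce
  next
    case False
    then show ?thesis by (simp add: order_0I)
  qed
  then have "proots A = proots A'" using A0 by (intro multiset_eqI) simp
  then show AA: "A = A'"
    using proots_alg_closed(2)[OF A0(1)] proots_alg_closed(2)[OF A0(2)] np(1) np'(1)
    unfolding norm_pair_def by metis
  have "B ^ 2 + [:- a, 1:] * A ^ 2 = B' ^ 2 + [:- a, 1:] * A' ^ 2"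
    using np(1) np'(1) unfolding norm_pair_def by metis
  then have "B ^ 2 = B' ^ 2" using AA by simp
  then have "B = B' \<or> B = - B'" by (simp add: power2_eq_iff)
  moreover have "B \<noteq> - B'"
  proof
    assume BB: "B = - B'"
    \<comment> \<open>\<open>g \<ge> 1\<close> provides a root of \<open>A\<close>. There
      \<open>B\<close> is nonzero and agrees with \<open>B'\<close>, which excludes the opposite
      sign.\<close>
    obtain c where c: "poly A c = 0" using alg_closed_imp_poly_has_root[of A] np(2) g_pos by auto
    have "poly B' c = poly B c" using class_eq_order(1)[OF np(1) np'(1) sym c] .
    then show False using neq_uminus[of "poly B' c"] norm_pair_root(2)[OF np(1) c] BB by simp
  qed
  ultimately show "B = B'" by blast
qed

section \<open>The number of tuples\<close>

lemma card_square_roots: "e \<noteq> 0 \<Longrightarrow> card {z :: 'a. z ^ 2 = e} = 2"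
proof -
  assume "e \<noteq> 0"
  obtain d where d: "e = d ^ 2" using nth_root_exists[of 2 e] by (metis zero_less_numeral)
  then have "d \<noteq> 0" using \<open>e \<noteq> 0\<close> by auto
  then show ?thesis unfolding d square_roots_eq using neq_uminus[of d] by (auto simp: card_insert_if)
qed

text \<open>All but one entry can be chosen freely; the prescribed product determines the last one.\<close>

lemma card_root_tuples: "card (root_tuples g \<alpha> a b) = 2 ^ (2 * g)"
proof -
  let ?I = "{1..2 * g + 1}"
  \<comment> \<open>The entry to be determined by the others: for \<open>b = 0\<close> the unique
    index with \<open>a = \<alpha> k\<close>, otherwise any index. The remaining entries are then
    nonzero, and one may divide by their product.\<close>
  obtain k where k: "k \<in> ?I" "\<And>i. i \<in> ?I - {k} \<Longrightarrow> a \<noteq> \<alpha> i"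
  proof (cases "b = 0")
    case True
    then obtain k where "k \<in> ?I" "a = \<alpha> k" using ab poly_f_eq_0_iff[of a] by auto
    then show ?thesis using that[of k] inj_onD[OF inj] by blast
  next
    case False
    then have "\<forall>i\<in>?I. a \<noteq> \<alpha> i" using ab poly_f_eq_0_iff[of a] by auto
    then show ?thesis using that[of 1] by auto
  qed
  let ?J = "?I - {k}"
  let ?T = "\<Pi>\<^sub>E i\<in>?J. {z. z ^ 2 = a - \<alpha> i}"
  have prodJ: "(\<Prod>i\<in>?J. s i) ^ 2 = (\<Prod>i\<in>?J. a - \<alpha> i)" if "\<And>i. i \<in> ?J \<Longrightarrow> s i ^ 2 = a - \<alpha> i" for s
    unfolding prod_power_distrib using that by (intro prod.cong) auto
  have pJ: "(\<Prod>i\<in>?J. a - \<alpha> i) \<noteq> 0" using k(2) by (subst prod_zero_iff) auto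
  have b2: "b ^ 2 = (a - \<alpha> k) * (\<Prod>i\<in>?J. a - \<alpha> i)"
    unfolding ab poly_f using k(1) by (subst prod.remove[of _ k]) auto
  have nz: "(\<Prod>i\<in>?J. s i) \<noteq> 0" if "\<And>i. i \<in> ?J \<Longrightarrow> s i ^ 2 = a - \<alpha> i" for s
  proof
    assume z: "(\<Prod>i\<in>?J. s i) = 0"
    have "(\<Prod>i\<in>?J. s i) ^ 2 = (\<Prod>i\<in>?J. a - \<alpha> i)" by (rule prodJ) (rule that)
    then have "(\<Prod>i\<in>?J. s i) ^ 2 \<noteq> 0" using pJ by (simp only: not_False_eq_True)
    then show False unfolding z by simp
  qed
  have "bij_betw (\<lambda>r. restrict r ?J) (root_tuples g \<alpha> a b) ?T"
  proof (rule bij_betw_byWitness[where f' = "\<lambda>s. s(k := - b / (\<Prod>i\<in>?J. s i))"])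
    show "\<forall>r\<in>root_tuples g \<alpha> a b. (restrict r ?J)(k := - b / (\<Prod>i\<in>?J. restrict r ?J i)) = r"
    proof
      fix r assume r: "r \<in> root_tuples g \<alpha> a b"
      then have sq: "r i ^ 2 = a - \<alpha> i" if "i \<in> ?I" for i using that unfolding root_tuples_def by blast
      have "r k * (\<Prod>i\<in>?J. r i) = - b"
        using r k(1) unfolding root_tuples_def by (subst prod.remove[symmetric]) auto
      then have "- b / (\<Prod>i\<in>?J. r i) = r k" using nz[of r] sq by (simp add: field_simps)
      moreover have "r \<in> extensional ?I" using r root_tuples_iff by blast
      ultimately show "(restrict r ?J)(k := - b / (\<Prod>i\<in>?J. restrict r ?J i)) = r"
        by (intro ext) (auto simp: extensional_def)
    qed
    show "\<forall>s\<in>?T. restrict (s(k := - b / (\<Prod>i\<in>?J. s i))) ?J = s"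
      by (auto simp: restrict_def PiE_def extensional_def fun_eq_iff)
    show "(\<lambda>r. restrict r ?J) ` root_tuples g \<alpha> a b \<subseteq> ?T"
      by (intro image_subsetI) (auto simp: root_tuples_def restrict_PiE_iff)
    show "(\<lambda>s. s(k := - b / (\<Prod>i\<in>?J. s i))) ` ?T \<subseteq> root_tuples g \<alpha> a b"
    proof (rule image_subsetI)
      fix s assume s: "s \<in> ?T"
      have sq: "s i ^ 2 = a - \<alpha> i" if "i \<in> ?J" for i
        using PiE_mem[OF s that] by (rule CollectD)
      let ?r = "s(k := - b / (\<Prod>i\<in>?J. s i))"
      have "?r i ^ 2 = a - \<alpha> i" if "i \<in> ?I" for i
      proof (cases "i = k")
        case True
        have "?r k ^ 2 = b ^ 2 / (\<Prod>i\<in>?J. a - \<alpha> i)"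
          using prodJ[of s, OF sq] by (simp add: power_divide del: prod_power_distrib)
        then show ?thesis using True b2 pJ by simp
      next
        case False
        then show ?thesis using sq that by simp
      qed
      moreover have "(\<Prod>i\<in>?I. ?r i) = - b"
      proof -
        have "(\<Prod>i\<in>?I. ?r i) = ?r k * (\<Prod>i\<in>?J. ?r i)" using k(1) by (subst prod.remove[of _ k]) auto
        also have "(\<Prod>i\<in>?J. ?r i) = (\<Prod>i\<in>?J. s i)" by (intro prod.cong) auto
        finally show ?thesis using nz[of s] sq by simp
      qed
      moreover have "?r \<in> extensional ?I" using s k(1) by (auto simp: PiE_def extensional_def)
      ultimately show "?r \<in> root_tuples g \<alpha> a b" unfolding root_tuples_iff sqrts_def by blast
    qed
  qed
  then have "card (root_tuples g \<alpha> a b) = card ?T" by (rule bij_betw_same_card)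
  also have "\<dots> = (\<Prod>i\<in>?J. 2)"
    unfolding card_PiE[OF finite_Diff[OF finite_atLeastAtMost]]
    using k(2) by (intro prod.cong card_square_roots) auto
  also have "\<dots> = 2 ^ (2 * g)" using k(1) by simp
  finally show ?thesis .
qed

section \<open>From the parts to U and V, and the bijection\<close>

lemma U_poly_scaled: "U_poly g a r = smult ((-1) ^ g) (even_part g a r)"
proof -
  have "(-1 :: 'a poly) ^ g = [:(-1) ^ g:]"
    by (induction g) (simp_all add: one_pCons mult_pCons_left)
  then show ?thesis unfolding U_poly_eq by (simp add: mult_pCons_left)
qed

lemma proots_U_poly: "proots (U_poly g a r) = proots (even_part g a r)"
  unfolding U_poly_scaled by (simp add: proots_smult)

text \<open>Subtracting a multiple of \<open>even_part\<close> brings the degree below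
  \<open>g\<close> and keeps the values at its roots.\<close>

lemma poly_V_poly_root:
  "poly (even_part g a r) c = 0 \<Longrightarrow> poly (V_poly g a r) c = poly (odd_part g a r) c"
  by (simp add: V_poly_eq)

lemma root_divisor_U_V:
  "root_divisor (U_poly g a r) (V_poly g a r) = root_divisor (even_part g a r) (odd_part g a r)"
proof (cases "even_part g a r = 0")
  case False
  then show ?thesis
    unfolding root_divisor_def proots_U_poly
    by (intro arg_cong[where f = sum_mset] image_mset_cong) (simp add: poly_V_poly_root)
qed (simp add: root_divisor_def proots_U_poly)

definition root_class :: "(nat \<Rightarrow> 'a) \<Rightarrow> 'a divisor set" where
  "root_class r = cl f (root_divisor (U_poly g a r) (V_poly g a r) - inf_div (int g))"

lemma root_class_eq:
  "root_class r = cl f (root_divisor (even_part g a r) (odd_part g a r) - inf_div (int g))"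
  by (simp add: root_class_def root_divisor_U_V)

lemma root_class_double:
  assumes "r \<in> root_tuples g \<alpha> a b"
  shows "root_class r \<otimes>\<^bsub>jacobian f\<^esub> root_class r = embed f (Affine a b)"
  using double_root_divisor(2)[OF root_tuple_facts(2-4)[OF assms]] by (simp add: root_class_eq)

lemma root_class_half:
  assumes "r \<in> root_tuples g \<alpha> a b"
  shows "root_class r \<in> halves f (Affine a b)"
  using double_root_divisor(1)[OF root_tuple_facts(2-4)[OF assms]] root_class_double[OF assms]
  by (auto simp: halves_def carrier_jacobian root_class_eq)

lemma root_tuple_eq:
  assumes "r \<in> root_tuples g \<alpha> a b" "i \<in> {1..2 * g + 1}"
  shows "r i = poly (odd_part g a r) (\<alpha> i) / poly (even_part g a r) (\<alpha> i)"
    and "poly (even_part g a r) (\<alpha> i) \<noteq> 0"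
proof -
  show nz: "poly (even_part g a r) (\<alpha> i) \<noteq> 0"
    using norm_pair_no_root[OF root_tuple_facts(2)[OF assms(1)]] poly_f_eq_0_iff assms(2) by blast
  show "r i = poly (odd_part g a r) (\<alpha> i) / poly (even_part g a r) (\<alpha> i)"
    using poly_odd_part_root[OF root_tuple_facts(1)[OF assms(1)] assms(2)] nz by simp
qed

lemma root_class_bij: "bij_betw root_class (root_tuples g \<alpha> a b) (halves f (Affine a b))"
proof (rule bij_betw_imageI)
  show "inj_on root_class (root_tuples g \<alpha> a b)"
  proof (rule inj_onI)
    fix r r' assume r: "r \<in> root_tuples g \<alpha> a b" and r': "r' \<in> root_tuples g \<alpha> a b"
      and "root_class r = root_class r'"
    then have eq: "even_part g a r = even_part g a r'" "odd_part g a r = odd_part g a r'"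
      using root_class_inj[OF root_tuple_facts(2-4)[OF r] root_tuple_facts(2-4)[OF r']]
      by (simp_all add: root_class_eq)
    \<comment> \<open>The entries are the ratios of the two parts at the \<open>\<alpha> i\<close>,
      so equal parts mean equal tuples.\<close>
    show "r = r'"
    proof (rule extensionalityI)
      show "r \<in> extensional {1..2 * g + 1}" "r' \<in> extensional {1..2 * g + 1}"
        using r r' root_tuples_iff by blast+
    qed (use root_tuple_eq(1)[OF r] root_tuple_eq(1)[OF r'] eq in simp)
  qed
  show "root_class ` root_tuples g \<alpha> a b = halves f (Affine a b)"
    using root_class_half half_is_root_class by (auto simp: root_class_eq)
qed

lemma U_poly_root_iff: "poly (U_poly g a r) c = 0 \<longleftrightarrow> poly (even_part g a r) c = 0"
  by (simp add: U_poly_scaled)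

lemma root_tuple_eq_U_V:
  assumes "r \<in> root_tuples g \<alpha> a b" "i \<in> {1..2 * g + 1}"
  shows "r i = elem_sym (2 * g + 1) r 1 + (-1) ^ g * (poly (V_poly g a r) (\<alpha> i) / poly (U_poly g a r) (\<alpha> i))"
proof -
  have "(-1 :: 'a) ^ g * (-1) ^ g = 1" by (simp flip: power_mult_distrib)
  then have "(-1) ^ g * (v / ((-1) ^ g * u)) = v / u" for u v :: 'a
    by (metis mult_divide_mult_cancel_left_if mult_zero_left times_divide_eq_right zero_neq_one)
  then have "(-1) ^ g * (poly (V_poly g a r) (\<alpha> i) / poly (U_poly g a r) (\<alpha> i))
      = poly (V_poly g a r) (\<alpha> i) / poly (even_part g a r) (\<alpha> i)"
    by (simp only: U_poly_scaled poly_smult)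
  then show ?thesis
    using root_tuple_eq[OF assms] by (simp add: V_poly_eq diff_divide_distrib)
qed

lemma coprime_U_f:
  assumes "r \<in> root_tuples g \<alpha> a b"
  shows "coprime (U_poly g a r) f"
proof (rule coprimeI)
  fix c assume c: "c dvd U_poly g a r" "c dvd f"
  show "is_unit c"
  proof (rule ccontr)
    assume "\<not> is_unit c"
    moreover have "c \<noteq> 0" using c(2) f_nonzero by auto
    ultimately have "degree c > 0" by (simp add: is_unit_iff_degree)
    then obtain x where "poly c x = 0" using alg_closed_imp_poly_has_root by blast
    then have "poly (U_poly g a r) x = 0" "poly f x = 0" using c by (auto elim!: dvdE)
    then show False
      using norm_pair_no_root[OF root_tuple_facts(2)[OF assms]] by (simp add: U_poly_root_iff)
  qed
qed

section \<open>Reducedness and the Mumford representation\<close>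

lemma reduced_root_divisor:
  assumes np: "norm_pair A B" and deg: "degree A = g"
  shows "reduced f g (root_divisor A B)"
proof -
  have A0: "A \<noteq> 0" using norm_pair_nonzero[OF np] .
  have key: "\<exists>c. P = Affine c (poly B c) \<and> poly A c = 0"
    if "P \<in> Poly_Mapping.keys (root_divisor A B)" for P
    using that A0 by (cases P) (auto simp: in_keys_iff lookup_root_divisor order_root split: if_splits)
  \<comment> \<open>The support consists of the points \<open>(c, poly B c)\<close> over the roots
    of \<open>A\<close>, where \<open>B\<close> is nonzero. So it has no Weierstrass point and at
    most one point in each fibre.\<close>
  have "P \<notin> weierstrass f" if P: "P \<in> Poly_Mapping.keys (root_divisor A B)" for P
    using key[OF P] norm_pair_root(2)[OF np] by (auto simp: weierstrass_def)
  moreover have "invol P \<notin> Poly_Mapping.keys (root_divisor A B)"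
    if P: "P \<in> Poly_Mapping.keys (root_divisor A B)" for P
  proof
    assume Q: "invol P \<in> Poly_Mapping.keys (root_divisor A B)"
    obtain c where c: "P = Affine c (poly B c)" "poly A c = 0" using key[OF P] by blast
    then have "- poly B c = poly B c" using key[OF Q] by auto
    then show False using neq_uminus norm_pair_root(2)[OF np c(2)] by blast
  qed
  ultimately show ?thesis
    unfolding reduced_def genus_f
    using affine_effective_root_divisor[OF np] size_proots_norm_pair[OF np deg]
    by (auto simp: affine_effective_def div_degree_root_divisor)
qed

lemma root_class_mumford:
  assumes r: "r \<in> root_tuples g \<alpha> a b"
  shows "mumford_rep f (root_class r) (U_poly g a r) (V_poly g a r)"
proof -
  let ?U = "U_poly g a r" and ?V = "V_poly g a r" and ?A = "even_part g a r" and ?B = "odd_part g a r"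
  note np = root_tuple_facts(2,3)[OF r]
  obtain cs where cs: "mset cs = proots ?U" using ex_mset by blast
  define qs where "qs = map (\<lambda>c. (c, poly ?V c)) cs"
  have "length cs = size (proots ?U)" by (simp flip: cs)
  then have len: "length qs = g"
    by (simp add: qs_def proots_U_poly size_proots_norm_pair[OF np])
  have red: "reduced f g (root_divisor ?U ?V)"
    unfolding root_divisor_U_V using reduced_root_divisor[OF np] .
  have D: "root_divisor ?U ?V = (\<Sum>(c, d)\<leftarrow>qs. pt_div (Affine c d))"
    unfolding root_divisor_def cs[symmetric] qs_def by (simp add: comp_def flip: sum_mset_sum_list)
  have U1: "lead_coeff ?U = 1" and U0: "?U \<noteq> 0"
  proof -
    show "lead_coeff ?U = 1"
      using np(1) by (simp add: U_poly_scaled norm_pair_def flip: power_mult_distrib)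
    then show "?U \<noteq> 0" by auto
  qed
  have "?U = (\<Prod>c\<in>#proots ?U. [:- c, 1:])" using proots_alg_closed(2)[OF U0] U1 by simp
  then have U: "?U = (\<Prod>(c, d)\<leftarrow>qs. [:- c, 1:])"
    unfolding cs[symmetric] qs_def by (simp add: comp_def flip: prod_mset_prod_list)
  have "?A dvd ?V ^ 2 - f"
  proof -
    \<comment> \<open>Modulo \<open>?A\<close>, the polynomial \<open>?V\<close> is congruent to
      \<open>?B\<close> and \<open>f\<close> to \<open>?B ^ 2\<close>.\<close>
    have "f = ?B ^ 2 + [:- a, 1:] * ?A ^ 2" using np(1) by (simp add: norm_pair_def)
    then have "?V ^ 2 - f = (?B - [:elem_sym (2 * g + 1) r 1:] * ?A) ^ 2 - (?B ^ 2 + [:- a, 1:] * ?A ^ 2)"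
      by (simp add: V_poly_eq mult_pCons_left)
    also have "\<dots> = ?A * ([:elem_sym (2 * g + 1) r 1:] ^ 2 * ?A
        - 2 * [:elem_sym (2 * g + 1) r 1:] * ?B - [:- a, 1:] * ?A)"
      by (simp only: power2_eq_square) (simp only: algebra_simps mult_2)
    finally show ?thesis by simp
  qed
  then have "?U dvd ?V ^ 2 - f" unfolding U_poly_scaled by (simp add: smult_dvd_iff)
  moreover have "\<forall>(c, d)\<in>set qs. d = poly ?V c" by (auto simp: qs_def)
  ultimately show ?thesis
    unfolding mumford_rep_def root_class_def
    using red D len U degree_V_poly[OF g_pos, of a r]
    by (intro exI[of _ g] exI[of _ "root_divisor ?U ?V"] exI[of _ qs]) blast
qed

end

theorem theorem3p2:
  fixes g :: nat and \<alpha> :: "nat \<Rightarrow> 'a::alg_closed_field" and f :: "'a poly" and a b :: 'a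
  assumes "CHAR('a) \<noteq> 2"
    and "g \<ge> 1"
    and "inj_on \<alpha> {1..2*g+1}"
    and "f = (\<Prod>i=1..2*g+1. [:- \<alpha> i, 1:])"
    and "b ^ 2 = poly f a"
  shows "card (halves f (Affine a b)) = 2 ^ (2*g) \<and>
    (\<exists>\<aa>. bij_betw \<aa> (root_tuples g \<alpha> a b) (halves f (Affine a b)) \<and>
      (\<forall>r\<in>root_tuples g \<alpha> a b.
         mumford_rep f (\<aa> r) (U_poly g a r) (V_poly g a r) \<and>
         size (proots (U_poly g a r)) = g \<and>
         (\<forall>c\<in>#proots (U_poly g a r). Affine c (poly (V_poly g a r) c) \<in> curve f) \<and>
         \<aa> r = cl f (root_divisor (U_poly g a r) (V_poly g a r)
                      - Poly_Mapping.single Infinity (int g)) \<and>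
         \<aa> r \<otimes>\<^bsub>jacobian f\<^esub> \<aa> r = embed f (Affine a b) \<and>
         (\<forall>i\<in>{1..2*g+1}. poly (U_poly g a r) (\<alpha> i) \<noteq> 0) \<and>
         coprime (U_poly g a r) f \<and>
         (\<forall>i\<in>{1..2*g+1}.
            r i = elem_sym (2*g+1) r 1
                  + (-1) ^ g * (poly (V_poly g a r) (\<alpha> i) / poly (U_poly g a r) (\<alpha> i)))))"
proof -
  have "\<not> CHAR('a) dvd 2"
  proof
    assume "CHAR('a) dvd 2"
    then have "CHAR('a) \<in> {1, 2}" using prime_nat_iff two_is_prime_nat by blast
    then show False using assms(1) CHAR_not_1 by auto
  qed
  then have "(2 :: 'a) \<noteq> 0" using of_nat_eq_0_iff_char_dvd[of 2, where ?'a = 'a] by simp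
  then interpret halving f g \<alpha> a b using assms(2-5) by unfold_locales
  \<comment> \<open>The number of halves is read off from the tuples, without counting the 2-torsion
    of the jacobian.\<close>
  have "card (halves f (Affine a b)) = 2 ^ (2 * g)"
    using bij_betw_same_card[OF root_class_bij] card_root_tuples by simp
  moreover have "size (proots (U_poly g a r)) = g"
    and "\<forall>c\<in>#proots (U_poly g a r). Affine c (poly (V_poly g a r) c) \<in> curve f"
    and "\<forall>i\<in>{1..2 * g + 1}. poly (U_poly g a r) (\<alpha> i) \<noteq> 0"
    if r: "r \<in> root_tuples g \<alpha> a b" for r
  proof -
    note np = root_tuple_facts(2,3)[OF r]
    show "size (proots (U_poly g a r)) = g"
      unfolding proots_U_poly using size_proots_norm_pair[OF np] .
    show "\<forall>c\<in>#proots (U_poly g a r). Affine c (poly (V_poly g a r) c) \<in> curve f"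
      unfolding proots_U_poly
      using norm_pair_nonzero[OF np(1)] norm_pair_root(1)[OF np(1)] by (simp add: poly_V_poly_root)
    show "\<forall>i\<in>{1..2 * g + 1}. poly (U_poly g a r) (\<alpha> i) \<noteq> 0"
      using root_tuple_eq(2)[OF r] by (simp add: U_poly_root_iff)
  qed
  ultimately show ?thesis
    using root_class_bij root_class_mumford root_class_def root_class_double coprime_U_f root_tuple_eq_U_V
    by (intro conjI exI[of _ root_class] ballI) blast+
qed

end
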